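(* Let $\mathcal{X}$ be a family of matroids. Let $g,h:\mathbb{Z}_+\to\mathbb{Z}_+$ be functions such that for every $M=(E,r)\in\mathcal{X}$ with $|E|=m$, the number of bases of $M$ is at most $g(m)$ and $r(E)\le h(m)$. Then matroid MLOP for $\mathcal{X}$ can be solved in time $O(g(m)\cdot (h(m))!)$. In particular, if $g$ is a polynomial in $m$ and $h$ is bounded by a constant, then matroid MLOP for $\mathcal{X}$ is in P.
   Context: For a matroid $M=(E,r)$ with $|E|=m$ (rank function $r$ monotone, submodular, integer-valued, $r(A)\le|A|$), matroid MLOP asks for $\min_{\sigma}\sum_{i=1}^m r(E_{i,\sigma})$ over bijections $\sigma:E\to\{1,\dots,m\}$, where $E_{i,\sigma}=\{e\in E:\sigma(e)\le i\}$. A basis is a maximal independent set (a set $I$ with $r(I)=|I|$).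
   Formalization: The bound O(g(m)·h(m)!) is proved when the matroid is given by its list of bases; when it is given by a rank oracle, where that bound is false (rank 1, one or two non-loops), an extra factor m^d is added. Membership in P is proved for both. *)

theory Defs
  imports Complex_Main "HOL-Library.Landau_Symbols" "HOL-Computational_Algebra.Polynomial"
begin

section \<open>Matroids and the minimum linear ordering problem\<close>

locale matroid =
  fixes E :: "'a set" and r :: "'a set \<Rightarrow> nat"
  assumes finite_ground: "finite E"
    and rank_le_card: "A \<subseteq> E \<Longrightarrow> r A \<le> card A"
    and rank_mono: "A \<subseteq> B \<Longrightarrow> B \<subseteq> E \<Longrightarrow> r A \<le> r B"
    and rank_submodular: "A \<subseteq> E \<Longrightarrow> B \<subseteq> E \<Longrightarrow> r (A \<union> B) + r (A \<inter> B) \<le> r A + r B"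

definition indep :: "'a set \<Rightarrow> ('a set \<Rightarrow> nat) \<Rightarrow> 'a set \<Rightarrow> bool" where
  "indep E r I \<longleftrightarrow> I \<subseteq> E \<and> r I = card I"

definition bases :: "'a set \<Rightarrow> ('a set \<Rightarrow> nat) \<Rightarrow> 'a set set" where
  "bases E r = {B. indep E r B \<and> (\<forall>I. indep E r I \<and> B \<subseteq> I \<longrightarrow> I = B)}"

definition mlop_cost :: "'a set \<Rightarrow> ('a set \<Rightarrow> nat) \<Rightarrow> ('a \<Rightarrow> nat) \<Rightarrow> nat" where
  "mlop_cost E r \<sigma> = (\<Sum>i = 1..card E. r {e \<in> E. \<sigma> e \<le> i})"

definition mlop :: "'a set \<Rightarrow> ('a set \<Rightarrow> nat) \<Rightarrow> nat" where
  "mlop E r = Min {mlop_cost E r \<sigma> | \<sigma>. bij_betw \<sigma> E {1..card E}}"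


section \<open>Random access programs with queries\<close>

text \<open>
  A structured random access machine. Its memory consists of finitely many named, unbounded
  arrays of natural numbers (a scalar \<open>x\<close> is the cell \<open>x[0]\<close>). Every elementary operation costs
  one unit. The only arithmetic operations are addition and truncated subtraction; one step
  lengthens the numbers in memory by at most one bit, so polynomially many unit-cost steps are
  polynomial time in the usual sense.
\<close>

type_synonym vname = string
type_synonym state = "vname \<Rightarrow> nat \<Rightarrow> nat"
type_synonym answers = "nat set \<Rightarrow> nat"

datatype aexp = N nat | Get vname aexp | Plus aexp aexp | Minus aexp aexp

fun aval :: "aexp \<Rightarrow> state \<Rightarrow> nat" where
  "aval (N n) s = n"
| "aval (Get x a) s = s x (aval a s)"
| "aval (Plus a b) s = aval a s + aval b s"
| "aval (Minus a b) s = aval a s - aval b s"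

fun acost :: "aexp \<Rightarrow> nat" where
  "acost (N n) = 1"
| "acost (Get x a) = acost a + 1"
| "acost (Plus a b) = acost a + acost b + 1"
| "acost (Minus a b) = acost a + acost b + 1"

datatype com =
    SKIP
  | Put vname aexp aexp
  | Query vname aexp vname
  | Seq com com
  | IF aexp com com
  | WHILE aexp com

definition store :: "vname \<Rightarrow> nat \<Rightarrow> nat \<Rightarrow> state \<Rightarrow> state" where
  "store x i v s = s(x := (s x)(i := v))"

text \<open>
  \<open>exec orc c s t s'\<close>: if \<open>orc\<close> answers the queries, program \<open>c\<close> started in memory \<open>s\<close> halts after \<open>t\<close> steps
  in memory \<open>s'\<close>. A guard is true if it is nonzero. \<open>Query x a y\<close> queries the set whose
  indicator vector is the array \<open>y\<close> and writes the answer to \<open>x[a]\<close>.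
\<close>

inductive exec :: "answers \<Rightarrow> com \<Rightarrow> state \<Rightarrow> nat \<Rightarrow> state \<Rightarrow> bool" for orc :: answers where
  Skip: "exec orc SKIP s 1 s"
| Put: "exec orc (Put x a b) s (acost a + acost b + 1) (store x (aval a s) (aval b s) s)"
| Query: "exec orc (Query x a y) s (acost a + 1) (store x (aval a s) (orc {i. s y i \<noteq> 0}) s)"
| Seq: "exec orc c1 s1 t1 s2 \<Longrightarrow> exec orc c2 s2 t2 s3 \<Longrightarrow> exec orc (Seq c1 c2) s1 (t1 + t2) s3"
| IfTrue: "aval a s \<noteq> 0 \<Longrightarrow> exec orc c1 s t s' \<Longrightarrow> exec orc (IF a c1 c2) s (acost a + t + 1) s'"
| IfFalse: "aval a s = 0 \<Longrightarrow> exec orc c2 s t s' \<Longrightarrow> exec orc (IF a c1 c2) s (acost a + t + 1) s'"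
| WhileFalse: "aval a s = 0 \<Longrightarrow> exec orc (WHILE a c) s (acost a + 1) s"
| WhileTrue: "aval a s1 \<noteq> 0 \<Longrightarrow> exec orc c s1 t1 s2 \<Longrightarrow> exec orc (WHILE a c) s2 t2 s3
    \<Longrightarrow> exec orc (WHILE a c) s1 (acost a + t1 + t2 + 1) s3"


section \<open>Matroids as inputs, and solving MLOP\<close>

text \<open>
  In both input formats the ground set is labelled by \<open>0, \<dots>, m - 1\<close>. A matroid has many inputs
  (the labelling and the order of the bases and of their elements are arbitrary), and a program
  has to work on all of them.
\<close>

definition scalar :: "nat \<Rightarrow> nat \<Rightarrow> nat" where
  "scalar n = (\<lambda>_. 0)(0 := n)"

definition array_of :: "nat list \<Rightarrow> nat \<Rightarrow> nat" where
  "array_of xs = (\<lambda>i. if i < length xs then xs ! i else 0)"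

definition basis_list_inputs :: "'a set \<Rightarrow> ('a set \<Rightarrow> nat) \<Rightarrow> (answers \<times> state) set" where
  \<comment> \<open>the list of all bases is written to memory; queries are useless\<close>
  "basis_list_inputs E r =
    {(\<lambda>_. 0, (\<lambda>_ _. 0)(''m'' := scalar (card E), ''k'' := scalar (r E),
                       ''b'' := scalar (length L), ''B'' := array_of (concat L))) | L lab.
      bij_betw lab {..<card E} E \<and>
      (\<forall>xs \<in> set L. distinct xs \<and> set xs \<subseteq> {..<card E}) \<and>
      distinct (map set L) \<and>
      (\<lambda>xs. lab ` set xs) ` set L = bases E r}"

definition rank_oracle_inputs :: "'a set \<Rightarrow> ('a set \<Rightarrow> nat) \<Rightarrow> (answers \<times> state) set" where
  \<comment> \<open>only the number of elements is written to memory; a query returns the rank of a set\<close>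
  "rank_oracle_inputs E r =
    {(\<lambda>A. r (lab ` (A \<inter> {..<card E})), (\<lambda>_ _. 0)(''m'' := scalar (card E))) | lab.
      bij_betw lab {..<card E} E}"

definition mlop_solvable_in_time ::
  "('a set \<Rightarrow> ('a set \<Rightarrow> nat) \<Rightarrow> (answers \<times> state) set)
    \<Rightarrow> ('a set \<times> ('a set \<Rightarrow> nat)) set \<Rightarrow> (nat \<Rightarrow> nat) \<Rightarrow> bool" where
  "mlop_solvable_in_time inputs X T \<longleftrightarrow>
    (\<exists>c. \<forall>(E, r) \<in> X. \<forall>(orc, s) \<in> inputs E r.
      \<exists>t s'. exec orc c s t s' \<and> s' ''out'' 0 = mlop E r \<and> t \<le> T (card E))"

definition mlop_in_P ::
  "('a set \<Rightarrow> ('a set \<Rightarrow> nat) \<Rightarrow> (answers \<times> state) set)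
    \<Rightarrow> ('a set \<times> ('a set \<Rightarrow> nat)) set \<Rightarrow> bool" where
  "mlop_in_P inputs X \<longleftrightarrow>
    (\<exists>T d. mlop_solvable_in_time inputs X T \<and> (\<lambda>m. real (T m)) \<in> O(\<lambda>m. real m ^ d))"

end

theory Submission
  imports Defs "HOL-Library.Nat_Bijection"
begin

text \<open>
  Call \<open>x\<^sub>1, \<dots>, x\<^sub>k\<close> an ordered basis and let \<open>S\<^sub>j = {x\<^sub>1, \<dots>, x\<^sub>j}\<close>. An ordering that lists the
  closures of \<open>S\<^sub>0, S\<^sub>1, \<dots>\<close> one after another costs at most \<open>\<Sum>j<k. m - |cl S\<^sub>j|\<close>, and the greedy
  basis of any ordering shows that no ordering is cheaper than the best such sum. Moreover,
  \<open>m - |cl S\<^sub>j|\<close> is the number of ways to extend \<open>S\<^sub>j\<close> by one element to an independent set. Thus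
  MLOP only depends on the family of independent sets, and it is a shortest path problem in the
  Hasse diagram of this family, from the empty set to the bases.

  Every independent set lies in a basis, so there are at most \<open>2\<^sup>k\<close> times as many of them as bases,
  and \<open>2\<^sup>k (k + 1)\<close> is at most a constant times \<open>k!\<close>. On the random access machine, a set is
  represented by the sum of \<open>2\<^sup>e\<close> over its elements \<open>e\<close>, which is used as an array index. If the
  bases are given, the elements are renumbered in the order of their first occurrence, which keeps
  the powers of two computable by one doubling per new element: the running time must not
  depend on \<open>m\<close>, because there may be many loops.
\<close>

section \<open>MLOP as a shortest path problem\<close>

text \<open>Both costs become comparable once each rank is written as the number of \<open>j\<close>
  below it: after exchanging the sums, MLOP and a chain cost are sums over \<open>j < r E\<close>,
  and the comparison is made separately for each \<open>j\<close>. The bound leaves no room for a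
  scan of the ground set, so closures are never formed. Instead every independent set
  \<open>T\<close> adds one to a counter of \<open>T - {e}\<close> for each \<open>e\<close> in
  \<open>T\<close>; afterwards the counter of \<open>S\<close> is the number of its extensions, and
  loops are never touched. The machine has neither bit operations nor division, so an element cannot
  simply be read off from a code. Each code therefore carries the power of two of one of its
  elements, recorded when the set is first listed. Subtracting it leaves the code of another listed
  set, because the family is closed under subsets, and so a set can be taken apart completely.
  Listing every set after its subsets serves two purposes: it is the order in which the sets can be
  generated, and the order in which the distances can be computed.\<close>

definition ext :: "'a set set \<Rightarrow> 'a set \<Rightarrow> nat" where
  "ext F S = card {x. x \<notin> S \<and> insert x S \<in> F}"

definition chain_cost :: "'a set set \<Rightarrow> 'a list \<Rightarrow> nat" where
  "chain_cost F xs = (\<Sum>j<length xs. ext F (set (take j xs)))"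

text \<open>No condition is put on the prefixes of \<open>xs\<close>. In a family closed under
  subsets they belong to the family as soon as \<open>S\<close> does.\<close>

definition chain_dist :: "'a set set \<Rightarrow> 'a set \<Rightarrow> nat" where
  "chain_dist F S = Min {chain_cost F xs | xs. distinct xs \<and> set xs = S}"

definition chain_opt :: "'a set set \<Rightarrow> nat" where
  "chain_opt F = Min {chain_cost F xs | xs. distinct xs \<and> set xs \<in> F \<and> ext F (set xs) = 0}"

text \<open>The common form of the optimality arguments: each solution of one problem is turned into
  a solution of the other that is no worse.\<close>

lemma Min_eq_if_cofinal:
  fixes A B :: "'a::linorder set"
  assumes "finite A" "finite B" "A \<noteq> {}" "B \<noteq> {}"
    and "\<And>a. a \<in> A \<Longrightarrow> \<exists>b\<in>B. b \<le> a" and "\<And>b. b \<in> B \<Longrightarrow> \<exists>a\<in>A. a \<le> b"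
  shows "Min A = Min B"
proof (rule antisym)
  obtain b where "b \<in> B" "b \<le> Min A" using assms Min_in by blast
  then show "Min B \<le> Min A" using assms(2) Min_le order_trans by blast
  obtain a where "a \<in> A" "a \<le> Min B" using assms Min_in by blast
  then show "Min A \<le> Min B" using assms(1) Min_le order_trans by blast
qed

section \<open>Enumerations of a set and their shortest path recursion\<close>

lemma chain_cost_Nil [simp]: "chain_cost F [] = 0"
  by (simp add: chain_cost_def)

lemma chain_cost_snoc: "chain_cost F (xs @ [x]) = chain_cost F xs + ext F (set xs)"
  by (simp add: chain_cost_def)

lemma finite_chain_costs: "finite S \<Longrightarrow> finite {chain_cost F xs | xs. distinct xs \<and> set xs = S}"
  using finite_subset[of "{xs. distinct xs \<and> set xs = S}" "{xs. set xs \<subseteq> S \<and> distinct xs}"]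
  by (auto simp: setcompr_eq_image intro!: finite_imageI finite_subset_distinct)

lemma chain_dist_le:
  "distinct xs \<Longrightarrow> chain_dist F (set xs) \<le> chain_cost F xs"
  unfolding chain_dist_def by (rule Min_le) (auto intro: finite_chain_costs)

lemma chain_dist_attained:
  assumes "finite S"
  obtains xs where "distinct xs" "set xs = S" "chain_dist F S = chain_cost F xs"
proof -
  have "chain_dist F S \<in> {chain_cost F xs | xs. distinct xs \<and> set xs = S}"
    unfolding chain_dist_def
    by (rule Min_in) (use assms finite_distinct_list in \<open>auto intro: finite_chain_costs\<close>)
  with that show ?thesis by auto
qed

lemma chain_dist_empty [simp]: "chain_dist F {} = 0"
  using chain_dist_le[of "[]" F] by simp

text \<open>Bellman's equation: the last step of an optimal path is split off.\<close>

lemma chain_dist_rec: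
  assumes "finite S" "S \<noteq> {}"
  shows "chain_dist F S = Min ((\<lambda>x. chain_dist F (S - {x}) + ext F (S - {x})) ` S)"
proof (rule Min_eqI[symmetric])
  show "finite ((\<lambda>x. chain_dist F (S - {x}) + ext F (S - {x})) ` S)"
    using assms by simp
  show "chain_dist F S \<le> y" if "y \<in> (\<lambda>x. chain_dist F (S - {x}) + ext F (S - {x})) ` S" for y
  proof -
    from that obtain x where x: "x \<in> S" "y = chain_dist F (S - {x}) + ext F (S - {x})" by auto
    obtain xs where xs: "distinct xs" "set xs = S - {x}" "chain_dist F (S - {x}) = chain_cost F xs"
      using chain_dist_attained[of "S - {x}" F] assms by auto
    have "set (xs @ [x]) = S" using x xs by auto
    then show ?thesis
      using chain_dist_le[of "xs @ [x]" F] x xs by (simp add: chain_cost_snoc)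
  qed
  obtain xs where xs: "distinct xs" "set xs = S" "chain_dist F S = chain_cost F xs"
    using chain_dist_attained[of S F] assms by auto
  then obtain ys x where ys: "xs = ys @ [x]"
    using assms by (metis rev_exhaust set_empty)
  have eq: "S - {x} = set ys" "x \<in> S" using xs ys by auto
  have "chain_dist F (set ys) + ext F (set ys) \<le> chain_dist F S"
    using chain_dist_le[of ys F] xs ys by (simp add: chain_cost_snoc)
  \<comment> \<open>If the prefix \<open>ys\<close> were not optimal for its set, a cheaper
    \<open>zs\<close> followed by \<open>x\<close> would improve the whole path.\<close>
  moreover have "chain_dist F S \<le> chain_dist F (set ys) + ext F (set ys)"
  proof -
    obtain zs where "distinct zs" "set zs = set ys" "chain_dist F (set ys) = chain_cost F zs"
      using chain_dist_attained[of "set ys" F] by auto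
    then show ?thesis
      using chain_dist_le[of "zs @ [x]" F] xs ys eq by (simp add: chain_cost_snoc)
  qed
  ultimately show "chain_dist F S \<in> (\<lambda>x. chain_dist F (S - {x}) + ext F (S - {x})) ` S"
    using eq by (metis (no_types, lifting) antisym image_iff)
qed

lemma chain_opt_eq_Min_dist:
  assumes "finite F" "\<And>S. S \<in> F \<Longrightarrow> finite S" "\<exists>S\<in>F. ext F S = 0"
  shows "chain_opt F = Min (chain_dist F ` {S \<in> F. ext F S = 0})"
  unfolding chain_opt_def
proof (rule Min_eq_if_cofinal)
  have "{chain_cost F xs | xs. distinct xs \<and> set xs \<in> F \<and> ext F (set xs) = 0}
    \<subseteq> (\<Union>S\<in>F. {chain_cost F xs | xs. distinct xs \<and> set xs = S})" by auto
  then show "finite {chain_cost F xs | xs. distinct xs \<and> set xs \<in> F \<and> ext F (set xs) = 0}"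
    using assms by (rule_tac finite_subset) (auto intro!: finite_chain_costs)
  show "{chain_cost F xs | xs. distinct xs \<and> set xs \<in> F \<and> ext F (set xs) = 0} \<noteq> {}"
  proof -
    obtain S where S: "S \<in> F" "ext F S = 0" using assms by auto
    then obtain xs where "set xs = S" "distinct xs" using assms finite_distinct_list by metis
    with S show ?thesis by auto
  qed
  show "\<exists>b\<in>chain_dist F ` {S \<in> F. ext F S = 0}. b \<le> a"
    if "a \<in> {chain_cost F xs | xs. distinct xs \<and> set xs \<in> F \<and> ext F (set xs) = 0}" for a
    using that chain_dist_le by fastforce
  show "\<exists>a\<in>{chain_cost F xs | xs. distinct xs \<and> set xs \<in> F \<and> ext F (set xs) = 0}. a \<le> b"
    if b: "b \<in> chain_dist F ` {S \<in> F. ext F S = 0}" for b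
  proof -
    from b obtain S where S: "S \<in> F" "ext F S = 0" "b = chain_dist F S" by auto
    with assms obtain xs where "distinct xs" "set xs = S" "chain_dist F S = chain_cost F xs"
      using chain_dist_attained[of S F] by auto
    with S show ?thesis by auto
  qed
qed (use assms in auto)

section \<open>Invariance under injective relabelling\<close>

lemma ext_image:
  assumes inj: "inj_on f (\<Union>F)" and S: "S \<in> F"
  shows "ext ((`) f ` F) (f ` S) = ext F S"
proof -
  have "{y. y \<notin> f ` S \<and> insert y (f ` S) \<in> (`) f ` F} = f ` {x. x \<notin> S \<and> insert x S \<in> F}"
  proof safe
    fix y T assume y: "y \<notin> f ` S" and T: "insert y (f ` S) = f ` T" "T \<in> F"
    then obtain x where x: "x \<in> T" "y = f x" by blast
    \<comment> \<open>Injectivity on the whole union makes the preimage of a set unique, so the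
      extension upstairs comes from an extension of \<open>S\<close>.\<close>
    have "f ` insert x S = f ` T" using T x by auto
    then have "insert x S = T"
      using inj_on_image_eq_iff[OF inj, of "insert x S" T] T S x by blast
    with T x y show "y \<in> f ` {x. x \<notin> S \<and> insert x S \<in> F}" by auto
  next
    fix x y assume "x \<notin> S" "insert x S \<in> F" "y \<in> S" "f x = f y"
    with inj S show False by (auto simp: inj_on_def)
  next
    fix x assume "insert x S \<in> F"
    then show "insert (f x) (f ` S) \<in> (`) f ` F" by (metis image_eqI image_insert)
  qed
  moreover have "inj_on f {x. x \<notin> S \<and> insert x S \<in> F}"
    by (rule inj_on_subset[OF inj]) auto
  ultimately show ?thesis unfolding ext_def by (simp add: card_image)
qed

text \<open>Covers both the labelling of the ground set by numbers and the renumbering carried out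
  by the program. Closure under subsets puts every prefix of a chain into \<open>F\<close>, where
  \<open>ext_image\<close> applies.\<close>

lemma chain_opt_image:
  assumes inj: "inj_on f (\<Union>F)" and down: "\<And>S T. T \<in> F \<Longrightarrow> S \<subseteq> T \<Longrightarrow> S \<in> F"
  shows "chain_opt ((`) f ` F) = chain_opt F"
proof -
  have cost: "chain_cost ((`) f ` F) (map f xs) = chain_cost F xs" if "set xs \<in> F" for xs
    unfolding chain_cost_def
    by (auto simp: take_map intro!: sum.cong ext_image[OF inj] down[OF that] dest: in_set_takeD)
  have "{chain_cost ((`) f ` F) ys | ys. distinct ys \<and> set ys \<in> (`) f ` F \<and> ext ((`) f ` F) (set ys) = 0}
      = {chain_cost F xs | xs. distinct xs \<and> set xs \<in> F \<and> ext F (set xs) = 0}" (is "?L = ?R")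
  proof (intro set_eqI iffI)
    fix a assume "a \<in> ?L"
    then obtain ys T where ys: "distinct ys" "T \<in> F" "set ys = f ` T" "ext ((`) f ` F) (f ` T) = 0"
      "a = chain_cost ((`) f ` F) ys" by auto
    have injT: "inj_on f T" using ys inj by (meson Union_upper inj_on_subset)
    define xs where "xs = map (inv_into T f) ys"
    have f: "map f xs = ys" unfolding xs_def
      by (simp add: comp_def) (rule map_idI, use ys in \<open>auto intro: f_inv_into_f\<close>)
    have "set xs = T" using ys injT unfolding xs_def by auto
    moreover have "distinct xs" using f ys distinct_map by blast
    ultimately show "a \<in> ?R" using ys f cost[of xs] ext_image[OF inj, of T] by auto
  next
    fix a assume "a \<in> ?R"
    then obtain xs where xs: "distinct xs" "set xs \<in> F" "ext F (set xs) = 0" "a = chain_cost F xs"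
      by auto
    then have "distinct (map f xs)" using inj by (auto simp: distinct_map intro: inj_on_subset)
    then show "a \<in> ?L"
      using xs cost[of xs] ext_image[OF inj xs(2)] by (auto intro!: exI[of _ "map f xs"])
  qed
  then show ?thesis unfolding chain_opt_def by simp
qed

section \<open>Independence and closure in terms of the rank function\<close>

context matroid
begin

lemma indep_finite: "indep E r I \<Longrightarrow> finite I"
  using finite_ground finite_subset by (auto simp: indep_def)

lemma finite_indeps: "finite (Collect (indep E r))"
  by (rule finite_subset[of _ "Pow E"]) (auto simp: indep_def finite_ground)

lemma rank_empty: "r {} = 0"
  using rank_le_card[of "{}"] by simp

lemma indep_empty: "indep E r {}"
  by (simp add: indep_def rank_empty)

text \<open>Submodularity for \<open>J\<close> and \<open>I - J\<close>: the two ranks must add up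
  to at least \<open>card I\<close>, which leaves neither of them room to be smaller than the
  cardinality.\<close>

lemma indep_subset:
  assumes "indep E r I" "J \<subseteq> I"
  shows "indep E r J"
proof -
  have I: "I \<subseteq> E" "r I = card I" "finite I"
    using assms indep_finite[OF assms(1)] by (simp_all add: indep_def)
  have "r (J \<union> (I - J)) + r (J \<inter> (I - J)) \<le> r J + r (I - J)"
    using I assms by (intro rank_submodular) auto
  moreover have "J \<union> (I - J) = I" "J \<inter> (I - J) = {}" using assms by auto
  moreover have "r (I - J) \<le> card (I - J)" "r J \<le> card J" using I assms by (auto intro: rank_le_card)
  moreover have "card (I - J) = card I - card J" "card J \<le> card I"
    using I assms by (simp_all add: card_Diff_subset finite_subset[OF assms(2)] card_mono)
  ultimately show ?thesis using I assms by (auto simp: indep_def)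
qed

lemma rank_insert_le: "S \<subseteq> E \<Longrightarrow> e \<in> E \<Longrightarrow> r (insert e S) \<le> Suc (r S)"
  using rank_submodular[of S "{e}"] rank_le_card[of "{e}"] by simp

text \<open>\<open>r (insert e S) = r S\<close> says that \<open>e\<close> lies in the closure of
  \<open>S\<close>, so this is monotonicity of the closure. Submodularity is applied to
  \<open>T\<close> and \<open>insert e S\<close>, whose intersection still contains
  \<open>S\<close>.\<close>

lemma rank_insert_eq_mono:
  assumes "S \<subseteq> T" "T \<subseteq> E" "e \<in> E" "r (insert e S) = r S"
  shows "r (insert e T) = r T"
proof -
  have "r (T \<union> insert e S) + r (T \<inter> insert e S) \<le> r T + r (insert e S)"
    using assms by (intro rank_submodular) auto
  moreover have "T \<union> insert e S = insert e T" using assms by auto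
  moreover have "r S \<le> r (T \<inter> insert e S)" using assms by (intro rank_mono) auto
  moreover have "r T \<le> r (insert e T)" using assms by (intro rank_mono) auto
  ultimately show ?thesis using assms by simp
qed

lemma rank_Un_eq:
  assumes "S \<subseteq> E" "A \<subseteq> E" "\<And>e. e \<in> A \<Longrightarrow> r (insert e S) = r S"
  shows "r (S \<union> A) = r S"
proof -
  have "finite A" using assms(2) finite_ground by (rule finite_subset)
  then show ?thesis using assms(2,3)
  proof (induction A)
    case (insert e A)
    then show ?case using rank_insert_eq_mono[of S "S \<union> A" e] assms(1) by simp
  qed simp
qed

lemma indep_insert_iff:
  assumes "indep E r S" "e \<in> E"
  shows "e \<notin> S \<and> indep E r (insert e S) \<longleftrightarrow> r (insert e S) \<noteq> r S"
proof (cases "e \<in> S")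
  case False
  have "r S \<le> r (insert e S)" using assms by (intro rank_mono) (auto simp: indep_def)
  then show ?thesis
    using False assms indep_finite[OF assms(1)] rank_insert_le[of S e] by (auto simp: indep_def)
qed (simp add: insert_absorb)

lemma ext_indep:
  assumes "indep E r S"
  shows "ext (Collect (indep E r)) S = card {e \<in> E. r (insert e S) \<noteq> r S}"
  unfolding ext_def
  by (rule arg_cong[of _ _ card]) (use indep_insert_iff[OF assms] in \<open>auto simp: indep_def\<close>)

text \<open>Without extensions \<open>S\<close> spans \<open>E\<close>; hence maximality of an
  independent set is a matter of its cardinality alone.\<close>

lemma ext_indep_0_iff:
  assumes "indep E r S"
  shows "ext (Collect (indep E r)) S = 0 \<longleftrightarrow> card S = r E"
proof
  have S: "S \<subseteq> E" "r S = card S" using assms by (auto simp: indep_def)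
  show "card S = r E" if "ext (Collect (indep E r)) S = 0"
    using that ext_indep[OF assms] rank_Un_eq[of S E] finite_ground S by (auto simp: Un_absorb1)
  show "ext (Collect (indep E r)) S = 0" if "card S = r E"
  proof -
    have "r (insert e S) = r S" if "e \<in> E" for e
      using rank_mono[of S "insert e S"] rank_mono[of "insert e S" E] S that \<open>card S = r E\<close>
      by (simp add: subset_insertI)
    then have "{e \<in> E. r (insert e S) \<noteq> r S} = {}" by auto
    then show ?thesis using ext_indep[OF assms] by (simp del: Collect_empty_eq)
  qed
qed

lemma bases_iff: "B \<in> bases E r \<longleftrightarrow> indep E r B \<and> card B = r E"
proof
  assume B: "B \<in> bases E r"
  then have "indep E r B" by (simp add: bases_def)
  moreover have "{x. x \<notin> B \<and> indep E r (insert x B)} = {}" using B by (auto simp: bases_def)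
  ultimately show "indep E r B \<and> card B = r E"
    using ext_indep_0_iff[of B] by (simp add: ext_def del: Collect_empty_eq)
next
  assume B: "indep E r B \<and> card B = r E"
  have "I = B" if I: "indep E r I" "B \<subseteq> I" for I
  proof -
    have "card I \<le> card B" using I B rank_mono[of I E] by (simp add: indep_def)
    then show ?thesis using card_seteq[OF indep_finite[OF I(1)] I(2)] by simp
  qed
  with B show "B \<in> bases E r" by (auto simp: bases_def)
qed

lemma indep_subset_basis:
  assumes "indep E r I"
  obtains B where "B \<in> bases E r" "I \<subseteq> B"
proof -
  obtain B where "B \<in> Collect (indep E r)" "I \<subseteq> B" "\<forall>J\<in>Collect (indep E r). B \<subseteq> J \<longrightarrow> B = J"
    using finite_has_maximal2[OF finite_indeps, of I] assms by auto
  then show ?thesis using that[of B] by (auto simp: bases_def)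
qed

lemma indep_iff_subset_basis: "indep E r I \<longleftrightarrow> (\<exists>B\<in>bases E r. I \<subseteq> B)"
  by (meson bases_iff indep_subset indep_subset_basis)

section \<open>Orderings and chains compared layer by layer\<close>

lemma mlop_cost_layers:
  "mlop_cost E r \<sigma> = (\<Sum>j<r E. card {i \<in> {1..card E}. j < r {e \<in> E. \<sigma> e \<le> i}})"
proof -
  \<comment> \<open>Layer-cake formula: a number is the count of all \<open>j\<close> below it, and
    \<open>r E\<close> bounds all ranks that occur.\<close>
  have "r {e \<in> E. \<sigma> e \<le> i} = (\<Sum>j<r E. if j < r {e \<in> E. \<sigma> e \<le> i} then 1 else 0)" for i
  proof -
    have "r {e \<in> E. \<sigma> e \<le> i} \<le> r E" by (rule rank_mono) auto
    then have "{..<r E} \<inter> {j. j < r {e \<in> E. \<sigma> e \<le> i}} = {..<r {e \<in> E. \<sigma> e \<le> i}}" by auto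
    then show ?thesis by (simp add: sum.If_cases)
  qed
  then have "mlop_cost E r \<sigma> = (\<Sum>i = 1..card E. \<Sum>j<r E. if j < r {e \<in> E. \<sigma> e \<le> i} then 1 else 0)"
    unfolding mlop_cost_def by simp
  also have "\<dots> = (\<Sum>j<r E. \<Sum>i = 1..card E. if j < r {e \<in> E. \<sigma> e \<le> i} then 1 else 0)"
    by (rule sum.swap)
  also have "\<dots> = (\<Sum>j<r E. card {i \<in> {1..card E}. j < r {e \<in> E. \<sigma> e \<le> i}})"
  proof (rule sum.cong)
    fix j
    have "{1..card E} \<inter> {i. j < r {e \<in> E. \<sigma> e \<le> i}} = {i \<in> {1..card E}. j < r {e \<in> E. \<sigma> e \<le> i}}"
      by auto
    then show "(\<Sum>i = 1..card E. if j < r {e \<in> E. \<sigma> e \<le> i} then 1 else 0)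
        = card {i \<in> {1..card E}. j < r {e \<in> E. \<sigma> e \<le> i}}"
      by (simp add: sum.If_cases)
  qed simp
  finally show ?thesis .
qed

text \<open>The greedy basis of the ordering. The clause for all earlier \<open>i'\<close> lets one
  list serve every prefix: its first \<open>r {e \<in> E. \<sigma> e \<le> i'}\<close> entries form
  a basis of that prefix.\<close>

lemma greedy_chain:
  assumes \<sigma>: "bij_betw \<sigma> E {1..card E}" and "i \<le> card E"
  shows "\<exists>xs. distinct xs \<and> indep E r (set xs) \<and> length xs = r {e \<in> E. \<sigma> e \<le> i} \<and>
    (\<forall>i'\<le>i. r {e \<in> E. \<sigma> e \<le> i'} \<le> length xs \<and>
      set (take (r {e \<in> E. \<sigma> e \<le> i'}) xs) \<subseteq> {e \<in> E. \<sigma> e \<le> i'})"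
  using \<open>i \<le> card E\<close>
proof (induction i)
  case 0
  have "\<sigma> e \<noteq> 0" if "e \<in> E" for e
    using bij_betwE[OF \<sigma>] that by force
  then have "{e \<in> E. \<sigma> e = 0} = {}" by auto
  then show ?case by (intro exI[of _ "[]"]) (simp add: rank_empty indep_empty del: Collect_empty_eq)
next
  case (Suc i)
  let ?E = "\<lambda>i. {e \<in> E. \<sigma> e \<le> i}"
  from Suc obtain xs where xs: "distinct xs" "indep E r (set xs)" "length xs = r (?E i)"
    "\<And>i'. i' \<le> i \<Longrightarrow> r (?E i') \<le> length xs \<and> set (take (r (?E i')) xs) \<subseteq> ?E i'"
    by auto
  have "Suc i \<in> \<sigma> ` E" using \<sigma> Suc.prems by (auto simp: bij_betw_def)
  then obtain e where e: "e \<in> E" "\<sigma> e = Suc i" by auto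
  have E: "?E (Suc i) = insert e (?E i)"
    using e \<sigma> by (auto simp: le_Suc_eq bij_betw_def inj_on_def)
  have sub: "set xs \<subseteq> ?E i" using xs(3) xs(4)[of i] by simp
  have rk: "r (set xs) = r (?E i)" using xs by (auto simp: indep_def distinct_card)
  show ?case
  proof (cases "r (?E (Suc i)) = r (?E i)")
    case True
    have "r (?E i') \<le> length xs \<and> set (take (r (?E i')) xs) \<subseteq> ?E i'" if "i' \<le> Suc i" for i'
    proof (cases "i' = Suc i")
      case True
      then show ?thesis using \<open>r (?E (Suc i)) = r (?E i)\<close> xs(3) sub by (auto dest!: in_set_takeD)
    qed (use xs(4) that in auto)
    then show ?thesis using xs True by (intro exI[of _ xs]) simp
  next
    case False
    \<comment> \<open>If the greedy set spanned \<open>e\<close>, so would the larger prefix, and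
      the rank would not have grown.\<close>
    have "r (insert e (set xs)) \<noteq> r (set xs)"
      using False rank_insert_eq_mono[of "set xs" "?E i" e] sub e E by auto
    then have new: "e \<notin> set xs" "indep E r (insert e (set xs))"
      using indep_insert_iff[OF xs(2) e(1)] by auto
    have rk': "r (?E (Suc i)) = Suc (length xs)"
      using False E rank_insert_le[of "?E i" e] rank_mono[of "?E i" "insert e (?E i)"] xs(3) e
      by (simp add: subset_insertI)
    have "r (?E i') \<le> length (xs @ [e]) \<and> set (take (r (?E i')) (xs @ [e])) \<subseteq> ?E i'"
      if "i' \<le> Suc i" for i'
    proof (cases "i' = Suc i")
      case True
      then show ?thesis using rk' sub e by auto
    next
      case False
      then show ?thesis using xs(4)[of i'] that by (auto simp: le_Suc_eq)
    qed
    then show ?thesis using xs new rk' by (intro exI[of _ "xs @ [e]"]) simp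
  qed
qed

text \<open>An element outside the closure of the first \<open>j\<close> greedy elements cannot be
  placed before the rank has exceeded \<open>j\<close>. Sending it to its position is thus an
  injection from the \<open>j\<close>-th set of extensions into the \<open>j\<close>-th
  layer.\<close>

lemma chain_cost_le_mlop_cost:
  assumes \<sigma>: "bij_betw \<sigma> E {1..card E}"
  shows "\<exists>xs. distinct xs \<and> indep E r (set xs) \<and> length xs = r E \<and>
    chain_cost (Collect (indep E r)) xs \<le> mlop_cost E r \<sigma>"
proof -
  let ?E = "\<lambda>i. {e \<in> E. \<sigma> e \<le> i}"
  have top: "?E (card E) = E" using \<sigma> by (auto simp: bij_betw_def)
  obtain xs where xs: "distinct xs" "indep E r (set xs)" "length xs = r E"
    "\<And>i. i \<le> card E \<Longrightarrow> set (take (r (?E i)) xs) \<subseteq> ?E i"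
    using greedy_chain[OF \<sigma>, of "card E"] top by auto
  have ind: "indep E r (set (take j xs))" for j
    using xs(2) by (rule indep_subset) (auto dest: in_set_takeD)
  have "ext (Collect (indep E r)) (set (take j xs)) \<le> card {i \<in> {1..card E}. j < r (?E i)}"
    if j: "j < r E" for j
    unfolding ext_indep[OF ind]
  proof (rule card_inj_on_le[of \<sigma>])
    show "inj_on \<sigma> {e \<in> E. r (insert e (set (take j xs))) \<noteq> r (set (take j xs))}"
      using \<sigma> by (auto simp: bij_betw_def inj_on_def)
    show "\<sigma> ` {e \<in> E. r (insert e (set (take j xs))) \<noteq> r (set (take j xs))}
        \<subseteq> {i \<in> {1..card E}. j < r (?E i)}"
    proof (rule image_subsetI, rule ccontr)
      fix e assume e: "e \<in> {e \<in> E. r (insert e (set (take j xs))) \<noteq> r (set (take j xs))}"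
        and "\<sigma> e \<notin> {i \<in> {1..card E}. j < r (?E i)}"
      moreover have i: "\<sigma> e \<in> {1..card E}" using e \<sigma> by (auto simp: bij_betw_def)
      ultimately have le: "r (?E (\<sigma> e)) \<le> j" by auto
      \<comment> \<open>The greedy basis of the prefix ending in \<open>e\<close>. It spans
        \<open>e\<close>, and with at most \<open>j\<close> elements it is contained in
        \<open>take j xs\<close>, which contradicts the choice of \<open>e\<close>.\<close>
      let ?S = "set (take (r (?E (\<sigma> e))) xs)"
      have sub: "?S \<subseteq> ?E (\<sigma> e)" using xs(4) i by auto
      have "r ?S = r (?E (\<sigma> e))"
        using ind[of "r (?E (\<sigma> e))"] xs le j by (auto simp: indep_def distinct_card)
      then have "r (insert e ?S) = r ?S"
        using rank_mono[of "insert e ?S" "?E (\<sigma> e)"] rank_mono[of ?S "insert e ?S"] sub e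
        by fastforce
      moreover have "?S \<subseteq> set (take j xs)" using le by (rule set_take_subset_set_take)
      ultimately show False
        using rank_insert_eq_mono[of ?S "set (take j xs)" e] ind e by (auto simp: indep_def)
    qed
  qed simp
  then have "chain_cost (Collect (indep E r)) xs \<le> mlop_cost E r \<sigma>"
    unfolding chain_cost_def mlop_cost_layers xs(3) by (rule sum_mono) simp
  with xs show ?thesis by auto
qed

lemma ex_monotone_numbering:
  fixes f :: "'a \<Rightarrow> nat"
  assumes "finite A"
  shows "\<exists>\<sigma>. bij_betw \<sigma> A {1..card A} \<and> (\<forall>x\<in>A. \<forall>y\<in>A. \<sigma> x \<le> \<sigma> y \<longrightarrow> f x \<le> f y)"
proof -
  obtain zs where zs: "set zs = A" "distinct zs" using assms finite_distinct_list by auto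
  define ys where "ys = sort_key f zs"
  have ys: "set ys = A" "distinct ys" "length ys = card A" "sorted (map f ys)"
    using zs by (auto simp: ys_def distinct_card[symmetric])
  \<comment> \<open>List positions start at 0 and the numbering at 1, hence
    \<open>i - 1\<close>.\<close>
  have "bij_betw (\<lambda>i. ys ! (i - 1)) {1..card A} A"
  proof (rule bij_betwI'[where f = "\<lambda>i. ys ! (i - 1)"])
    show "\<exists>x\<in>{1..card A}. y = ys ! (x - 1)" if "y \<in> A" for y
    proof -
      from that ys obtain i where "i < length ys" "ys ! i = y" by (metis in_set_conv_nth)
      then show ?thesis using ys by (intro bexI[of _ "Suc i"]) auto
    qed
  qed (use ys in \<open>auto simp: nth_eq_iff_index_eq\<close>)
  note bij = this
  define \<sigma> where "\<sigma> = inv_into {1..card A} (\<lambda>i. ys ! (i - 1))"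
  have \<sigma>: "bij_betw \<sigma> A {1..card A}" "\<And>x. x \<in> A \<Longrightarrow> ys ! (\<sigma> x - 1) = x"
    unfolding \<sigma>_def using bij_betw_inv_into[OF bij] bij_betw_inv_into_right[OF bij] by auto
  have "f x \<le> f y" if "x \<in> A" "y \<in> A" "\<sigma> x \<le> \<sigma> y" for x y
  proof -
    have "\<sigma> x \<in> {1..card A}" "\<sigma> y \<in> {1..card A}" using \<sigma> that by (auto simp: bij_betw_def)
    then have "f (ys ! (\<sigma> x - 1)) \<le> f (ys ! (\<sigma> y - 1))"
      using sorted_nth_mono[OF ys(4), of "\<sigma> x - 1" "\<sigma> y - 1"] ys that by auto
    then show ?thesis using \<sigma> that by simp
  qed
  with \<sigma> show ?thesis by auto
qed

text \<open>Elements are ordered by the first \<open>S j\<close> that spans them. If the rank of a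
  prefix exceeds \<open>j\<close>, then \<open>S j\<close> does not span its last element, since
  otherwise it would span the whole prefix. So the \<open>j\<close>-th layer is covered by the
  positions of extensions of \<open>S j\<close>.\<close>

lemma mlop_cost_le_chain_cost:
  assumes xs: "distinct xs" "indep E r (set xs)" "length xs = r E"
  shows "\<exists>\<sigma>. bij_betw \<sigma> E {1..card E} \<and> mlop_cost E r \<sigma> \<le> chain_cost (Collect (indep E r)) xs"
proof -
  define S where "S j = set (take j xs)" for j
  have ind: "indep E r (S j)" for j
    unfolding S_def using xs(2) by (rule indep_subset) (auto dest: in_set_takeD)
  have mono: "S i \<subseteq> S j" if "i \<le> j" for i j
    unfolding S_def using that by (rule set_take_subset_set_take)
  have SE: "S j \<subseteq> E" for j using ind by (auto simp: indep_def)
  define f where "f e = (LEAST j. r (insert e (S j)) = r (S j))" for e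
  have spanned_iff: "r (insert e (S j)) = r (S j) \<longleftrightarrow> f e \<le> j" if e: "e \<in> E" for e j
  proof
    show "f e \<le> j" if "r (insert e (S j)) = r (S j)"
      unfolding f_def using that by (rule Least_le)
    \<comment> \<open>The complete list is a basis and spans \<open>e\<close>, so the
      \<open>LEAST\<close> in \<open>f e\<close> is attained.\<close>
    have "r (S (r E)) = r E" using xs by (simp add: S_def indep_def distinct_card)
    then have "r (insert e (S (r E))) = r (S (r E))"
      using rank_mono[of "insert e (S (r E))" E] rank_mono[of "S (r E)" "insert e (S (r E))"] SE e
      by (simp add: subset_insertI)
    then have "r (insert e (S (f e))) = r (S (f e))" unfolding f_def by (rule LeastI)
    then show "r (insert e (S j)) = r (S j)" if "f e \<le> j"
      using rank_insert_eq_mono[of "S (f e)" "S j" e] mono[OF that] SE e by auto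
  qed
  obtain \<sigma> where \<sigma>: "bij_betw \<sigma> E {1..card E}"
    and mon: "\<And>x y. x \<in> E \<Longrightarrow> y \<in> E \<Longrightarrow> \<sigma> x \<le> \<sigma> y \<Longrightarrow> f x \<le> f y"
    using ex_monotone_numbering[OF finite_ground, of f] by metis
  let ?E = "\<lambda>i. {e \<in> E. \<sigma> e \<le> i}"
  have "card {i \<in> {1..card E}. j < r (?E i)} \<le> ext (Collect (indep E r)) (S j)"
    if j: "j < r E" for j
    unfolding ext_indep[OF ind]
  proof (rule surj_card_le)
    show "finite {e \<in> E. r (insert e (S j)) \<noteq> r (S j)}" using finite_ground by simp
    show "{i \<in> {1..card E}. j < r (?E i)} \<subseteq> \<sigma> ` {e \<in> E. r (insert e (S j)) \<noteq> r (S j)}"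
    proof
      fix i assume i: "i \<in> {i \<in> {1..card E}. j < r (?E i)}"
      then have "i \<in> \<sigma> ` E" using \<sigma> by (auto simp: bij_betw_def)
      then obtain e where e: "e \<in> E" "i = \<sigma> e" by auto
      have "r (insert e (S j)) \<noteq> r (S j)"
      proof
        assume "r (insert e (S j)) = r (S j)"
        then have "f e \<le> j" using spanned_iff e by blast
        then have "r (insert x (S j)) = r (S j)" if "x \<in> ?E i" for x
          using that mon[of x e] e spanned_iff[of x j] by auto
        then have "r (S j \<union> ?E i) = r (S j)" using SE by (intro rank_Un_eq) auto
        moreover have "r (?E i) \<le> r (S j \<union> ?E i)" using SE by (intro rank_mono) auto
        moreover have "r (S j) = j" using ind[of j] xs j by (auto simp: S_def indep_def distinct_card)
        ultimately show False using i by auto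
      qed
      with e show "i \<in> \<sigma> ` {e \<in> E. r (insert e (S j)) \<noteq> r (S j)}" by auto
    qed
  qed
  then have "mlop_cost E r \<sigma> \<le> chain_cost (Collect (indep E r)) xs"
    unfolding chain_cost_def mlop_cost_layers xs(3) S_def by (rule sum_mono) simp
  with \<sigma> show ?thesis by auto
qed

lemma mlop_eq_chain_opt: "mlop E r = chain_opt (Collect (indep E r))"
proof -
  let ?F = "Collect (indep E r)"
  have eq: "chain_opt ?F = Min {chain_cost ?F xs | xs. distinct xs \<and> indep E r (set xs) \<and> length xs = r E}"
    unfolding chain_opt_def
    by (rule arg_cong[of _ _ Min]) (use ext_indep_0_iff in \<open>auto simp: distinct_card\<close>)
  show ?thesis unfolding eq mlop_def
  proof (rule Min_eq_if_cofinal)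
    \<comment> \<open>Bijections may differ arbitrarily outside \<open>E\<close>, so there can be
      infinitely many of them; their costs are finitely many because they are bounded.\<close>
    have "mlop_cost E r \<sigma> \<le> card E * r E" for \<sigma>
      unfolding mlop_cost_def
      using sum_bounded_above[of "{1..card E}" "\<lambda>i. r {e \<in> E. \<sigma> e \<le> i}" "r E"]
      by (simp add: rank_mono)
    then show "finite {mlop_cost E r \<sigma> | \<sigma>. bij_betw \<sigma> E {1..card E}}"
      by (intro finite_subset[OF _ finite_atMost[of "card E * r E"]]) auto
    have "{xs. distinct xs \<and> indep E r (set xs) \<and> length xs = r E} \<subseteq> {xs. set xs \<subseteq> E \<and> distinct xs}"
      by (auto simp: indep_def)
    then have "finite {xs. distinct xs \<and> indep E r (set xs) \<and> length xs = r E}"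
      using finite_subset finite_subset_distinct[OF finite_ground] by blast
    then show "finite {chain_cost ?F xs | xs. distinct xs \<and> indep E r (set xs) \<and> length xs = r E}"
      by (auto simp: setcompr_eq_image)
    obtain \<sigma> where \<sigma>: "bij_betw \<sigma> E {1..card E}" 
      using ex_monotone_numbering[OF finite_ground] by blast
    then show "{mlop_cost E r \<sigma> | \<sigma>. bij_betw \<sigma> E {1..card E}} \<noteq> {}" by auto
    from chain_cost_le_mlop_cost[OF \<sigma>]
    show "{chain_cost ?F xs | xs. distinct xs \<and> indep E r (set xs) \<and> length xs = r E} \<noteq> {}" by auto
    show "\<exists>b\<in>{chain_cost ?F xs | xs. distinct xs \<and> indep E r (set xs) \<and> length xs = r E}. b \<le> a"
      if "a \<in> {mlop_cost E r \<sigma> | \<sigma>. bij_betw \<sigma> E {1..card E}}" for a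
    proof -
      from that obtain \<sigma> where "bij_betw \<sigma> E {1..card E}" "a = mlop_cost E r \<sigma>" by auto
      with chain_cost_le_mlop_cost[of \<sigma>] show ?thesis by auto
    qed
    show "\<exists>a\<in>{mlop_cost E r \<sigma> | \<sigma>. bij_betw \<sigma> E {1..card E}}. a \<le> b"
      if "b \<in> {chain_cost ?F xs | xs. distinct xs \<and> indep E r (set xs) \<and> length xs = r E}" for b
    proof -
      from that obtain xs where "distinct xs" "indep E r (set xs)" "length xs = r E"
        "b = chain_cost ?F xs" by auto
      with mlop_cost_le_chain_cost[of xs] show ?thesis by auto
    qed
  qed
qed

end

section \<open>Timed weakest preconditions\<close>

text \<open>Total correctness, with the running time passed to the postcondition. An existential
  over runs suffices, since \<open>mlop_solvable_in_time\<close> asks for a halting run.\<close>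

definition wp :: "answers \<Rightarrow> com \<Rightarrow> (nat \<Rightarrow> state \<Rightarrow> bool) \<Rightarrow> state \<Rightarrow> bool" where
  "wp orc c R s \<longleftrightarrow> (\<exists>t s'. exec orc c s t s' \<and> R t s')"

inductive_cases SkipE: "exec orc SKIP s t s'"
inductive_cases PutE: "exec orc (Put x a b) s t s'"
inductive_cases QueryE: "exec orc (Query x a y) s t s'"
inductive_cases SeqE: "exec orc (Seq c1 c2) s t s'"
inductive_cases IfE: "exec orc (IF a c1 c2) s t s'"

lemma store_apply: "store x i v s y = (if y = x then (s x)(i := v) else s y)"
  by (simp add: store_def)

lemma wp_mono: "wp orc c R s \<Longrightarrow> (\<And>t s'. R t s' \<Longrightarrow> R' t s') \<Longrightarrow> wp orc c R' s"
  by (auto simp: wp_def)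

lemma wp_Skip [simp]: "wp orc SKIP R s \<longleftrightarrow> R 1 s"
  unfolding wp_def by (metis exec.Skip SkipE)

lemma wp_Put [simp]:
  "wp orc (Put x a b) R s \<longleftrightarrow> R (acost a + acost b + 1) (store x (aval a s) (aval b s) s)"
  unfolding wp_def by (metis exec.Put PutE)

lemma wp_Query [simp]:
  "wp orc (Query x a y) R s \<longleftrightarrow> R (acost a + 1) (store x (aval a s) (orc {i. s y i \<noteq> 0}) s)"
  unfolding wp_def by (metis exec.Query QueryE)

lemma wp_Seq [simp]:
  "wp orc (Seq c1 c2) R s \<longleftrightarrow> wp orc c1 (\<lambda>t1. wp orc c2 (\<lambda>t2. R (t1 + t2))) s"
  unfolding wp_def by (blast intro: exec.Seq elim: SeqE)

lemma wp_If [simp]: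
  "wp orc (IF a c1 c2) R s \<longleftrightarrow>
    (if aval a s \<noteq> 0 then wp orc c1 (\<lambda>t. R (acost a + t + 1)) s
     else wp orc c2 (\<lambda>t. R (acost a + t + 1)) s)"
    unfolding wp_def
proof (cases "aval a s = 0")
  case True
  have "exec orc (IF a c1 c2) s t s' \<longleftrightarrow> (\<exists>t'. t = acost a + t' + 1 \<and> exec orc c2 s t' s')" for t s'
    by (rule iffI, erule IfE) (use True in \<open>auto dest: exec.IfFalse[OF True, of orc c2 _ _ c1]\<close>)
  then show "(\<exists>t s'. exec orc (IF a c1 c2) s t s' \<and> R t s') =
      (if aval a s \<noteq> 0 then \<exists>t s'. exec orc c1 s t s' \<and> R (acost a + t + 1) s'
       else \<exists>t s'. exec orc c2 s t s' \<and> R (acost a + t + 1) s')"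
    using True by auto
next
  case False
  have "exec orc (IF a c1 c2) s t s' \<longleftrightarrow> (\<exists>t'. t = acost a + t' + 1 \<and> exec orc c1 s t' s')" for t s'
    by (rule iffI, erule IfE) (use False in \<open>auto dest: exec.IfTrue[OF False, of orc c1 _ _ c2]\<close>)
  then show "(\<exists>t s'. exec orc (IF a c1 c2) s t s' \<and> R t s') =
      (if aval a s \<noteq> 0 then \<exists>t s'. exec orc c1 s t s' \<and> R (acost a + t + 1) s'
       else \<exists>t s'. exec orc c2 s t s' \<and> R (acost a + t + 1) s')"
    using False by auto
qed

text \<open>The invariant is indexed by the number of completed rounds and \<open>M\<close> is fixed
  beforehand. The index gives termination, and the time of a round may vary with it.\<close>

lemma wp_While:
  assumes "I 0 s"
    and "\<And>j s. j < M \<Longrightarrow> I j s \<Longrightarrow> aval a s \<noteq> 0 \<and> wp orc c (\<lambda>t s'. t \<le> tb j \<and> I (Suc j) s') s"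
    and "\<And>s. I M s \<Longrightarrow> aval a s = 0"
  shows "wp orc (WHILE a c) (\<lambda>t s'. t \<le> (\<Sum>j<M. tb j + acost a + 1) + acost a + 1 \<and> I M s') s"
proof -
  have "wp orc (WHILE a c) (\<lambda>t s'. t \<le> (\<Sum>j=i..<M. tb j + acost a + 1) + acost a + 1 \<and> I M s') s"
    if "i \<le> M" "I i s" for i s
    using that
  proof (induction i arbitrary: s rule: inc_induct)
    case base
    then show ?case
      using assms(3)[of s] exec.WhileFalse[of a s orc c] by (auto simp: wp_def)
  next
    case (step i)
    obtain t1 s1 where 1: "aval a s \<noteq> 0" "exec orc c s t1 s1" "t1 \<le> tb i" "I (Suc i) s1"
      using assms(2)[OF step.hyps(2) step.prems] by (auto simp: wp_def)
    obtain t2 s2 where 2: "exec orc (WHILE a c) s1 t2 s2" "I M s2"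
        "t2 \<le> (\<Sum>j=Suc i..<M. tb j + acost a + 1) + acost a + 1"
      using step.IH[OF 1(4)] by (auto simp: wp_def)
    have "exec orc (WHILE a c) s (acost a + t1 + t2 + 1) s2"
      using 1 2 by (blast intro: exec.WhileTrue)
    moreover have "acost a + t1 + t2 + 1 \<le> (\<Sum>j=i..<M. tb j + acost a + 1) + acost a + 1"
      using 1 2 step.hyps by (simp add: sum.atLeast_Suc_lessThan)
    ultimately show ?case using 2(2) unfolding wp_def by blast
  qed
  from this[of 0 s] assms(1) show ?thesis by (simp add: atLeast0LessThan)
qed

abbreviation seq :: "com \<Rightarrow> com \<Rightarrow> com" (infixr ";;" 60) where
  "c1 ;; c2 \<equiv> Seq c1 c2"

abbreviation var :: "vname \<Rightarrow> aexp" where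
  "var x \<equiv> Get x (N 0)"

abbreviation assign :: "vname \<Rightarrow> aexp \<Rightarrow> com" (infix "::=" 61) where
  "x ::= a \<equiv> Put x (N 0) a"

text \<open>Truncated subtraction makes the guard nonzero exactly while \<open>i < n\<close>. The
  bound is read again in every round, so a body must leave it unchanged; loops that append to a list
  run up to a saved copy of its length.\<close>

definition FOR :: "vname \<Rightarrow> vname \<Rightarrow> com \<Rightarrow> com" where
  "FOR i n c = i ::= N 0 ;; WHILE (Minus (var n) (var i)) (c ;; i ::= Plus (var i) (N 1))"

text \<open>The 12 per round are 6 for the increment and 6 for the test; the 9 are 3 for the
  initialisation and 6 for the last test. The invariant refers to the memory in which the counter is
  already advanced.\<close>

lemma wp_FOR:
  assumes "i \<noteq> n" "s n 0 = M" "I 0 (store i 0 0 s)"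
    and "\<And>j s. j < M \<Longrightarrow> I j s \<Longrightarrow> s i 0 = j \<Longrightarrow> s n 0 = M \<Longrightarrow>
      wp orc c (\<lambda>t s'. t \<le> tb j \<and> I (Suc j) (store i 0 (Suc j) s') \<and> s' i 0 = j \<and> s' n 0 = M) s"
  shows "wp orc (FOR i n c) (\<lambda>t s'. t \<le> (\<Sum>j<M. tb j + 12) + 9 \<and> I M s' \<and> s' n 0 = M) s"
proof -
  have "wp orc (WHILE (Minus (var n) (var i)) (c ;; i ::= Plus (var i) (N 1)))
     (\<lambda>t s'. t \<le> (\<Sum>j<M. tb j + 6 + acost (Minus (var n) (var i)) + 1) + acost (Minus (var n) (var i)) + 1
        \<and> (I M s' \<and> s' i 0 = M \<and> s' n 0 = M)) (store i 0 0 s)"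
  proof (rule wp_While[where I = "\<lambda>j s. I j s \<and> s i 0 = j \<and> s n 0 = M"])
    fix j s' assume j: "j < M" and I: "I j s' \<and> s' i 0 = j \<and> s' n 0 = M"
    have "wp orc (c ;; i ::= Plus (var i) (N 1))
        (\<lambda>t s'. t \<le> tb j + 6 \<and> I (Suc j) s' \<and> s' i 0 = Suc j \<and> s' n 0 = M) s'"
      using I assms(1) by (auto intro!: wp_mono[OF assms(4)[OF j]] simp: store_def)
    then show "aval (Minus (var n) (var i)) s' \<noteq> 0 \<and> wp orc (c ;; i ::= Plus (var i) (N 1))
        (\<lambda>t s'. t \<le> tb j + 6 \<and> I (Suc j) s' \<and> s' i 0 = Suc j \<and> s' n 0 = M) s'"
      using j I by simp
  qed (use assms in \<open>auto simp: store_def\<close>)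
  then show ?thesis
    unfolding FOR_def by (auto elim!: wp_mono simp: algebra_simps)
qed

section \<open>Shortest paths over a list of set codes\<close>

lemma set_encode_eq_0_iff: "finite T \<Longrightarrow> set_encode T = 0 \<longleftrightarrow> T = {}"
  using set_encode_eq[of T "{}"] by simp

lemma set_encode_remove: "finite T \<Longrightarrow> e \<in> T \<Longrightarrow> set_encode T - 2 ^ e = set_encode (T - {e})"
  using set_encode_insert[of "T - {e}" e] by (simp add: insert_absorb)

text \<open>The body runs before the subtraction, so it finds the power of two of the current
  element in \<open>V[x]\<close>.\<close>

definition chain_loop :: "com \<Rightarrow> com" where
  "chain_loop c = WHILE (var ''x'') (c ;; ''x'' ::= Minus (var ''x'') (Get ''V'' (var ''x'')))"

text \<open>\<open>Z\<close> is the set of elements already removed. Their order is dictated by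
  \<open>V\<close>, hence an invariant indexed by sets. The 11 per element are 8 for the subtraction
  and 3 for the test.\<close>

lemma wp_chain_loop:
  assumes T: "finite T" and V: "\<And>R. R \<subseteq> T \<Longrightarrow> R \<noteq> {} \<Longrightarrow> \<exists>e\<in>R. s ''V'' (set_encode R) = 2 ^ e"
    and x: "s ''x'' 0 = set_encode T" and I: "I {} s"
    and body: "\<And>Z e s'. Z \<subseteq> T \<Longrightarrow> e \<in> T \<Longrightarrow> e \<notin> Z \<Longrightarrow> I Z s' \<Longrightarrow> s' ''V'' = s ''V'' \<Longrightarrow>
      s ''V'' (set_encode (T - Z)) = 2 ^ e \<Longrightarrow> s' ''x'' 0 = set_encode (T - Z) \<Longrightarrow>
      wp orc c (\<lambda>t s''. t \<le> tb \<and> I (insert e Z) (store ''x'' 0 (set_encode (T - insert e Z)) s'') \<and>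
        s'' ''V'' = s' ''V'' \<and> s'' ''x'' 0 = s' ''x'' 0) s'"
  shows "wp orc (chain_loop c) (\<lambda>t s'. t \<le> card T * (tb + 11) + 3 \<and> I T s') s"
proof -
  let ?I = "\<lambda>j s'. \<exists>Z\<subseteq>T. card Z = j \<and> I Z s' \<and> s' ''V'' = s ''V'' \<and> s' ''x'' 0 = set_encode (T - Z)"
  let ?c = "c ;; ''x'' ::= Minus (var ''x'') (Get ''V'' (var ''x''))"
  have "wp orc (WHILE (var ''x'') ?c)
     (\<lambda>t s'. t \<le> (\<Sum>j<card T. tb + 8 + acost (var ''x'') + 1) + acost (var ''x'') + 1 \<and> ?I (card T) s') s"
  proof (rule wp_While)
    show "?I 0 s" using I x by (intro exI[of _ "{}"]) simp
  next
    fix j s1 assume j: "j < card T" and "?I j s1"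
    then obtain Z where Z: "Z \<subseteq> T" "card Z = j" "I Z s1" "s1 ''V'' = s ''V''"
      "s1 ''x'' 0 = set_encode (T - Z)" by auto
    have fin: "finite Z" using Z T finite_subset by blast
    have ne: "T - Z \<noteq> {}" using Z j T by (metis Diff_eq_empty_iff card_mono fin not_le)
    obtain e where e: "e \<in> T" "e \<notin> Z" "s ''V'' (set_encode (T - Z)) = 2 ^ e"
      using V[of "T - Z"] ne by auto
    have eq: "set_encode (T - Z) - 2 ^ e = set_encode (T - insert e Z)"
      using set_encode_remove[of "T - Z" e] T e by (metis Diff_insert DiffI finite_Diff)
    have "wp orc ?c (\<lambda>t s'. t \<le> tb + 8 \<and> ?I (Suc j) s') s1"
      unfolding wp_Seq
    proof (rule wp_mono[OF body[OF Z(1) e(1,2) Z(3,4) e(3) Z(5)]])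
      fix t s' assume s': "t \<le> tb \<and> I (insert e Z) (store ''x'' 0 (set_encode (T - insert e Z)) s') \<and>
        s' ''V'' = s1 ''V'' \<and> s' ''x'' 0 = s1 ''x'' 0"
      have "?I (Suc j) (store ''x'' 0 (set_encode (T - insert e Z)) s')"
        using s' Z e fin by (intro exI[of _ "insert e Z"]) (simp add: store_def)
      then show "wp orc (''x'' ::= Minus (var ''x'') (Get ''V'' (var ''x'')))
          (\<lambda>t2 s'. t + t2 \<le> tb + 8 \<and> ?I (Suc j) s') s'"
        using s' Z e eq by simp
    qed
    then show "aval (var ''x'') s1 \<noteq> 0 \<and> wp orc ?c (\<lambda>t s'. t \<le> tb + 8 \<and> ?I (Suc j) s') s1"
      using Z ne T by (simp add: set_encode_eq_0_iff)
  next
    fix s1 assume "?I (card T) s1"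
    then show "aval (var ''x'') s1 = 0" using T by (auto dest: card_subset_eq)
  qed
  then show ?thesis
    unfolding chain_loop_def
    by (rule wp_mono) (use T in \<open>auto dest: card_subset_eq simp: algebra_simps\<close>)
qed

text \<open>A topological order of the Hasse diagram: all lower neighbours of a set precede
  it.\<close>

definition down_ordered :: "'a set list \<Rightarrow> bool" where
  "down_ordered qs \<longleftrightarrow> (\<forall>p<length qs. \<forall>e\<in>qs ! p. qs ! p - {e} \<in> set (take p qs))"

lemma down_ordered_snoc:
  "down_ordered (qs @ [T]) \<longleftrightarrow> down_ordered qs \<and> (\<forall>e\<in>T. T - {e} \<in> set qs)"
  by (auto simp: down_ordered_def nth_append less_Suc_eq)

lemma down_ordered_subset:
  assumes "down_ordered qs" "T \<in> set qs" "finite T" "R \<subseteq> T"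
  shows "R \<in> set qs"
  using assms(3,2,4)
proof (induction T rule: finite_psubset_induct)
  case (psubset T)
  show ?case
  proof (cases "R = T")
    case False
    then obtain e where e: "e \<in> T" "e \<notin> R" using psubset.prems by auto
    obtain p where "p < length qs" "qs ! p = T" using psubset.prems by (metis in_set_conv_nth)
    then have "T - {e} \<in> set qs"
      using assms(1) e by (auto simp: down_ordered_def dest: in_set_takeD)
    then show ?thesis using psubset.IH[of "T - {e}"] e psubset.prems by auto
  qed (use psubset in auto)
qed

text \<open>
  The array \<open>Q\<close> holds the codes of the listed sets. For a listed nonempty set, \<open>V\<close> holds the code of
  one of its elements, so that a set can be taken apart by following \<open>V\<close>; \<open>V\<close> is zero elsewhere
  and thus also serves as a membership test.
\<close>

definition listed :: "nat set list \<Rightarrow> state \<Rightarrow> bool" where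
  "listed qs s \<longleftrightarrow> distinct qs \<and> (\<forall>T\<in>set qs. finite T) \<and> {} \<in> set qs \<and> down_ordered qs \<and>
    s ''n'' 0 = length qs \<and> (\<forall>p<length qs. s ''Q'' p = set_encode (qs ! p)) \<and>
    (\<forall>T. finite T \<longrightarrow> (if T \<in> set qs \<and> T \<noteq> {} then \<exists>e\<in>T. s ''V'' (set_encode T) = 2 ^ e
                       else s ''V'' (set_encode T) = 0))"

text \<open>Supplies the assumption on \<open>V\<close> in \<open>wp_chain_loop\<close>: all
  remainders that occur while a listed set is taken apart are listed as well.\<close>

lemma listed_chain:
  assumes "listed qs s" "T \<in> set qs" "R \<subseteq> T" "R \<noteq> {}"
  shows "\<exists>e\<in>R. s ''V'' (set_encode R) = 2 ^ e"
proof -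
  have "finite T" "down_ordered qs" using assms by (auto simp: listed_def)
  then have "R \<in> set qs" "finite R"
    using assms down_ordered_subset finite_subset by blast+
  then show ?thesis using assms by (auto simp: listed_def)
qed

section \<open>Counting the one-element extensions\<close>

definition count_body :: com where
  "count_body = ''y'' ::= Minus (var ''c'') (Get ''V'' (var ''x'')) ;;
    Put ''X'' (var ''y'') (Plus (Get ''X'' (var ''y'')) (N 1))"

definition count_extensions :: com where
  "count_extensions = FOR ''i'' ''n''
    (''c'' ::= Get ''Q'' (var ''i'') ;; ''x'' ::= var ''c'' ;;
     chain_loop count_body)"

text \<open>\<open>T\<close> is an extension of exactly its lower neighbours, of each by a single
  element. So extension numbers can be maintained by increments while the list is scanned.\<close>

lemma ext_insert:
  assumes "finite T" "T \<notin> F" 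
    and "finite {x. x \<notin> S \<and> insert x S \<in> F}"
  shows "ext (insert T F) S = ext F S + (if \<exists>x\<in>T. S = T - {x} then 1 else 0)"
proof (cases "\<exists>x\<in>T. S = T - {x}")
  case True
  then obtain x where x: "x \<in> T" "S = T - {x}" by auto
  then have "{y. y \<notin> S \<and> insert y S \<in> insert T F} = insert x {y. y \<notin> S \<and> insert y S \<in> F}"
    by auto
  moreover have "insert x S \<notin> F" using x assms by (simp add: insert_absorb)
  ultimately show ?thesis using True assms by (simp add: ext_def)
next
  case False
  then have "{y. y \<notin> S \<and> insert y S \<in> insert T F} = {y. y \<notin> S \<and> insert y S \<in> F}"
    by auto
  then show ?thesis using False by (simp add: ext_def)
qed

lemma finite_extensions:
  "finite F \<Longrightarrow> (\<And>T. T \<in> F \<Longrightarrow> finite T) \<Longrightarrow> finite {x. x \<notin> S \<and> insert x S \<in> F}"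
  by (rule finite_subset[of _ "\<Union>F"]) auto

lemma wp_count_extensions:
  assumes listed: "listed qs s" and X: "\<And>i. s ''X'' i = 0" and k: "\<And>T. T \<in> set qs \<Longrightarrow> card T \<le> k"
  shows "wp orc count_extensions (\<lambda>t s'. t \<le> length qs * (k * 40 + 40) + 9 \<and>
    (\<forall>S. finite S \<longrightarrow> s' ''X'' (set_encode S) = ext (set qs) S) \<and>
    (\<forall>v. v \<notin> {''i'', ''c'', ''x'', ''y'', ''X''} \<longrightarrow> s' v = s v)) s"
proof -
  have fin: "finite T" if "T \<in> set qs" for T using listed that by (auto simp: listed_def)
  let ?I = "\<lambda>j s'. (\<forall>S. finite S \<longrightarrow> s' ''X'' (set_encode S) = ext (set (take j qs)) S) \<and>
    (\<forall>v. v \<notin> {''i'', ''c'', ''x'', ''y'', ''X''} \<longrightarrow> s' v = s v)"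
  have "wp orc count_extensions (\<lambda>t s'. t \<le> (\<Sum>j<length qs. (k * 40 + 28) + 12) + 9 \<and> ?I (length qs) s' \<and>
      s' ''n'' 0 = length qs) s"
    unfolding count_extensions_def
  proof (rule wp_FOR[where I = ?I and tb = "\<lambda>_. k * 40 + 28"])
    show "s ''n'' 0 = length qs" using listed by (simp add: listed_def)
    show "?I 0 (store ''i'' 0 0 s)" using X by (simp add: store_def ext_def)
    fix j s1 assume j: "j < length qs" and I: "?I j s1" and i: "s1 ''i'' 0 = j"
      and n: "s1 ''n'' 0 = length qs"
    define T where "T = qs ! j"
    have T: "T \<in> set qs" "finite T" using j fin by (auto simp: T_def)
    have QV: "s1 ''Q'' = s ''Q''" "s1 ''V'' = s ''V''" using I by auto
    have Q: "s1 ''Q'' j = set_encode T" using QV listed j by (simp add: listed_def T_def)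
    define s2 where "s2 = store ''x'' 0 (set_encode T) (store ''c'' 0 (set_encode T) s1)"
    let ?J = "\<lambda>Z s'. (\<forall>S. finite S \<longrightarrow> s' ''X'' (set_encode S)
         = ext (set (take j qs)) S + (if \<exists>x\<in>Z. S = T - {x} then 1 else 0)) \<and>
       s' ''c'' 0 = set_encode T \<and> s' ''i'' 0 = j \<and> (\<forall>v. v \<notin> {''i'', ''c'', ''x'', ''y'', ''X''} \<longrightarrow> s' v = s v)"
    have "wp orc (chain_loop count_body)
       (\<lambda>t s'. t \<le> card T * (16 + 11) + 3 \<and> ?J T s') s2"
    proof (rule wp_chain_loop[where I = ?J])
      show "?J {} s2" using I i by (simp add: s2_def store_def)
      show "\<exists>e\<in>R. s2 ''V'' (set_encode R) = 2 ^ e" if "R \<subseteq> T" "R \<noteq> {}" for R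
        using listed_chain[OF listed T(1) that] QV by (simp add: s2_def store_def)
      fix Z e s3 assume Z: "Z \<subseteq> T" "e \<in> T" "e \<notin> Z" and J: "?J Z s3"
        and V: "s3 ''V'' = s2 ''V''" "s2 ''V'' (set_encode (T - Z)) = 2 ^ e"
        and x: "s3 ''x'' 0 = set_encode (T - Z)"
      \<comment> \<open>\<open>c\<close> still holds the code of all of \<open>T\<close>, so
        \<open>y\<close> addresses \<open>T\<close> without the current element and not the
        remainder of the loop.\<close>
      have e: "set_encode T - 2 ^ e = set_encode (T - {e})" using T Z by (simp add: set_encode_remove)
      \<comment> \<open>Different elements give different cells, so \<open>T\<close> raises no cell
        twice.\<close>
      have "T - {e} \<noteq> T - {x}" if "x \<in> Z" for x using that Z by auto
      then show "wp orc count_body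
        (\<lambda>t s''. t \<le> 16 \<and> ?J (insert e Z) (store ''x'' 0 (set_encode (T - insert e Z)) s'') \<and>
        s'' ''V'' = s3 ''V'' \<and> s'' ''x'' 0 = s3 ''x'' 0) s3"
        using J V x T Z by (auto simp: count_body_def store_def e set_encode_eq)
    qed (use T in \<open>simp_all add: s2_def store_def\<close>)
    note loop = this
    have ext_Suc: "ext (set (take (Suc j) qs)) S
        = ext (set (take j qs)) S + (if \<exists>x\<in>T. S = T - {x} then 1 else 0)" for S
    proof -
      have "T \<notin> set (take j qs)"
        using listed j by (auto simp: listed_def T_def in_set_conv_nth nth_eq_iff_index_eq)
      moreover have "finite {x. x \<notin> S \<and> insert x S \<in> set (take j qs)}"
        by (rule finite_extensions) (auto dest: in_set_takeD intro: fin)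
      ultimately show ?thesis
        using ext_insert[of T "set (take j qs)" S] T(2) j by (simp add: take_Suc_conv_app_nth T_def)
    qed
    have card: "card T * 27 \<le> k * 40" using k[OF T(1)] by (intro mult_le_mono) auto
    show "wp orc (''c'' ::= Get ''Q'' (var ''i'') ;; ''x'' ::= var ''c'' ;;
     chain_loop count_body)
       (\<lambda>t s'. t \<le> k * 40 + 28 \<and> ?I (Suc j) (store ''i'' 0 (Suc j) s') \<and> s' ''i'' 0 = j \<and>
          s' ''n'' 0 = length qs) s1"
      by (simp add: i Q store_apply s2_def[symmetric], rule wp_mono[OF loop])
        (use card n I ext_Suc in \<open>auto simp: store_apply listed_def\<close>)
  qed simp
  then show ?thesis by (rule wp_mono) (simp add: algebra_simps)
qed

text \<open>Minima are stored shifted by one, since zero in fresh memory has to stand for no value.\<close>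

definition opt_min :: "nat set \<Rightarrow> nat" where
  "opt_min A = (if A = {} then 0 else Suc (Min A))"

lemma opt_min_empty [simp]: "opt_min {} = 0"
  by (simp add: opt_min_def)

text \<open>With truncated subtraction, \<open>m - (m - a)\<close> is the minimum of
  \<open>m\<close> and \<open>a\<close>. The zero case is the one where no value has been stored
  yet.\<close>

lemma opt_min_insert:
  assumes "finite A"
  shows "opt_min (insert a A) = (if opt_min A = 0 then Suc a else opt_min A - (opt_min A - Suc a))"
proof -
  have "Suc (min a m) = Suc m - (Suc m - Suc a)" for m
    by (simp add: min_def)
  then show ?thesis
    using assms unfolding opt_min_def by (cases "A = {}") (simp_all add: Min_insert)
qed

section \<open>The shortest path computation\<close>

definition min_into :: "vname \<Rightarrow> aexp \<Rightarrow> aexp \<Rightarrow> com" where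
  "min_into x a b =
    IF (Get x a) (Put x a (Minus (Get x a) (Minus (Get x a) b))) (Put x a b)"

text \<open>\<open>D\<close> is shifted by one and \<open>X\<close> is not, so their sum carries the
  shift that \<open>D\<close> expects.\<close>

definition relax_body :: com where
  "relax_body = ''y'' ::= Minus (var ''c'') (Get ''V'' (var ''x'')) ;;
    ''z'' ::= Plus (Get ''D'' (var ''y'')) (Get ''X'' (var ''y'')) ;;
    min_into ''D'' (var ''c'') (var ''z'')"

text \<open>A zero counter in \<open>X\<close> marks a maximal set, where a path may end.\<close>

definition visit_body :: com where
  "visit_body = IF (Get ''X'' (var ''c'')) SKIP (min_into ''o'' (N 0) (Get ''D'' (var ''c'')))"

text \<open>Cell 0 of \<open>D\<close> belongs to the empty set, whose distance 0 is stored as 1.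
  The last subtraction undoes the shift.\<close>

definition best_chain :: com where
  "best_chain = Put ''D'' (N 0) (N 1) ;;
    FOR ''i'' ''n'' (''c'' ::= Get ''Q'' (var ''i'') ;; ''x'' ::= var ''c'' ;;
      chain_loop relax_body ;; visit_body) ;;
    ''out'' ::= Minus (var ''o'') (N 1)"

text \<open>Ensures that the final minimum is taken over a nonempty set, so that \<open>o\<close>
  does not end with the value 0 for "nothing stored".\<close>

lemma ex_ext_0:
  assumes "finite F" "F \<noteq> {}" "\<And>T. T \<in> F \<Longrightarrow> finite T"
  shows "\<exists>S\<in>F. ext F S = 0"
proof -
  obtain S where S: "S \<in> F" "\<And>T. T \<in> F \<Longrightarrow> S \<subseteq> T \<Longrightarrow> S = T"
    using finite_has_maximal[OF assms(1,2)] by auto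
  then have "{x. x \<notin> S \<and> insert x S \<in> F} = {}" by blast
  with S show ?thesis unfolding ext_def by (metis card.empty)
qed

lemma wp_best_chain:
  assumes listed: "listed qs s" and X: "\<And>S. finite S \<Longrightarrow> s ''X'' (set_encode S) = ext (set qs) S"
    and D: "\<And>i. s ''D'' i = 0" and o: "s ''o'' 0 = 0" and k: "\<And>T. T \<in> set qs \<Longrightarrow> card T \<le> k"
  shows "wp orc best_chain (\<lambda>t s'. t \<le> length qs * (k * 45 + 45) + 20 \<and>
    s' ''out'' 0 = chain_opt (set qs)) s"
proof -
  let ?F = "set qs"
  let ?fr = "{''i'', ''c'', ''x'', ''y'', ''z'', ''D'', ''o''}"
  let ?d = "chain_dist ?F"
  have fin: "finite T" if "T \<in> set qs" for T using listed that by (auto simp: listed_def)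
  \<comment> \<open>The cell of the empty set is filled before the scan begins, hence its separate
    case.\<close>
  define base where "base j S = (if S \<in> set (take j qs) \<or> S = {} then Suc (?d S) else 0)" for j S
  define out where "out j = opt_min (?d ` {S \<in> set (take j qs). ext ?F S = 0})" for j
  let ?I = "\<lambda>j s'. (\<forall>S. finite S \<longrightarrow> s' ''D'' (set_encode S) = base j S) \<and>
    s' ''o'' 0 = out j \<and> (\<forall>v. v \<notin> ?fr \<longrightarrow> s' v = s v)"
  let ?s = "store ''D'' 0 1 s"
  have "wp orc (FOR ''i'' ''n'' (''c'' ::= Get ''Q'' (var ''i'') ;; ''x'' ::= var ''c'' ;;
      chain_loop relax_body ;; visit_body))
      (\<lambda>t s'. t \<le> (\<Sum>j<length qs. (k * 45 + 33) + 12) + 9 \<and> ?I (length qs) s' \<and>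
      s' ''n'' 0 = length qs) ?s"
  proof (rule wp_FOR[where I = ?I and tb = "\<lambda>_. k * 45 + 33"])
    show "?s ''n'' 0 = length qs" using listed by (simp add: listed_def store_apply)
    show "?I 0 (store ''i'' 0 0 ?s)"
      using D o by (auto simp: store_apply base_def out_def set_encode_eq_0_iff)
    fix j s1 assume j: "j < length qs" and I: "?I j s1" and i: "s1 ''i'' 0 = j"
      and n: "s1 ''n'' 0 = length qs"
    define T where "T = qs ! j"
    have T: "T \<in> set qs" "finite T" using j fin by (auto simp: T_def)
    have T': "T \<notin> set (take j qs)"
      using listed j by (auto simp: listed_def T_def in_set_conv_nth nth_eq_iff_index_eq)
    have QV: "s1 ''Q'' = s ''Q''" "s1 ''V'' = s ''V''" "s1 ''X'' = s ''X''" using I by auto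
    have Q: "s1 ''Q'' j = set_encode T" using QV listed j by (simp add: listed_def T_def)
    have take_Suc: "set (take (Suc j) qs) = insert T (set (take j qs))"
      using j by (simp add: take_Suc_conv_app_nth T_def)
    let ?f = "\<lambda>x. ?d (T - {x}) + ext ?F (T - {x})"
    define s2 where "s2 = store ''x'' 0 (set_encode T) (store ''c'' 0 (set_encode T) s1)"
    \<comment> \<open>While \<open>T\<close> is processed, only its own cell differs from
      \<open>base j\<close>; it holds the minimum over the elements removed so far. For empty
      \<open>T\<close> the loop has no rounds and the preset cell stays.\<close>
    let ?J = "\<lambda>Z s'. (\<forall>S. finite S \<longrightarrow> s' ''D'' (set_encode S)
         = (if S = T \<and> T \<noteq> {} then opt_min (?f ` Z) else base j S)) \<and>
       s' ''c'' 0 = set_encode T \<and> s' ''i'' 0 = j \<and> s' ''o'' 0 = out j \<and>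
       (\<forall>v. v \<notin> ?fr \<longrightarrow> s' v = s v)"
    have loop: "wp orc (chain_loop relax_body) (\<lambda>t s'. t \<le> card T * (34 + 11) + 3 \<and> ?J T s') s2"
    proof (rule wp_chain_loop[where I = ?J])
      show "?J {} s2" using I i T' by (simp add: s2_def store_apply base_def)
      show "\<exists>e\<in>R. s2 ''V'' (set_encode R) = 2 ^ e" if "R \<subseteq> T" "R \<noteq> {}" for R
        using listed_chain[OF listed T(1) that] QV by (simp add: s2_def store_apply)
      fix Z e s3 assume Z: "Z \<subseteq> T" "e \<in> T" "e \<notin> Z" and J: "?J Z s3"
        and V: "s3 ''V'' = s2 ''V''" "s2 ''V'' (set_encode (T - Z)) = 2 ^ e"
        and x: "s3 ''x'' 0 = set_encode (T - Z)"
      have e: "set_encode T - 2 ^ e = set_encode (T - {e})" using T Z by (simp add: set_encode_remove)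
      \<comment> \<open>The order of the list makes the distances of all lower neighbours final
        before \<open>T\<close> is visited.\<close>
      have "T - {e} \<in> set (take j qs)"
        using listed j Z by (simp add: listed_def down_ordered_def T_def)
      moreover have "T - {e} \<noteq> T" using Z by auto
      ultimately have De: "s3 ''D'' (set_encode (T - {e})) = Suc (?d (T - {e}))"
        using J T by (simp add: base_def)
      have Xe: "s3 ''X'' (set_encode (T - {e})) = ext ?F (T - {e})"
        using J T X by simp
      have Xs: "s ''X'' (set_encode (T - {e})) = ext ?F (T - {e})" using T X by simp
      have DT: "s3 ''D'' (set_encode T) = opt_min (?f ` Z)" using J T Z by auto
      have cT: "s3 ''c'' 0 = set_encode T" using J by simp
      have "finite (?f ` Z)" using Z T finite_subset by blast
      note ins = opt_min_insert[OF this, of "?f e"]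
      show "wp orc relax_body
        (\<lambda>t s''. t \<le> 34 \<and> ?J (insert e Z) (store ''x'' 0 (set_encode (T - insert e Z)) s'') \<and>
        s'' ''V'' = s3 ''V'' \<and> s'' ''x'' 0 = s3 ''x'' 0) s3"
        using J T Z Xs
        by (auto simp: relax_body_def min_into_def store_apply x V cT e De Xe DT ins set_encode_eq)
    qed (use T in \<open>simp_all add: s2_def store_apply\<close>)
    \<comment> \<open>The minimum over all of \<open>T\<close> is the right-hand side of Bellman's
      equation.\<close>
    have base_Suc: "(if S = T \<and> T \<noteq> {} then opt_min (?f ` T) else base j S) = base (Suc j) S" for S
      using chain_dist_rec[OF T(2), of ?F] take_Suc by (auto simp: base_def opt_min_def)
    have out_Suc: "out (Suc j) = (if ext ?F T = 0 then opt_min (insert (?d T) (?d ` {S \<in> set (take j qs). ext ?F S = 0}))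
       else out j)"
      unfolding out_def take_Suc by (auto intro!: arg_cong[of _ _ opt_min])
    have ins: "opt_min (insert (?d T) (?d ` {S \<in> set (take j qs). ext ?F S = 0})) =
      (if out j = 0 then Suc (?d T) else out j - (out j - Suc (?d T)))"
      unfolding out_def by (rule opt_min_insert) simp
    have baseT: "base (Suc j) T = Suc (?d T)" by (simp add: base_def take_Suc)
    have card: "card T \<le> k" using k[OF T(1)] .
    define P where "P s' \<longleftrightarrow> ?I (Suc j) (store ''i'' 0 (Suc j) s') \<and> s' ''i'' 0 = j \<and>
      s' ''n'' 0 = length qs" for s'
    have visit: "wp orc visit_body (\<lambda>t s'. t \<le> 18 \<and> P s') s4"
      if "?J T s4" for s4
    proof -
      have s4: "\<forall>S. finite S \<longrightarrow> s4 ''D'' (set_encode S) = base (Suc j) S" "s4 ''o'' 0 = out j"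
        "s4 ''c'' 0 = set_encode T" "s4 ''i'' 0 = j" "\<forall>v. v \<notin> ?fr \<longrightarrow> s4 v = s v"
        using that unfolding base_Suc by blast+
      then have "s4 ''X'' (set_encode T) = ext ?F T" "s4 ''n'' 0 = length qs"
         "s4 ''D'' (set_encode T) = Suc (?d T)"
        using X T listed baseT by (simp_all add: listed_def)
      then show ?thesis using s4
        by (simp add: P_def visit_body_def min_into_def store_apply out_Suc ins)
    qed
    have "wp orc (chain_loop relax_body ;; visit_body) (\<lambda>t s'. t \<le> k * 45 + 21 \<and> P s') s2"
      unfolding wp_Seq
    proof (rule wp_mono[OF loop])
      fix t s4 assume a: "t \<le> card T * (34 + 11) + 3 \<and> ?J T s4"
      then have "?J T s4" by blast
      then show "wp orc visit_body (\<lambda>t2 s'. t + t2 \<le> k * 45 + 21 \<and> P s') s4"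
        by (rule wp_mono[OF visit]) (use conjunct1[OF a] card in auto)
    qed
    then have "wp orc (''c'' ::= Get ''Q'' (var ''i'') ;; ''x'' ::= var ''c'' ;;
        chain_loop relax_body ;; visit_body) (\<lambda>t s'. t \<le> k * 45 + 33 \<and> P s') s1"
      by (simp add: i Q store_apply s2_def[symmetric]) (auto elim!: wp_mono)
    then show "wp orc (''c'' ::= Get ''Q'' (var ''i'') ;; ''x'' ::= var ''c'' ;;
        chain_loop relax_body ;; visit_body)
       (\<lambda>t s'. t \<le> k * 45 + 33 \<and> ?I (Suc j) (store ''i'' 0 (Suc j) s') \<and> s' ''i'' 0 = j \<and>
          s' ''n'' 0 = length qs) s1"
      unfolding P_def .
  qed simp
  then have FOR: "wp orc (FOR ''i'' ''n'' (''c'' ::= Get ''Q'' (var ''i'') ;; ''x'' ::= var ''c'' ;;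
      chain_loop relax_body ;; visit_body))
      (\<lambda>t s'. t \<le> length qs * (k * 45 + 45) + 9 \<and> s' ''o'' 0 = out (length qs)) ?s"
    by (rule wp_mono) (simp add: algebra_simps)
  have opt: "chain_opt ?F = Min (?d ` {S \<in> ?F. ext ?F S = 0})" "\<exists>S\<in>?F. ext ?F S = 0"
  proof -
    have "?F \<noteq> {}" using listed by (auto simp: listed_def)
    then show "\<exists>S\<in>?F. ext ?F S = 0" using ex_ext_0[of ?F] fin by auto
    then show "chain_opt ?F = Min (?d ` {S \<in> ?F. ext ?F S = 0})"
      using chain_opt_eq_Min_dist[of ?F] fin by auto
  qed
  show ?thesis
    unfolding best_chain_def wp_Seq wp_Put
    by (simp del: One_nat_def, rule wp_mono[OF FOR])
      (use opt in \<open>auto simp: store_apply out_def opt_min_def algebra_simps\<close>)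
qed

definition solve_listed :: com where
  "solve_listed = count_extensions ;; best_chain"

lemma wp_solve_listed:
  assumes listed: "listed qs s" and X: "\<And>i. s ''X'' i = 0" "\<And>i. s ''D'' i = 0" "s ''o'' 0 = 0"
    and k: "\<And>T. T \<in> set qs \<Longrightarrow> card T \<le> k"
  shows "wp orc solve_listed (\<lambda>t s'. t \<le> length qs * (k * 85 + 85) + 29 \<and>
    s' ''out'' 0 = chain_opt (set qs)) s"
  unfolding solve_listed_def wp_Seq
proof (rule wp_mono[OF wp_count_extensions[OF listed X(1) k]], assumption)
  fix t s' assume s': "t \<le> length qs * (k * 40 + 40) + 9 \<and>
    (\<forall>S. finite S \<longrightarrow> s' ''X'' (set_encode S) = ext (set qs) S) \<and>
    (\<forall>v. v \<notin> {''i'', ''c'', ''x'', ''y'', ''X''} \<longrightarrow> s' v = s v)"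
  then have "wp orc best_chain (\<lambda>t s'. t \<le> length qs * (k * 45 + 45) + 20 \<and>
    s' ''out'' 0 = chain_opt (set qs)) s'"
    using listed X k by (intro wp_best_chain) (auto simp: listed_def)
  then show "wp orc best_chain (\<lambda>t2 s'. t + t2 \<le> length qs * (k * 85 + 85) + 29 \<and>
    s' ''out'' 0 = chain_opt (set qs)) s'"
    by (rule wp_mono) (use s' in \<open>auto simp: algebra_simps\<close>)
qed

section \<open>Enumerating the independent sets by rank queries\<close>

text \<open>Codes of different finite sets differ, so the new entry of \<open>V\<close> disturbs no
  other set. Both enumerations append in this way.\<close>

lemma listed_snoc:
  assumes "listed qs s" "T \<notin> set qs" "finite T" "e \<in> T" "\<And>f. f \<in> T \<Longrightarrow> T - {f} \<in> set qs"
    and "s' ''n'' 0 = Suc (length qs)" "s' ''Q'' = (s ''Q'')(length qs := set_encode T)"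
    and "s' ''V'' = (s ''V'')(set_encode T := 2 ^ e)"
  shows "listed (qs @ [T]) s'"
proof -
  have "if R \<in> set (qs @ [T]) \<and> R \<noteq> {} then \<exists>e\<in>R. s' ''V'' (set_encode R) = 2 ^ e
      else s' ''V'' (set_encode R) = 0" if R: "finite R" for R
  proof (cases "R = T")
    case False
    then have "s' ''V'' (set_encode R) = s ''V'' (set_encode R)"
      using assms R by (simp add: set_encode_eq)
    then show ?thesis using assms(1) R False by (auto simp: listed_def)
  qed (use assms in auto)
  moreover have "s' ''Q'' p = set_encode ((qs @ [T]) ! p)" if "p < length (qs @ [T])" for p
  proof (cases "p = length qs")
    case False
    then show ?thesis using that assms(1,7) by (simp add: listed_def nth_append)
  qed (use assms in simp)
  moreover have "distinct (qs @ [T])" "\<forall>R\<in>set (qs @ [T]). finite R" "{} \<in> set (qs @ [T])"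
    "down_ordered (qs @ [T])" "s' ''n'' 0 = length (qs @ [T])"
    using assms(1-6) by (simp_all add: listed_def down_ordered_snoc)
  ultimately show ?thesis unfolding listed_def by blast
qed

lemma listed_cong:
  "s' ''n'' = s ''n'' \<Longrightarrow> s' ''Q'' = s ''Q'' \<Longrightarrow> s' ''V'' = s ''V'' \<Longrightarrow> listed qs s' = listed qs s"
  by (simp add: listed_def)

text \<open>A query vector has to be addressed by the element itself, whereas \<open>V\<close> holds
  its power of two. \<open>U\<close> records the exponent alongside, so that no logarithm has to be
  computed.\<close>

definition topped :: "nat set list \<Rightarrow> state \<Rightarrow> bool" where
  "topped qs s \<longleftrightarrow> (\<forall>T\<in>set qs. T \<noteq> {} \<longrightarrow> s ''V'' (set_encode T) = 2 ^ s ''U'' (set_encode T))"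

lemma topped_cong:
  "s' ''U'' = s ''U'' \<Longrightarrow> s' ''V'' = s ''V'' \<Longrightarrow> topped qs s' = topped qs s"
  by (simp add: topped_def)

text \<open>The value 1 writes a set into the query vector, the value 0 erases it again.\<close>

definition mark_body :: "nat \<Rightarrow> com" where
  "mark_body v = Put ''Y'' (Get ''U'' (var ''x'')) (N v)"

lemma wp_mark:
  assumes listed: "listed qs s" and topped: "topped qs s" and T: "T \<in> set qs"
    and x: "s ''x'' 0 = set_encode T"
  shows "wp orc (chain_loop (mark_body v)) (\<lambda>t s'. t \<le> card T * 16 + 3 \<and>
    (\<forall>i. s' ''Y'' i = (if i \<in> T then v else s ''Y'' i)) \<and>
    (\<forall>u. u \<notin> {''x'', ''Y''} \<longrightarrow> s' u = s u)) s"
proof -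
  let ?J = "\<lambda>Z s'. (\<forall>i. s' ''Y'' i = (if i \<in> Z then v else s ''Y'' i)) \<and>
    (\<forall>u. u \<notin> {''x'', ''Y''} \<longrightarrow> s' u = s u)"
  have fin: "finite T" using listed T by (auto simp: listed_def)
  have "wp orc (chain_loop (mark_body v)) (\<lambda>t s'. t \<le> card T * (5 + 11) + 3 \<and> ?J T s') s"
  proof (rule wp_chain_loop[where I = ?J])
    show "\<exists>e\<in>R. s ''V'' (set_encode R) = 2 ^ e" if "R \<subseteq> T" "R \<noteq> {}" for R
      using listed_chain[OF listed T that] .
    fix Z e s3 assume Z: "Z \<subseteq> T" "e \<in> T" "e \<notin> Z" and J: "?J Z s3"
      and V: "s3 ''V'' = s ''V''" "s ''V'' (set_encode (T - Z)) = 2 ^ e"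
      and x: "s3 ''x'' 0 = set_encode (T - Z)"
    have "T - Z \<in> set qs" "T - Z \<noteq> {}"
      using down_ordered_subset[of qs T "T - Z"] listed T fin Z by (auto simp: listed_def)
    then have "s ''V'' (set_encode (T - Z)) = 2 ^ s ''U'' (set_encode (T - Z))"
      using topped by (auto simp: topped_def)
    then have "s ''U'' (set_encode (T - Z)) = e" using V by simp
    then show "wp orc (mark_body v) (\<lambda>t s''. t \<le> 5 \<and>
        ?J (insert e Z) (store ''x'' 0 (set_encode (T - insert e Z)) s'') \<and>
        s'' ''V'' = s3 ''V'' \<and> s'' ''x'' 0 = s3 ''x'' 0) s3"
      using J by (auto simp: mark_body_def store_apply x)
  qed (use fin x in auto)
  then show ?thesis by simp
qed

text \<open>The vector is erased by a second walk through the set, so that every probe starts and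
  ends with \<open>Y\<close> zero.\<close>

definition probe :: com where
  "probe = ''c'' ::= Get ''Q'' (var ''i'') ;;
    ''x'' ::= var ''c'' ;; chain_loop (mark_body 1) ;; Query ''f'' (N 0) ''Y'' ;;
    Put ''Y'' (var ''e'') (N 1) ;; Query ''g'' (N 0) ''Y'' ;; Put ''Y'' (var ''e'') (N 0) ;;
    ''x'' ::= var ''c'' ;; chain_loop (mark_body 0)"

lemma wp_probe:
  assumes listed: "listed qs s" and topped: "topped qs s" and i: "s ''i'' 0 < length qs"
    and T: "T = qs ! s ''i'' 0" and Y: "\<And>i. s ''Y'' i = 0" and e: "s ''e'' 0 = e" "e \<notin> T"
  shows "wp orc probe (\<lambda>t s'. t \<le> card T * 32 + 40 \<and> s' ''c'' 0 = set_encode T \<and>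
    s' ''f'' 0 = orc T \<and> s' ''g'' 0 = orc (insert e T) \<and> (\<forall>i. s' ''Y'' i = 0) \<and>
    (\<forall>u. u \<notin> {''c'', ''x'', ''f'', ''g'', ''Y''} \<longrightarrow> s' u = s u)) s"
proof -
  have TQ: "T \<in> set qs" using T i by auto
  have Q: "s ''Q'' (s ''i'' 0) = set_encode T" using listed i T by (simp add: listed_def)
  define s1 where "s1 = store ''x'' 0 (set_encode T) (store ''c'' 0 (set_encode T) s)"
  have mark1: "wp orc (chain_loop (mark_body 1)) (\<lambda>t s'. t \<le> card T * 16 + 3 \<and>
    (\<forall>i. s' ''Y'' i = (if i \<in> T then 1 else s1 ''Y'' i)) \<and>
    (\<forall>u. u \<notin> {''x'', ''Y''} \<longrightarrow> s' u = s1 u)) s1"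
  proof (rule wp_mark)
    have "s1 ''n'' = s ''n''" "s1 ''Q'' = s ''Q''" "s1 ''V'' = s ''V''" "s1 ''U'' = s ''U''"
      by (simp_all add: s1_def store_apply)
    then show "listed qs s1" "topped qs s1"
      using listed topped listed_cong[of s1 s qs] topped_cong[of s1 s qs] by simp_all
  qed (use TQ in \<open>simp_all add: s1_def store_apply\<close>)
  have rest: "wp orc (Query ''f'' (N 0) ''Y'' ;;
    Put ''Y'' (var ''e'') (N 1) ;; Query ''g'' (N 0) ''Y'' ;; Put ''Y'' (var ''e'') (N 0) ;;
    ''x'' ::= var ''c'' ;; chain_loop (mark_body 0))
    (\<lambda>t s'. t \<le> card T * 16 + 20 \<and> s' ''c'' 0 = set_encode T \<and>
    s' ''f'' 0 = orc T \<and> s' ''g'' 0 = orc (insert e T) \<and> (\<forall>i. s' ''Y'' i = 0) \<and>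
    (\<forall>u. u \<notin> {''c'', ''x'', ''f'', ''g'', ''Y''} \<longrightarrow> s' u = s u)) s2"
    if s2: "\<forall>i. s2 ''Y'' i = (if i \<in> T then 1 else s1 ''Y'' i)" "\<forall>u. u \<notin> {''x'', ''Y''} \<longrightarrow> s2 u = s1 u"
    for s2
  proof -
    have Y2: "s2 ''Y'' i = (if i \<in> T then 1 else 0)" for i using s2 Y by (simp add: s1_def store_apply)
    have set1: "{i. s2 ''Y'' i \<noteq> 0} = T" by (auto simp: Y2)
    have e2: "s2 ''e'' 0 = e" "s2 ''c'' 0 = set_encode T" using s2 e by (auto simp: s1_def store_apply)
    define a1 where "a1 = store ''f'' 0 (orc T) s2"
    define a2 where "a2 = store ''Y'' e 1 a1"
    define a3 where "a3 = store ''g'' 0 (orc (insert e T)) a2"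
    define a4 where "a4 = store ''Y'' e 0 a3"
    define s3 where "s3 = store ''x'' 0 (set_encode T) a4"
    note a_defs = a1_def a2_def a3_def a4_def
    have set2: "{i. a2 ''Y'' i \<noteq> 0} = insert e T"
      by (auto simp: a_defs store_apply Y2 split: if_splits)
    have e3: "a1 ''e'' 0 = e" "a3 ''e'' 0 = e" "a4 ''c'' 0 = set_encode T"
      by (simp_all add: a_defs store_apply e2)
    have frame: "s3 u = s u" if "u \<notin> {''c'', ''x'', ''f'', ''g'', ''Y''}" for u
      using that s2 by (auto simp: s3_def a_defs s1_def store_apply)
    have "wp orc (chain_loop (mark_body 0)) (\<lambda>t s'. t \<le> card T * 16 + 3 \<and>
      (\<forall>i. s' ''Y'' i = (if i \<in> T then 0 else s3 ''Y'' i)) \<and>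
      (\<forall>u. u \<notin> {''x'', ''Y''} \<longrightarrow> s' u = s3 u)) s3"
    proof (rule wp_mark)
      show "listed qs s3" "topped qs s3"
        using listed topped listed_cong[of s3 s qs] topped_cong[of s3 s qs] frame by simp_all
    qed (use TQ in \<open>auto simp: s3_def store_apply\<close>)
    then have "wp orc (chain_loop (mark_body 0)) (\<lambda>t s'. t \<le> card T * 16 + 3 \<and> s' ''c'' 0 = set_encode T \<and>
      s' ''f'' 0 = orc T \<and> s' ''g'' 0 = orc (insert e T) \<and> (\<forall>i. s' ''Y'' i = 0) \<and>
      (\<forall>u. u \<notin> {''c'', ''x'', ''f'', ''g'', ''Y''} \<longrightarrow> s' u = s u)) s3"
    proof (rule wp_mono, intro conjI)
      fix t s' assume a: "t \<le> card T * 16 + 3 \<and> (\<forall>i. s' ''Y'' i = (if i \<in> T then 0 else s3 ''Y'' i)) \<and>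
        (\<forall>u. u \<notin> {''x'', ''Y''} \<longrightarrow> s' u = s3 u)"
      show "\<forall>u. u \<notin> {''c'', ''x'', ''f'', ''g'', ''Y''} \<longrightarrow> s' u = s u"
        using a frame by auto
    qed (auto simp: s3_def a_defs store_apply e2 Y2)
    then show ?thesis
      by (simp only: wp_Seq wp_Query wp_Put aval.simps set1 a1_def[symmetric] e3 a2_def[symmetric]
          set2 a3_def[symmetric] a4_def[symmetric] s3_def[symmetric])
        (erule wp_mono, simp)
  qed
  show ?thesis
    unfolding probe_def
    apply (subst wp_Seq, subst wp_Put, subst wp_Seq, subst wp_Put, subst wp_Seq)
    apply (simp add: Q store_apply s1_def[symmetric] del: wp_Seq One_nat_def)
    apply (rule wp_mono[OF mark1])
    apply (elim conjE)
    apply (rule wp_mono[OF rest], assumption, assumption)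
    apply (elim conjE, intro conjI)
    apply simp_all
    done
qed


definition extend_body :: com where
  "extend_body = IF (Minus (var ''g'') (var ''f''))
    (''c'' ::= Plus (var ''c'') (var ''W'') ;; Put ''V'' (var ''c'') (var ''W'') ;;
     Put ''U'' (var ''c'') (var ''e'') ;; Put ''Q'' (var ''n'') (var ''c'') ;;
     ''n'' ::= Plus (var ''n'') (N 1)) SKIP"

text \<open>Isolates the property of the oracle on which the enumeration rests: starting from an
  independent set, a rise in rank detects independence.\<close>

locale rank_test =
  fixes m :: nat and ind :: "nat set \<Rightarrow> bool" and orc :: answers
  assumes ind_empty: "ind {}" and ind_subset: "ind T \<Longrightarrow> S \<subseteq> T \<Longrightarrow> ind S"
    and orc_insert: "T \<subseteq> {..<m} \<Longrightarrow> ind T \<Longrightarrow> e < m \<Longrightarrow> e \<notin> T \<Longrightarrow>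
      orc T < orc (insert e T) \<longleftrightarrow> ind (insert e T)"
begin

text \<open>Stage \<open>e\<close> appends to the list that it scans. The old length, kept in
  \<open>h\<close>, confines the scan to the sets without \<open>e\<close>.\<close>

lemma wp_extend_all:
  assumes listed: "listed qs s" and topped: "topped qs s" and qs: "set qs = {T. T \<subseteq> {..<e} \<and> ind T}"
    and e: "e < m" "s ''e'' 0 = e" and W: "s ''W'' 0 = 2 ^ e" and Y: "\<And>i. s ''Y'' i = 0"
    and h: "s ''h'' 0 = length qs"
  shows "wp orc (FOR ''i'' ''h'' (probe ;; extend_body)) (\<lambda>t s'. t \<le> length qs * (m * 32 + 90) + 9 \<and>
    (\<exists>qs'. listed qs' s' \<and> topped qs' s' \<and> set qs' = {T. T \<subseteq> {..<Suc e} \<and> ind T}) \<and>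
    (\<forall>i. s' ''Y'' i = 0) \<and>
    (\<forall>v. v \<notin> {''i'', ''c'', ''x'', ''f'', ''g'', ''Y'', ''V'', ''U'', ''Q'', ''n''} \<longrightarrow> s' v = s v)) s"
proof -
  define fr where "fr = {''i'', ''c'', ''x'', ''f'', ''g'', ''Y'', ''V'', ''U'', ''Q'', ''n''}"
  let ?N = "\<lambda>j. {insert e S | S. S \<in> set (take j qs) \<and> ind (insert e S)}"
  define I where "I j s' \<longleftrightarrow> (\<exists>qs'. listed (qs @ qs') s' \<and> topped (qs @ qs') s' \<and> set qs' = ?N j) \<and>
    (\<forall>i. s' ''Y'' i = 0) \<and> (\<forall>v. v \<notin> fr \<longrightarrow> s' v = s v)" for j s'
  have "wp orc (FOR ''i'' ''h'' (probe ;; extend_body))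
     (\<lambda>t s'. t \<le> (\<Sum>j<length qs. (m * 32 + 78) + 12) + 9 \<and> I (length qs) s' \<and> s' ''h'' 0 = length qs) s"
  proof (rule wp_FOR[where I = I and tb = "\<lambda>_. m * 32 + 78"])
    have eq: "store ''i'' 0 0 s ''n'' = s ''n''" "store ''i'' 0 0 s ''Q'' = s ''Q''"
      "store ''i'' 0 0 s ''V'' = s ''V''" "store ''i'' 0 0 s ''U'' = s ''U''"
      by (simp_all add: store_apply)
    have "listed (qs @ []) (store ''i'' 0 0 s)" "topped (qs @ []) (store ''i'' 0 0 s)"
      using listed_cong[OF eq(1,2,3)] topped_cong[OF eq(4,3)] listed topped by simp_all
    moreover have "set [] = ?N 0" by simp
    moreover have "\<forall>i. store ''i'' 0 0 s ''Y'' i = 0"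
      "\<forall>v. v \<notin> fr \<longrightarrow> store ''i'' 0 0 s v = s v"
      using Y by (simp_all add: store_apply fr_def)
    ultimately show "I 0 (store ''i'' 0 0 s)" unfolding I_def by blast
    fix j s1 assume j: "j < length qs" and I: "I j s1" and i: "s1 ''i'' 0 = j"
      and n: "s1 ''h'' 0 = length qs"
    obtain qs' where listed1: "listed (qs @ qs') s1" and topped1: "topped (qs @ qs') s1"
      and qs': "set qs' = ?N j" using conjunct1[OF I[unfolded I_def]] by blast
    have Y1: "\<And>i. s1 ''Y'' i = 0" and fr1: "\<And>v. v \<notin> fr \<Longrightarrow> s1 v = s v"
      using conjunct2[OF I[unfolded I_def]] by simp_all
    define T where "T = qs ! j"
    have T: "T \<in> set qs" "T \<subseteq> {..<e}" "ind T" using j qs by (auto simp: T_def)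
    have fin: "finite T" using T finite_subset by blast
    have eT: "e \<notin> T" using T by auto
    have card: "card T \<le> m" using card_mono[of "{..<e}" T] T e by simp
    have We1: "s1 ''e'' 0 = e" "s1 ''W'' 0 = 2 ^ e" using fr1[of "''e''"] fr1[of "''W''"] e W by (simp_all add: fr_def)
    have N_Suc: "?N (Suc j) = (if ind (insert e T) then insert (insert e T) (?N j) else ?N j)"
      using j by (auto simp: take_Suc_conv_app_nth T_def)
    define P where "P s' \<longleftrightarrow> I (Suc j) (store ''i'' 0 (Suc j) s') \<and> s' ''i'' 0 = j \<and>
      s' ''h'' 0 = length qs" for s'
    let ?R = "insert e T"
    have "wp orc extend_body (\<lambda>t s'. t \<le> 35 \<and> P s') s2"
      if s2: "s2 ''c'' 0 = set_encode T" "s2 ''f'' 0 = orc T" "s2 ''g'' 0 = orc ?R" "\<forall>i. s2 ''Y'' i = 0"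
        and fr2: "\<forall>u. u \<notin> {''c'', ''x'', ''f'', ''g'', ''Y''} \<longrightarrow> s2 u = s1 u" for s2
    proof -
      have eq2: "s2 ''n'' = s1 ''n''" "s2 ''Q'' = s1 ''Q''" "s2 ''V'' = s1 ''V''" "s2 ''U'' = s1 ''U''"
        "s2 ''i'' = s1 ''i''" "s2 ''h'' = s1 ''h''" "s2 ''W'' = s1 ''W''" "s2 ''e'' = s1 ''e''"
        using fr2 by simp_all
      have frs: "s2 v = s v" if "v \<notin> fr" for v using fr1[OF that] fr2 that by (simp add: fr_def)
      have iff: "orc T < orc ?R \<longleftrightarrow> ind ?R" 
      proof (rule orc_insert)
        show "T \<subseteq> {..<m}" using T(2) e(1) by (auto dest!: subsetD)
      qed (use T e eT in auto)
      show ?thesis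
      proof (cases "ind ?R")
        case False
        define s3 where "s3 = store ''i'' 0 (Suc j) s2"
        have eq3: "s3 ''n'' = s1 ''n''" "s3 ''Q'' = s1 ''Q''" "s3 ''V'' = s1 ''V''" "s3 ''U'' = s1 ''U''"
          by (simp_all add: s3_def store_apply eq2)
        have "listed (qs @ qs') s3" "topped (qs @ qs') s3"
          using listed_cong[OF eq3(1,2,3)] topped_cong[OF eq3(4,3)] listed1 topped1 by simp_all
        moreover have "set qs' = ?N (Suc j)" using N_Suc qs' False by simp
        moreover have "s3 ''Y'' i = 0" for i using s2 by (simp add: s3_def store_apply)
        moreover have "s3 v = s v" if "v \<notin> fr" for v
          using frs[OF that] that by (simp add: s3_def store_apply fr_def)
        ultimately have "I (Suc j) s3" unfolding I_def by blast
        then have "P s2" unfolding P_def using i n eq2 by (simp add: s3_def)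
        then show ?thesis using False iff by (simp add: extend_body_def s2)
      next
        case True
        define L where "L = length (qs @ qs')"
        have nL: "s1 ''n'' 0 = L" using listed1 by (simp add: listed_def L_def)
        have code: "set_encode T + 2 ^ e = set_encode ?R" using fin eT by simp
        define s4 where "s4 = store ''n'' 0 (Suc L) (store ''Q'' L (set_encode ?R) (store ''U'' (set_encode ?R) e
          (store ''V'' (set_encode ?R) (2 ^ e) (store ''c'' 0 (set_encode ?R) s2))))"
        define s3 where "s3 = store ''i'' 0 (Suc j) s4"
        \<comment> \<open>Old sets do not contain \<open>e\<close>, and inserting \<open>e\<close>
          is injective on them, so nothing is appended twice.\<close>
        have new: "?R \<notin> set (qs @ qs')"
        proof -
          have "T \<notin> set (take j qs)"
            using listed j by (auto simp: listed_def T_def in_set_conv_nth nth_eq_iff_index_eq)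
          moreover have "S = T" if "S \<in> set (take j qs)" "insert e S = ?R" for S
          proof -
            have "e \<notin> S" using that(1) qs by (auto dest!: in_set_takeD)
            then show ?thesis using that(2) eT by (metis insert_ident)
          qed
          ultimately have "?R \<notin> set qs'" unfolding qs' by blast
          moreover have "?R \<notin> set qs" using qs by auto
          ultimately show ?thesis by simp
        qed
        \<comment> \<open>Removing \<open>e\<close> gives the old set \<open>T\<close>. Any other
          lower neighbour is \<open>insert e (T - {f})\<close>, appended earlier because
          \<open>T - {f}\<close> precedes \<open>T\<close>.\<close>
        have down: "?R - {f} \<in> set (qs @ qs')" if f: "f \<in> ?R" for f
        proof (cases "f = e")
          case True
          then have "?R - {f} = T" using eT by auto
          then show ?thesis using T by simp
        next
          case False
          then have "T - {f} \<in> set (take j qs)"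
            using listed j f by (simp add: listed_def down_ordered_def T_def)
          moreover have "?R - {f} = insert e (T - {f})" using False by auto
          moreover have "ind (insert e (T - {f}))" using ind_subset[OF True, of "insert e (T - {f})"] by auto
          ultimately have "?R - {f} \<in> set qs'" unfolding qs' by auto
          then show ?thesis by simp
        qed
        have eq3: "s3 ''n'' 0 = Suc (length (qs @ qs'))"
          "s3 ''Q'' = (s1 ''Q'')(length (qs @ qs') := set_encode ?R)"
          "s3 ''V'' = (s1 ''V'')(set_encode ?R := 2 ^ e)" "s3 ''U'' = (s1 ''U'')(set_encode ?R := e)"
          by (simp_all add: s3_def s4_def store_apply eq2 L_def)
        have "listed ((qs @ qs') @ [?R]) s3"
          by (rule listed_snoc[OF listed1 new _ _ down eq3(1,2,3)]) (use fin in auto)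
        moreover have "topped ((qs @ qs') @ [?R]) s3"
        proof -
          have "s3 ''V'' (set_encode S) = 2 ^ s3 ''U'' (set_encode S)"
            if S: "S \<in> set ((qs @ qs') @ [?R])" "S \<noteq> {}" for S
          proof (cases "S = ?R")
            case False
            then have S': "S \<in> set (qs @ qs')" using S by simp
            then have "finite S" using listed1 unfolding listed_def by blast
            then have "set_encode S \<noteq> set_encode ?R" using False fin by (simp add: set_encode_eq)
            then show ?thesis using topped1 S S' by (simp add: eq3 topped_def)
          qed (simp add: eq3)
          then show ?thesis unfolding topped_def by blast
        qed
        moreover have "set (qs' @ [?R]) = ?N (Suc j)" using N_Suc qs' True by simp
        moreover have "s3 ''Y'' i = 0" for i using s2 by (simp add: s3_def s4_def store_apply)
        moreover have "s3 v = s v" if "v \<notin> fr" for v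
          using frs[OF that] that by (simp add: s3_def s4_def store_apply fr_def)
        ultimately have "I (Suc j) s3" unfolding I_def append.assoc by blast
        moreover have "s4 ''i'' 0 = j" "s4 ''h'' 0 = length qs"
          using i n by (simp_all add: s4_def store_apply eq2)
        ultimately have "P s4" unfolding P_def s3_def by blast
        then show ?thesis using True iff
          by (simp add: extend_body_def s2 store_apply eq2 We1 nL code del: set_encode_insert)
            (simp add: s4_def del: set_encode_insert)
      qed
    qed
    note extend = this
    have "wp orc (probe ;; extend_body) (\<lambda>t s'. t \<le> m * 32 + 78 \<and> P s') s1"
      unfolding wp_Seq
    proof (rule wp_mono[OF wp_probe[OF listed1 topped1]])
      show "T = (qs @ qs') ! s1 ''i'' 0" using i j by (simp add: T_def nth_append)
      fix t s' assume s': "t \<le> card T * 32 + 40 \<and> s' ''c'' 0 = set_encode T \<and>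
        s' ''f'' 0 = orc T \<and> s' ''g'' 0 = orc (insert e T) \<and> (\<forall>i. s' ''Y'' i = 0) \<and>
        (\<forall>u. u \<notin> {''c'', ''x'', ''f'', ''g'', ''Y''} \<longrightarrow> s' u = s1 u)"
      have "wp orc extend_body (\<lambda>t s'. t \<le> 35 \<and> P s') s'"
        by (rule extend) (use s' in blast)+
      then show "wp orc extend_body (\<lambda>t2 s'. t + t2 \<le> m * 32 + 78 \<and> P s') s'"
        by (rule wp_mono) (use conjunct1[OF s'] card in auto)
    qed (use i j We1 eT Y1 in auto)
    then show "wp orc (probe ;; extend_body) (\<lambda>t s'. t \<le> m * 32 + 78 \<and>
        I (Suc j) (store ''i'' 0 (Suc j) s') \<and> s' ''i'' 0 = j \<and> s' ''h'' 0 = length qs) s1"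
      unfolding P_def .
  qed (use h in auto)
  then show ?thesis
    unfolding I_def fr_def
  proof (rule wp_mono, elim conjE exE, intro conjI)
    fix t s' qs' assume "listed (qs @ qs') s'" "topped (qs @ qs') s'" and qs': "set qs' = ?N (length qs)"
    moreover have "set (qs @ qs') = {T. T \<subseteq> {..<Suc e} \<and> ind T}"
    proof -
      have "T \<in> set qs \<union> ?N (length qs)" if T: "T \<subseteq> {..<Suc e}" "ind T" for T
      proof (cases "e \<in> T")
        case True
        have "T - {e} \<subseteq> {..<e}" using T by (auto simp: less_Suc_eq)
        moreover have "ind (T - {e})" using ind_subset T by blast
        moreover have "insert e (T - {e}) = T" using True by auto
        ultimately show ?thesis using qs T by (metis (mono_tags, lifting) UnI2 mem_Collect_eq order_refl take_all)
      next
        case False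
        then have "T \<subseteq> {..<e}" using T by (auto simp: less_Suc_eq)
        then show ?thesis using T qs by simp
      qed
      moreover have "set qs \<union> ?N (length qs) \<subseteq> {T. T \<subseteq> {..<Suc e} \<and> ind T}"
        using qs by auto
      ultimately show ?thesis using qs' by auto
    qed
    ultimately show "\<exists>qs'. listed qs' s' \<and> topped qs' s' \<and> set qs' = {T. T \<subseteq> {..<Suc e} \<and> ind T}"
      by blast
  qed (simp_all add: algebra_simps)
qed

end

definition enumerate_by_rank :: com where
  "enumerate_by_rank = ''W'' ::= N 1 ;; ''n'' ::= N 1 ;;
    FOR ''e'' ''m'' (''h'' ::= var ''n'' ;; FOR ''i'' ''h'' (probe ;; extend_body) ;;
      ''W'' ::= Plus (var ''W'') (var ''W''))"

text \<open>The code of the empty set is 0, so fresh memory already represents the list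
  \<open>[{}]\<close> once \<open>n\<close> is set to 1.\<close>

lemma listed_initial:
  assumes "s ''n'' 0 = 1" "s ''Q'' 0 = 0" "\<And>i. s ''V'' i = 0"
  shows "listed [{}] s"
  using assms by (simp add: listed_def down_ordered_def)

context rank_test
begin

lemma wp_enumerate_by_rank:
  assumes m: "s ''m'' 0 = m" and 0: "\<And>x i. x \<noteq> ''m'' \<Longrightarrow> s x i = 0"
    and K: "card {T. T \<subseteq> {..<m} \<and> ind T} = K"
  shows "wp orc enumerate_by_rank (\<lambda>t s'. t \<le> m * (K * (m * 32 + 90) + 32) + 15 \<and>
    (\<exists>qs. listed qs s' \<and> set qs = {T. T \<subseteq> {..<m} \<and> ind T}) \<and>
    (\<forall>i. s' ''X'' i = 0 \<and> s' ''D'' i = 0 \<and> s' ''o'' i = 0)) s"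
proof -
  define fr where "fr = {''W'', ''n'', ''h'', ''e'', ''i'', ''c'', ''x'', ''f'', ''g'', ''Y'', ''V'', ''U'', ''Q''}"
  define I where "I e s' \<longleftrightarrow>
      (\<exists>qs. listed qs s' \<and> topped qs s' \<and> set qs = {T. T \<subseteq> {..<e} \<and> ind T}) \<and>
      s' ''W'' 0 = 2 ^ e \<and> (\<forall>i. s' ''Y'' i = 0) \<and> (\<forall>v. v \<notin> fr \<longrightarrow> s' v = s v)" for e s'
  define s1 where "s1 = store ''n'' 0 1 (store ''W'' 0 1 s)"
  have "wp orc (FOR ''e'' ''m'' (''h'' ::= var ''n'' ;; FOR ''i'' ''h'' (probe ;; extend_body) ;;
      ''W'' ::= Plus (var ''W'') (var ''W'')))
     (\<lambda>t s'. t \<le> (\<Sum>e<m. (K * (m * 32 + 90) + 20) + 12) + 9 \<and> I m s' \<and> s' ''m'' 0 = m) s1"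
  proof (rule wp_FOR[where I = I and tb = "\<lambda>_. K * (m * 32 + 90) + 20"])
    show "s1 ''m'' 0 = m" using m by (simp add: s1_def store_apply)
    have "listed [{}] (store ''e'' 0 0 s1)"
      by (rule listed_initial) (simp_all add: s1_def store_apply 0)
    moreover have "topped [{}] (store ''e'' 0 0 s1)" by (simp add: topped_def)
    moreover have "set [{}] = {T. T \<subseteq> {..<0} \<and> ind T}" using ind_empty by auto
    ultimately have "\<exists>qs. listed qs (store ''e'' 0 0 s1) \<and> topped qs (store ''e'' 0 0 s1) \<and>
      set qs = {T. T \<subseteq> {..<0} \<and> ind T}" by blast
    then show "I 0 (store ''e'' 0 0 s1)"
      unfolding I_def by (simp add: s1_def store_apply 0 fr_def)
    fix e s2 assume e: "e < m" and I: "I e s2" and e2: "s2 ''e'' 0 = e" and m2: "s2 ''m'' 0 = m"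
    obtain qs where qs: "listed qs s2" "topped qs s2" "set qs = {T. T \<subseteq> {..<e} \<and> ind T}"
      using conjunct1[OF I[unfolded I_def]] by blast
    have W: "s2 ''W'' 0 = 2 ^ e" and Y: "\<And>i. s2 ''Y'' i = 0" and fr2: "\<And>v. v \<notin> fr \<Longrightarrow> s2 v = s v"
      using conjunct2[OF I[unfolded I_def]] by simp_all
    have n: "s2 ''n'' 0 = length qs" using qs by (simp add: listed_def)
    \<comment> \<open>The family of each stage is part of the last one, so \<open>K\<close> bounds
      the list throughout.\<close>
    have "length qs = card (set qs)" using qs(1) by (simp add: listed_def distinct_card)
    also have "\<dots> \<le> K" unfolding qs(3) K[symmetric]
    proof (rule card_mono)
      show "finite {T. T \<subseteq> {..<m} \<and> ind T}" by (rule finite_subset[of _ "Pow {..<m}"]) auto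
      show "{T. T \<subseteq> {..<e} \<and> ind T} \<subseteq> {T. T \<subseteq> {..<m} \<and> ind T}" using e by auto
    qed
    finally have len: "length qs * (m * 32 + 90) \<le> K * (m * 32 + 90)" by (rule mult_le_mono1)
    define s3 where "s3 = store ''h'' 0 (length qs) s2"
    have eq: "s3 ''n'' = s2 ''n''" "s3 ''Q'' = s2 ''Q''" "s3 ''V'' = s2 ''V''" "s3 ''U'' = s2 ''U''"
      by (simp_all add: s3_def store_apply)
    have inner: "wp orc (FOR ''i'' ''h'' (probe ;; extend_body)) (\<lambda>t s'. t \<le> length qs * (m * 32 + 90) + 9 \<and>
      (\<exists>qs'. listed qs' s' \<and> topped qs' s' \<and> set qs' = {T. T \<subseteq> {..<Suc e} \<and> ind T}) \<and>
      (\<forall>i. s' ''Y'' i = 0) \<and>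
      (\<forall>v. v \<notin> {''i'', ''c'', ''x'', ''f'', ''g'', ''Y'', ''V'', ''U'', ''Q'', ''n''} \<longrightarrow> s' v = s3 v)) s3"
    proof (rule wp_extend_all[OF _ _ qs(3)])
      show "listed qs s3" "topped qs s3"
        using listed_cong[OF eq(1,2,3)] topped_cong[OF eq(4,3)] qs by simp_all
    qed (use e e2 W Y in \<open>simp_all add: s3_def store_apply\<close>)
    have "wp orc (FOR ''i'' ''h'' (probe ;; extend_body) ;; ''W'' ::= Plus (var ''W'') (var ''W''))
     (\<lambda>t s'. t \<le> K * (m * 32 + 90) + 16 \<and> I (Suc e) (store ''e'' 0 (Suc e) s') \<and> s' ''e'' 0 = e \<and>
       s' ''m'' 0 = m) s3"
      unfolding wp_Seq
    proof (rule wp_mono[OF inner])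
      fix t s4 assume a: "t \<le> length qs * (m * 32 + 90) + 9 \<and>
        (\<exists>qs'. listed qs' s4 \<and> topped qs' s4 \<and> set qs' = {T. T \<subseteq> {..<Suc e} \<and> ind T}) \<and>
        (\<forall>i. s4 ''Y'' i = 0) \<and>
        (\<forall>v. v \<notin> {''i'', ''c'', ''x'', ''f'', ''g'', ''Y'', ''V'', ''U'', ''Q'', ''n''} \<longrightarrow> s4 v = s3 v)"
      then obtain qs' where qs': "listed qs' s4" "topped qs' s4" "set qs' = {T. T \<subseteq> {..<Suc e} \<and> ind T}"
        by (elim conjE exE)
      have t: "t \<le> length qs * (m * 32 + 90) + 9" and Y4: "\<forall>i. s4 ''Y'' i = 0"
        and fr4: "\<forall>v. v \<notin> {''i'', ''c'', ''x'', ''f'', ''g'', ''Y'', ''V'', ''U'', ''Q'', ''n''} \<longrightarrow> s4 v = s3 v"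
        using conjunct1[OF a] conjunct1[OF conjunct2[OF conjunct2[OF a]]]
          conjunct2[OF conjunct2[OF conjunct2[OF a]]] .
      define s5 where "s5 = store ''W'' 0 (2 * 2 ^ e) s4"
      define s6 where "s6 = store ''e'' 0 (Suc e) s5"
      have eq: "s6 ''n'' = s4 ''n''" "s6 ''Q'' = s4 ''Q''" "s6 ''V'' = s4 ''V''" "s6 ''U'' = s4 ''U''"
        by (simp_all add: s6_def s5_def store_apply)
      have "listed qs' s6" "topped qs' s6"
        using listed_cong[OF eq(1,2,3)] topped_cong[OF eq(4,3)] qs' by simp_all
      then have "\<exists>qs'. listed qs' s6 \<and> topped qs' s6 \<and> set qs' = {T. T \<subseteq> {..<Suc e} \<and> ind T}"
        using qs'(3) by blast
      moreover have "s6 ''W'' 0 = 2 ^ Suc e" "\<forall>i. s6 ''Y'' i = 0"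
        using Y4 by (simp_all add: s6_def s5_def store_apply)
      moreover have "\<forall>v. v \<notin> fr \<longrightarrow> s6 v = s v"
        using fr4 fr2 by (simp add: s6_def s5_def s3_def store_apply fr_def)
      ultimately have "I (Suc e) s6" unfolding I_def by blast
      moreover have "s5 ''e'' 0 = e" "s5 ''m'' 0 = m" "s4 ''W'' 0 = 2 ^ e"
        using fr4 e2 m2 W by (simp_all add: s5_def s3_def store_apply)
      moreover have "t \<le> K * (m * 32 + 90) + 9" using t len by linarith
      ultimately show "wp orc (''W'' ::= Plus (var ''W'') (var ''W''))
       (\<lambda>t2 s'. t + t2 \<le> K * (m * 32 + 90) + 16 \<and> I (Suc e) (store ''e'' 0 (Suc e) s') \<and>
        s' ''e'' 0 = e \<and> s' ''m'' 0 = m) s4"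
        by (simp add: s6_def s5_def mult_2[symmetric])
    qed
    then show "wp orc (''h'' ::= var ''n'' ;; FOR ''i'' ''h'' (probe ;; extend_body) ;;
        ''W'' ::= Plus (var ''W'') (var ''W''))
       (\<lambda>t s'. t \<le> K * (m * 32 + 90) + 20 \<and> I (Suc e) (store ''e'' 0 (Suc e) s') \<and> s' ''e'' 0 = e \<and>
       s' ''m'' 0 = m) s2"
      apply (subst wp_Seq, subst wp_Put)
      apply (simp only: aval.simps n s3_def[symmetric])
      apply (erule wp_mono)
      apply simp
      done
  qed simp
  then have "wp orc (FOR ''e'' ''m'' (''h'' ::= var ''n'' ;; FOR ''i'' ''h'' (probe ;; extend_body) ;;
      ''W'' ::= Plus (var ''W'') (var ''W'')))
     (\<lambda>t s'. t \<le> m * (K * (m * 32 + 90) + 32) + 9 \<and>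
    (\<exists>qs. listed qs s' \<and> set qs = {T. T \<subseteq> {..<m} \<and> ind T}) \<and>
    (\<forall>i. s' ''X'' i = 0 \<and> s' ''D'' i = 0 \<and> s' ''o'' i = 0)) s1"
  proof (rule wp_mono)
    fix t s' assume a: "t \<le> (\<Sum>e<m. K * (m * 32 + 90) + 20 + 12) + 9 \<and> I m s' \<and> s' ''m'' 0 = m"
    then have "\<exists>qs. listed qs s' \<and> set qs = {T. T \<subseteq> {..<m} \<and> ind T}"
      unfolding I_def by blast
    moreover have "s' ''X'' = s ''X''" "s' ''D'' = s ''D''" "s' ''o'' = s ''o''"
      using a unfolding I_def by (simp_all add: fr_def)
    ultimately show "t \<le> m * (K * (m * 32 + 90) + 32) + 9 \<and>
      (\<exists>qs. listed qs s' \<and> set qs = {T. T \<subseteq> {..<m} \<and> ind T}) \<and>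
      (\<forall>i. s' ''X'' i = 0 \<and> s' ''D'' i = 0 \<and> s' ''o'' i = 0)"
      using a 0 by (simp add: algebra_simps)
  qed
  then show ?thesis
    unfolding enumerate_by_rank_def
    apply (subst wp_Seq, subst wp_Put, subst wp_Seq, subst wp_Put)
    apply (simp only: aval.simps s1_def[symmetric])
    apply (erule wp_mono)
    apply simp
    done
qed

lemma wp_enumerate_and_solve:
  assumes m: "s ''m'' 0 = m" and 0: "\<And>x i. x \<noteq> ''m'' \<Longrightarrow> s x i = 0"
    and K: "card {T. T \<subseteq> {..<m} \<and> ind T} = K"
  shows "wp orc (enumerate_by_rank ;; solve_listed) (\<lambda>t s'. t \<le> 300 * ((m + 1) ^ 2 * K) \<and>
    s' ''out'' 0 = chain_opt {T. T \<subseteq> {..<m} \<and> ind T}) s"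
  unfolding wp_Seq
proof (rule wp_mono[OF wp_enumerate_by_rank[of s, OF m 0 K]], assumption)
  fix t s' assume a: "t \<le> m * (K * (m * 32 + 90) + 32) + 15 \<and>
    (\<exists>qs. listed qs s' \<and> set qs = {T. T \<subseteq> {..<m} \<and> ind T}) \<and>
    (\<forall>i. s' ''X'' i = 0 \<and> s' ''D'' i = 0 \<and> s' ''o'' i = 0)"
  then obtain qs where qs: "listed qs s'" "set qs = {T. T \<subseteq> {..<m} \<and> ind T}" by blast
  have len: "length qs = K"
    using qs K by (metis distinct_card listed_def)
  \<comment> \<open>The empty set makes \<open>K\<close> positive, which lets a multiple of
    \<open>(m + 1) ^ 2 * K\<close> absorb the additive constants.\<close>
  have "{} \<in> set qs" using qs(1) by (simp add: listed_def)
  then have "length qs > 0" by (cases qs) auto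
  then obtain K' where K': "K = Suc K'" using len by (cases K) auto
  have "card T \<le> m" if "T \<in> set qs" for T
    using that card_mono[of "{..<m}" T] by (auto simp: qs(2))
  then have "wp orc solve_listed (\<lambda>t s'. t \<le> length qs * (m * 85 + 85) + 29 \<and>
    s' ''out'' 0 = chain_opt (set qs)) s'"
    using a by (intro wp_solve_listed qs(1)) auto
  moreover have "m * (K * (m * 32 + 90) + 32) + 15 + (K * (m * 85 + 85) + 29) \<le> 300 * ((m + 1) ^ 2 * K)"
    unfolding K' by (simp add: power2_eq_square algebra_simps)
  ultimately show "wp orc solve_listed (\<lambda>t2 s'. t + t2 \<le> 300 * ((m + 1) ^ 2 * K) \<and>
    s' ''out'' 0 = chain_opt {T. T \<subseteq> {..<m} \<and> ind T}) s'"
    by (elim wp_mono) (use a qs len in auto)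
qed

end

section \<open>Enumerating the independent sets from the list of bases\<close>

lemma down_ordered_append_map:
  assumes "down_ordered ss" "\<And>S. S \<in> set ss \<Longrightarrow> y \<notin> S"
  shows "down_ordered (ss @ map (insert y) ss)"
proof -
  have "(ss @ map (insert y) ss) ! p - {e} \<in> set (take p (ss @ map (insert y) ss))"
    if p: "p < length (ss @ map (insert y) ss)" and e: "e \<in> (ss @ map (insert y) ss) ! p" for p e
  proof (cases "p < length ss")
    case True
    then show ?thesis using assms(1) e by (simp add: down_ordered_def nth_append)
  next
    case False
    define i where "i = p - length ss"
    have i: "i < length ss" "p = length ss + i" using p False by (auto simp: i_def)
    have S: "ss ! i \<in> set ss" using i by simp
    show ?thesis
    proof (cases "e = y")
      case True
      then show ?thesis using i S assms(2)[OF S] by (simp add: nth_append)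
    next
      case False
      \<comment> \<open>Both halves are ordered alike, so this neighbour sits earlier in the second
        half. Removing \<open>y\<close> itself leads back to the first half.\<close>
      then have "ss ! i - {e} \<in> set (take i ss)"
        using assms(1) e i by (simp add: down_ordered_def nth_append)
      moreover have "insert y (ss ! i) - {e} = insert y (ss ! i - {e})" using False by auto
      ultimately show ?thesis using i by (simp add: nth_append take_map)
    qed
  qed
  then show ?thesis unfolding down_ordered_def by blast
qed

text \<open>Mirrors the array \<open>A\<close>, which doubles with each element read from a
  basis.\<close>

definition subset_list :: "'a list \<Rightarrow> 'a set list" where
  "subset_list ys = foldl (\<lambda>ss y. ss @ map (insert y) ss) [{}] ys"

lemma subset_list_Nil [simp]: "subset_list [] = [{}]"
  by (simp add: subset_list_def)

lemma subset_list_snoc: "subset_list (ys @ [y]) = subset_list ys @ map (insert y) (subset_list ys)"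
  by (simp add: subset_list_def)

lemma set_subset_list: "set (subset_list ys) = Pow (set ys)"
proof (induction ys rule: rev_induct)
  case (snoc y ys)
  then show ?case by (simp add: subset_list_snoc Pow_insert)
qed simp

lemma length_subset_list: "length (subset_list ys) = 2 ^ length ys"
  by (induction ys rule: rev_induct) (simp_all add: subset_list_snoc)

lemma down_ordered_subset_list: "distinct ys \<Longrightarrow> down_ordered (subset_list ys)"
proof (induction ys rule: rev_induct)
  case (snoc y ys)
  then show ?case
    unfolding subset_list_snoc by (intro down_ordered_append_map) (auto simp: set_subset_list)
qed (simp add: down_ordered_def)

text \<open>The number of an element is the count of distinct elements read before it, so
  consecutive numbers are handed out and the next power of two is one doubling away.\<close>

definition first_pos :: "'a list \<Rightarrow> 'a \<Rightarrow> nat" where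
  "first_pos xs x = card (set (takeWhile (\<lambda>y. y \<noteq> x) xs))"

lemma takeWhile_nth:
  assumes "p < length xs" "xs ! p \<notin> set (take p xs)"
  shows "takeWhile (\<lambda>y. y \<noteq> xs ! p) xs = take p xs"
proof -
  have "takeWhile (\<lambda>y. y \<noteq> xs ! p) (take p xs @ xs ! p # drop (Suc p) xs) = take p xs"
    using assms(2) by (subst takeWhile_append2) auto
  then show ?thesis using assms(1) by (simp add: id_take_nth_drop[symmetric])
qed

lemma first_pos_new:
  "p < length xs \<Longrightarrow> xs ! p \<notin> set (take p xs) \<Longrightarrow> first_pos xs (xs ! p) = card (set (take p xs))"
  by (simp add: first_pos_def takeWhile_nth)

lemma ex_first_occurrence:
  assumes "x \<in> set xs"
  shows "\<exists>p<length xs. xs ! p = x \<and> x \<notin> set (take p xs)"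
proof -
  obtain ys zs where xs: "xs = ys @ x # zs" "x \<notin> set ys"
    using split_list_first[OF assms] by auto
  then show ?thesis by (intro exI[of _ "length ys"]) simp
qed

text \<open>The part before a later first occurrence contains the earlier element and thus has
  strictly more distinct entries.\<close>

lemma inj_on_first_pos: "inj_on (first_pos xs) (set xs)"
proof -
  have lt: "first_pos xs (xs ! p) < first_pos xs (xs ! q)"
    if "p < q" "q < length xs" "xs ! p \<notin> set (take p xs)" "xs ! q \<notin> set (take q xs)" for p q
  proof -
    have "xs ! p \<in> set (take q xs)" using that by (auto simp: in_set_conv_nth intro!: exI[of _ p])
    moreover have "set (take p xs) \<subseteq> set (take q xs)"
      using that by (intro set_take_subset_set_take) simp
    ultimately have "card (set (take p xs)) < card (set (take q xs))"
      using that by (intro psubset_card_mono) auto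
    then show ?thesis using that by (simp add: first_pos_new)
  qed
  show ?thesis
  proof (rule inj_onI)
    fix x y assume "x \<in> set xs" "y \<in> set xs" and eq: "first_pos xs x = first_pos xs y"
    then obtain p q where "p < length xs" "xs ! p = x" "x \<notin> set (take p xs)"
      "q < length xs" "xs ! q = y" "y \<notin> set (take q xs)" using ex_first_occurrence[of _ xs] by metis
    then show "x = y" using lt[of p q] lt[of q p] eq by (metis less_irrefl linorder_neqE_nat)
  qed
qed

text \<open>Every set formed here contains the new element and is nonempty, so \<open>V\<close>
  tells exactly whether it is listed already. It goes into \<open>A\<close> in any case, because it
  still has to be combined with further elements of the current basis.\<close>

definition add_body :: com where
  "add_body = ''c'' ::= Plus (Get ''A'' (var ''i'')) (var ''v'') ;; Put ''A'' (var ''l'') (var ''c'') ;;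
    ''l'' ::= Plus (var ''l'') (N 1) ;;
    IF (Get ''V'' (var ''c'')) SKIP
      (Put ''V'' (var ''c'') (var ''v'') ;; Put ''Q'' (var ''n'') (var ''c'') ;;
       ''n'' ::= Plus (var ''n'') (N 1))"

lemma wp_add_all:
  assumes listed: "listed qs s" and sub: "set ss \<subseteq> set qs" and down: "down_ordered ss"
    and y: "\<And>S. S \<in> set ss \<Longrightarrow> y \<notin> S" and A: "\<And>p. p < length ss \<Longrightarrow> s ''A'' p = set_encode (ss ! p)"
    and l: "s ''l'' 0 = length ss" and h: "s ''h'' 0 = length ss" and v: "s ''v'' 0 = 2 ^ y"
  shows "wp orc (FOR ''i'' ''h'' add_body) (\<lambda>t s'. t \<le> length ss * 52 + 9 \<and>
    (\<exists>qs'. listed qs' s' \<and> set qs' = set qs \<union> insert y ` set ss) \<and>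
    (\<forall>p<length (ss @ map (insert y) ss). s' ''A'' p = set_encode ((ss @ map (insert y) ss) ! p)) \<and>
    s' ''l'' 0 = length (ss @ map (insert y) ss) \<and>
    (\<forall>u. u \<notin> {''i'', ''c'', ''A'', ''l'', ''V'', ''Q'', ''n''} \<longrightarrow> s' u = s u)) s"
proof -
  define fr where "fr = {''i'', ''c'', ''A'', ''l'', ''V'', ''Q'', ''n''}"
  let ?ss = "\<lambda>i. ss @ map (insert y) (take i ss)"
  define I where "I i s' \<longleftrightarrow> (\<exists>qs'. listed qs' s' \<and> set qs' = set qs \<union> insert y ` set (take i ss)) \<and>
    (\<forall>p<length ss + i. s' ''A'' p = set_encode (?ss i ! p)) \<and> s' ''l'' 0 = length ss + i \<and>
    (\<forall>u. u \<notin> fr \<longrightarrow> s' u = s u)" for i s'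
  have "wp orc (FOR ''i'' ''h'' add_body)
     (\<lambda>t s'. t \<le> (\<Sum>i<length ss. 40 + 12) + 9 \<and> I (length ss) s' \<and> s' ''h'' 0 = length ss) s"
  proof (rule wp_FOR[where I = I and tb = "\<lambda>_. 40"])
    show "I 0 (store ''i'' 0 0 s)"
    proof -
      define s' where "s' = store ''i'' 0 0 s"
      have "s' ''n'' = s ''n''" "s' ''Q'' = s ''Q''" "s' ''V'' = s ''V''"
        by (simp_all add: s'_def store_apply)
      then have "listed qs s'" using listed_cong[of s' s qs] listed by simp
      then have "\<exists>qs'. listed qs' s' \<and> set qs' = set qs \<union> insert y ` set (take 0 ss)" by auto
      moreover have "\<forall>p<length ss + 0. s' ''A'' p = set_encode (?ss 0 ! p)" "s' ''l'' 0 = length ss + 0"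
        "\<forall>u. u \<notin> fr \<longrightarrow> s' u = s u"
        using A l by (simp_all add: s'_def store_apply fr_def)
      ultimately show ?thesis unfolding I_def s'_def by blast
    qed
    fix i s1 assume i: "i < length ss" and I: "I i s1" and i1: "s1 ''i'' 0 = i" and h1: "s1 ''h'' 0 = length ss"
    obtain qs' where qs': "listed qs' s1" "set qs' = set qs \<union> insert y ` set (take i ss)"
      using conjunct1[OF I[unfolded I_def]] by blast
    have A1: "\<And>p. p < length ss + i \<Longrightarrow> s1 ''A'' p = set_encode (?ss i ! p)"
      and l1: "s1 ''l'' 0 = length ss + i" and fr1: "\<And>u. u \<notin> fr \<Longrightarrow> s1 u = s u"
      using conjunct2[OF I[unfolded I_def]] by simp_all
    define S where "S = ss ! i"
    let ?R = "insert y S"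
    have S: "S \<in> set ss" using i by (simp add: S_def)
    then have "finite S" using sub listed by (auto simp: listed_def)
    then have code: "set_encode S + 2 ^ y = set_encode ?R" using y[OF S] by simp
    have AS: "s1 ''A'' i = set_encode S" using A1[OF trans_less_add1[OF i]] i by (simp add: nth_append S_def)
    have v1: "s1 ''v'' 0 = 2 ^ y" using fr1[of "''v''"] v by (simp add: fr_def)
    have take_Suc: "insert y ` set (take (Suc i) ss) = insert ?R (insert y ` set (take i ss))"
      using i by (simp add: take_Suc_conv_app_nth S_def)
    have ss_Suc: "?ss (Suc i) = ?ss i @ [?R]" using i by (simp add: take_Suc_conv_app_nth S_def)
    have len: "length (?ss i) = length ss + i" using i by simp
    define P where "P s' \<longleftrightarrow> I (Suc i) (store ''i'' 0 (Suc i) s') \<and> s' ''i'' 0 = i \<and>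
      s' ''h'' 0 = length ss" for s'
    define s2 where "s2 = store ''l'' 0 (Suc (length ss + i)) (store ''A'' (length ss + i) (set_encode ?R)
      (store ''c'' 0 (set_encode ?R) s1))"
    \<comment> \<open>Whether or not the set is new, \<open>A\<close> and \<open>l\<close> change in
      the same way; the two cases differ only in the list.\<close>
    have P: "P s3"
      if "\<exists>qs'. listed qs' (store ''i'' 0 (Suc i) s3) \<and> set qs' = set qs \<union> insert y ` set (take (Suc i) ss)"
        and fr3: "\<And>u. u \<notin> {''V'', ''Q'', ''n''} \<Longrightarrow> s3 u = s2 u" for s3
    proof -
      define s4 where "s4 = store ''i'' 0 (Suc i) s3"
      have "s4 ''A'' p = set_encode (?ss (Suc i) ! p)" if p: "p < length ss + Suc i" for p
      proof (cases "p = length ss + i")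
        case True
        then show ?thesis unfolding ss_Suc using fr3 len
          by (simp add: s4_def s2_def store_apply nth_append)
      next
        case False
        then have p': "p < length ss + i" using p by simp
        then have "(?ss i @ [?R]) ! p = ?ss i ! p" using len by (metis nth_append)
        moreover have "s4 ''A'' p = s1 ''A'' p" using fr3 False by (simp add: s4_def s2_def store_apply)
        ultimately show ?thesis unfolding ss_Suc using A1[OF p'] by simp
      qed
      moreover have "s4 ''l'' 0 = length ss + Suc i" using fr3 by (simp add: s4_def s2_def store_apply)
      moreover have "s4 u = s u" if "u \<notin> fr" for u
        using that fr3[of u] fr1[OF that] by (simp add: s4_def s2_def store_apply fr_def)
      ultimately have "I (Suc i) s4" unfolding I_def using that(1)[folded s4_def] by blast
      moreover have "s3 ''i'' 0 = i" "s3 ''h'' 0 = length ss"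
        using fr3 i1 h1 by (simp_all add: s2_def store_apply)
      ultimately show ?thesis unfolding P_def s4_def by blast
    qed
    have V: "s1 ''V'' (set_encode ?R) = 0 \<longleftrightarrow> ?R \<notin> set qs'"
    proof -
      have "finite ?R" using \<open>finite S\<close> by simp
      then have "if ?R \<in> set qs' then \<exists>e\<in>?R. s1 ''V'' (set_encode ?R) = 2 ^ e
          else s1 ''V'' (set_encode ?R) = 0"
        using qs'(1) unfolding listed_def by (metis insert_not_empty)
      then show ?thesis by (auto split: if_splits)
    qed
    have n1: "s1 ''n'' 0 = length qs'" using qs'(1) by (simp add: listed_def)
    have "wp orc add_body (\<lambda>t s'. t \<le> 40 \<and> P s') s1"
    proof (cases "?R \<in> set qs'")
      case True
      define s4 where "s4 = store ''i'' 0 (Suc i) s2"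
      have "s4 ''n'' = s1 ''n''" "s4 ''Q'' = s1 ''Q''" "s4 ''V'' = s1 ''V''"
        by (simp_all add: s4_def s2_def store_apply)
      then have "listed qs' s4" using listed_cong[of s4 s1 qs'] qs' by simp
      moreover have "set qs' = set qs \<union> insert y ` set (take (Suc i) ss)"
        unfolding take_Suc using qs'(2) True by auto
      ultimately have "P s2" unfolding s4_def by (intro P) auto
      then show ?thesis using True V
        by (simp add: add_body_def i1 AS v1 store_apply l1 code del: set_encode_insert)
          (simp add: s2_def del: set_encode_insert)
    next
      case False
      define s3 where "s3 = store ''n'' 0 (Suc (length qs')) (store ''Q'' (length qs') (set_encode ?R)
        (store ''V'' (set_encode ?R) (2 ^ y) s2))"
      define s4 where "s4 = store ''i'' 0 (Suc i) s3"
      have "listed (qs' @ [?R]) s4"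
      proof (rule listed_snoc[OF qs'(1) False, of y])
        fix f assume f: "f \<in> ?R"
        \<comment> \<open>The lower neighbours are \<open>S\<close>, listed from the start, and sets
          \<open>insert y (S - {f})\<close>, treated in earlier rounds since \<open>ss\<close> is
          ordered downwards.\<close>
        show "?R - {f} \<in> set qs'"
        proof (cases "f = y")
          case True
          then have "?R - {f} = S" using y[OF S] by auto
          then show ?thesis using S sub qs'(2) by auto
        next
          case False
          then have "S - {f} \<in> set (take i ss)" using down f i by (auto simp: down_ordered_def S_def)
          moreover have "?R - {f} = insert y (S - {f})" using False by auto
          ultimately show ?thesis using qs'(2) by auto
        qed
      qed (use \<open>finite S\<close> in \<open>simp_all add: s4_def s3_def s2_def store_apply\<close>)
      moreover have "set (qs' @ [?R]) = set qs \<union> insert y ` set (take (Suc i) ss)"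
        unfolding take_Suc using qs'(2) by auto
      ultimately have "P s3" unfolding s4_def by (intro P) (auto simp: s3_def store_apply)
      then show ?thesis using False V
        by (simp add: add_body_def i1 AS v1 store_apply l1 n1 code del: set_encode_insert)
          (simp add: s3_def s2_def del: set_encode_insert)
    qed
    then show "wp orc add_body (\<lambda>t s'. t \<le> 40 \<and> I (Suc i) (store ''i'' 0 (Suc i) s') \<and> s' ''i'' 0 = i \<and>
      s' ''h'' 0 = length ss) s1"
      unfolding P_def .
  qed (use h in auto)
  then show ?thesis
    by (rule wp_mono) (simp add: I_def fr_def mult_2[symmetric])
qed

text \<open>A weight is a power of two, so a zero in \<open>w\<close> marks an element not seen
  before. \<open>h\<close> saves the length of \<open>A\<close> before it is doubled.\<close>

definition fetch_body :: com where
  "fetch_body = ''d'' ::= Get ''B'' (var ''p'') ;;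
    IF (Get ''w'' (var ''d'')) SKIP
      (Put ''w'' (var ''d'') (var ''W'') ;; ''W'' ::= Plus (var ''W'') (var ''W'')) ;;
    ''v'' ::= Get ''w'' (var ''d'') ;; ''h'' ::= var ''l''"

definition read_body :: com where
  "read_body = fetch_body ;; FOR ''i'' ''h'' add_body ;; ''p'' ::= Plus (var ''p'') (N 1)"

text \<open>Resetting \<open>l\<close> to 1 discards the subsets of the previous basis without
  clearing \<open>A\<close>: cell 0 still holds the empty set, and the other cells are overwritten
  before they are read.\<close>

definition basis_body :: com where
  "basis_body = ''l'' ::= N 1 ;; FOR ''j'' ''k'' read_body"

definition enumerate_bases :: com where
  "enumerate_bases = ''W'' ::= N 1 ;; ''n'' ::= N 1 ;; FOR ''q'' ''b'' basis_body"

definition weighted :: "nat list \<Rightarrow> nat \<Rightarrow> state \<Rightarrow> bool" where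
  "weighted xs p s \<longleftrightarrow>
    (\<forall>e. s ''w'' e = (if e \<in> set (take p xs) then 2 ^ first_pos xs e else 0)) \<and>
    s ''W'' 0 = 2 ^ card (set (take p xs)) \<and> (\<forall>i<length xs. s ''B'' i = xs ! i)"

lemma weighted_cong:
  "s' ''w'' = s ''w'' \<Longrightarrow> s' ''W'' = s ''W'' \<Longrightarrow> s' ''B'' = s ''B'' \<Longrightarrow> weighted xs p s' = weighted xs p s"
  by (simp add: weighted_def)

lemma wp_fetch:
  assumes weighted: "weighted xs p s" and p: "s ''p'' 0 = p" "p < length xs"
  shows "wp orc fetch_body (\<lambda>t s'. t \<le> 30 \<and> weighted xs (Suc p) s' \<and>
    s' ''v'' 0 = 2 ^ first_pos xs (xs ! p) \<and> s' ''h'' 0 = s ''l'' 0 \<and>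
    (\<forall>u. u \<notin> {''d'', ''w'', ''W'', ''v'', ''h''} \<longrightarrow> s' u = s u)) s"
proof -
  let ?d = "xs ! p"
  have B: "s ''B'' p = ?d" and w: "\<And>e. s ''w'' e = (if e \<in> set (take p xs) then 2 ^ first_pos xs e else 0)"
    and W: "s ''W'' 0 = 2 ^ card (set (take p xs))" and B': "\<forall>i<length xs. s ''B'' i = xs ! i"
    using weighted p by (simp_all add: weighted_def)
  have take_Suc: "set (take (Suc p) xs) = insert ?d (set (take p xs))"
    using p by (simp add: take_Suc_conv_app_nth)
  show ?thesis
  proof (cases "?d \<in> set (take p xs)")
    case True
    then show ?thesis
      using B' by (simp add: fetch_body_def p B w W weighted_def store_apply take_Suc insert_absorb)
  next
    case False
    then show ?thesis
      using B' first_pos_new[OF p(2) False]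
      by (simp add: fetch_body_def p B w W weighted_def store_apply take_Suc)
  qed
qed

definition coded :: "nat set list \<Rightarrow> state \<Rightarrow> bool" where
  "coded ss s \<longleftrightarrow> (\<forall>p<length ss. s ''A'' p = set_encode (ss ! p)) \<and> s ''l'' 0 = length ss"

lemma coded_cong: "s' ''A'' = s ''A'' \<Longrightarrow> s' ''l'' = s ''l'' \<Longrightarrow> coded ss s' = coded ss s"
  by (simp add: coded_def)

lemma wp_read:
  assumes weighted: "weighted xs p s" and p: "s ''p'' 0 = p" "p < length xs"
    and y: "y = first_pos xs (xs ! p)"
    and listed: "listed qs s" and sub: "set ss \<subseteq> set qs" and down: "down_ordered ss"
    and new: "\<And>S. S \<in> set ss \<Longrightarrow> y \<notin> S" and coded: "coded ss s"
  shows "wp orc read_body (\<lambda>t s'. t \<le> length ss * 52 + 45 \<and> weighted xs (Suc p) s' \<and> s' ''p'' 0 = Suc p \<and>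
    (\<exists>qs'. listed qs' s' \<and> set qs' = set qs \<union> insert y ` set ss) \<and>
    coded (ss @ map (insert y) ss) s' \<and>
    (\<forall>u\<in>{''m'', ''k'', ''b'', ''j'', ''q'', ''X'', ''D'', ''o''}. s' u = s u)) s"
  unfolding read_body_def wp_Seq
proof (rule wp_mono[OF wp_fetch[OF weighted p]])
  fix t :: nat and s1 assume a: "t \<le> 30 \<and> weighted xs (Suc p) s1 \<and>
    s1 ''v'' 0 = 2 ^ first_pos xs (xs ! p) \<and> s1 ''h'' 0 = s ''l'' 0 \<and>
    (\<forall>u. u \<notin> {''d'', ''w'', ''W'', ''v'', ''h''} \<longrightarrow> s1 u = s u)"
  then have fr1: "\<And>u. u \<notin> {''d'', ''w'', ''W'', ''v'', ''h''} \<Longrightarrow> s1 u = s u" by (elim conjE allE impE)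
  have s1: "t \<le> 30" "weighted xs (Suc p) s1" "s1 ''v'' 0 = 2 ^ y" "s1 ''h'' 0 = length ss"
    using a coded by (simp_all add: y coded_def)
  have listed1: "listed qs s1" using listed listed_cong[of s1 s qs] fr1 by simp
  have coded1: "coded ss s1" using coded coded_cong[of s1 s ss] fr1 by simp
  show "wp orc (FOR ''i'' ''h'' add_body)
     (\<lambda>t1. wp orc (''p'' ::= Plus (var ''p'') (N 1)) (\<lambda>t2 s'. t + (t1 + t2) \<le> length ss * 52 + 45 \<and>
    weighted xs (Suc p) s' \<and> s' ''p'' 0 = Suc p \<and>
    (\<exists>qs'. listed qs' s' \<and> set qs' = set qs \<union> insert y ` set ss) \<and>
    coded (ss @ map (insert y) ss) s' \<and>
    (\<forall>u\<in>{''m'', ''k'', ''b'', ''j'', ''q'', ''X'', ''D'', ''o''}. s' u = s u))) s1"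
  proof (rule wp_mono[OF wp_add_all[OF listed1 sub down new _ _ s1(4,3)]])
    fix t1 s2 assume a2: "t1 \<le> length ss * 52 + 9 \<and>
      (\<exists>qs'. listed qs' s2 \<and> set qs' = set qs \<union> insert y ` set ss) \<and>
      (\<forall>p<length (ss @ map (insert y) ss). s2 ''A'' p = set_encode ((ss @ map (insert y) ss) ! p)) \<and>
      s2 ''l'' 0 = length (ss @ map (insert y) ss) \<and>
      (\<forall>u. u \<notin> {''i'', ''c'', ''A'', ''l'', ''V'', ''Q'', ''n''} \<longrightarrow> s2 u = s1 u)"
    then obtain qs' where qs': "listed qs' s2" "set qs' = set qs \<union> insert y ` set ss"
      by (elim conjE exE)
    have fr2: "\<forall>u. u \<notin> {''i'', ''c'', ''A'', ''l'', ''V'', ''Q'', ''n''} \<longrightarrow> s2 u = s1 u"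
      using a2 by (elim conjE)
    have t1: "t1 \<le> length ss * 52 + 9" using a2 by (elim conjE)
    have coded2: "coded (ss @ map (insert y) ss) s2" 
      unfolding coded_def using a2[THEN conjunct2, THEN conjunct2, THEN conjunct1] a2[THEN conjunct2, THEN conjunct2, THEN conjunct2, THEN conjunct1] ..
    define s3 where "s3 = store ''p'' 0 (Suc p) s2"
    have "weighted xs (Suc p) s3"
      using s1(2) weighted_cong[of s3 s1 xs "Suc p"] fr2 by (simp add: s3_def store_apply)
    moreover have "coded (ss @ map (insert y) ss) s3"
      using coded2 coded_cong[of s3 s2 "ss @ map (insert y) ss"] by (simp add: s3_def store_apply)
    moreover have "listed qs' s3"
      using qs'(1) listed_cong[of s3 s2 qs'] by (simp add: s3_def store_apply)
    then have "\<exists>qs'. listed qs' s3 \<and> set qs' = set qs \<union> insert y ` set ss" using qs'(2) by blast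
    moreover have "\<forall>u\<in>{''m'', ''k'', ''b'', ''j'', ''q'', ''X'', ''D'', ''o''}. s3 u = s u"
      using fr2 fr1 by (simp add: s3_def store_apply)
    moreover have "s2 ''p'' 0 = p" "s3 ''p'' 0 = Suc p" using fr2 fr1 p by (simp_all add: s3_def store_apply)
    ultimately show "wp orc (''p'' ::= Plus (var ''p'') (N 1)) (\<lambda>t2 s'. t + (t1 + t2) \<le> length ss * 52 + 45 \<and>
      weighted xs (Suc p) s' \<and> s' ''p'' 0 = Suc p \<and>
      (\<exists>qs'. listed qs' s' \<and> set qs' = set qs \<union> insert y ` set ss) \<and>
      coded (ss @ map (insert y) ss) s' \<and>
      (\<forall>u\<in>{''m'', ''k'', ''b'', ''j'', ''q'', ''X'', ''D'', ''o''}. s' u = s u)) s2"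
      using s1(1) t1 by (simp add: s3_def[symmetric])
  qed (use coded1 in \<open>simp_all add: coded_def\<close>)
qed

text \<open>All bases have the same size \<open>k\<close>, so their concatenation can be cut up
  again without separators.\<close>

locale basis_lists =
  fixes L :: "nat list list" and k :: nat
  assumes L: "L \<noteq> []" "\<And>xs. xs \<in> set L \<Longrightarrow> length xs = k \<and> distinct xs"
begin

abbreviation "relabel \<equiv> first_pos (concat L)"

text \<open>The empty set is included separately, as it is listed before any basis has been
  read.\<close>

definition downset :: "nat list list \<Rightarrow> nat set set" where
  "downset M = insert {} (\<Union>xs\<in>set M. Pow (relabel ` set xs))"

lemma wp_basis:
  assumes q: "q < length L" and p: "p = length (concat (take q L))"
    and weighted: "weighted (concat L) p s" "s ''p'' 0 = p"
    and listed: "listed qs s" "set qs = downset (take q L)"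
    and A: "s ''A'' 0 = 0" and k: "s ''k'' 0 = k"
  shows "wp orc basis_body (\<lambda>t s'. t \<le> 2 ^ k * 52 + k * 57 + 12 \<and>
    weighted (concat L) (length (concat (take (Suc q) L))) s' \<and>
    s' ''p'' 0 = length (concat (take (Suc q) L)) \<and>
    (\<exists>qs'. listed qs' s' \<and> set qs' = downset (take (Suc q) L)) \<and> s' ''A'' 0 = 0 \<and>
    (\<forall>u\<in>{''m'', ''k'', ''b'', ''q'', ''X'', ''D'', ''o''}. s' u = s u)) s"
proof -
  define xs where "xs = L ! q"
  have xs: "xs \<in> set L" "length xs = k" "distinct xs" using L q by (auto simp: xs_def)
  have concat: "concat L = concat (take q L) @ xs @ concat (drop (Suc q) L)"
    using q by (metis append_Cons append_Nil concat.simps(2) concat_append id_take_nth_drop xs_def)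
  have nth: "concat L ! (p + j) = xs ! j" "p + j < length (concat L)" if "j < k" for j
    using that xs by (simp_all add: concat p nth_append)
  have inj: "inj_on relabel (set xs)"
    by (rule inj_on_subset[OF inj_on_first_pos]) (use xs(1) in auto)
  let ?ss = "\<lambda>j. subset_list (map relabel (take j xs))"
  define fr where "fr = {''m'', ''k'', ''b'', ''q'', ''X'', ''D'', ''o''}"
  define I where "I j s' \<longleftrightarrow> weighted (concat L) (p + j) s' \<and> s' ''p'' 0 = p + j \<and>
    (\<exists>qs'. listed qs' s' \<and> set qs' = downset (take q L) \<union> Pow (relabel ` set (take j xs))) \<and>
    coded (?ss j) s' \<and> (\<forall>u\<in>fr. s' u = s u)" for j s'
  define s1 where "s1 = store ''l'' 0 1 s"
  have "wp orc (FOR ''j'' ''k'' read_body)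
     (\<lambda>t s'. t \<le> (\<Sum>j<k. (2 ^ j * 52 + 45) + 12) + 9 \<and> I k s' \<and> s' ''k'' 0 = k) s1"
  proof (rule wp_FOR[where I = I])
    show "s1 ''k'' 0 = k" using k by (simp add: s1_def store_apply)
    define s2 where "s2 = store ''j'' 0 0 s1"
    have "listed qs s2" using listed listed_cong[of s2 s qs] by (simp add: s2_def s1_def store_apply)
    moreover have "set qs = downset (take q L) \<union> Pow (relabel ` set (take 0 xs))"
      using listed by (simp add: downset_def)
    moreover have "weighted (concat L) (p + 0) s2"
      using weighted weighted_cong[of s2 s "concat L" p] by (simp add: s2_def s1_def store_apply)
    moreover have "coded (?ss 0) s2" using A by (simp add: coded_def s2_def s1_def store_apply)
    moreover have "s2 ''p'' 0 = p + 0" "\<forall>u\<in>fr. s2 u = s u"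
      using weighted by (simp_all add: s2_def s1_def store_apply fr_def)
    ultimately show "I 0 (store ''j'' 0 0 s1)" unfolding I_def s2_def[symmetric] by blast
    fix j s3 assume j: "j < k" and I: "I j s3" and j3: "s3 ''j'' 0 = j" and k3: "s3 ''k'' 0 = k"
    obtain qs' where qs': "listed qs' s3" "set qs' = downset (take q L) \<union> Pow (relabel ` set (take j xs))"
      using I unfolding I_def by blast
    have I3: "weighted (concat L) (p + j) s3" "s3 ''p'' 0 = p + j" "coded (?ss j) s3" "\<forall>u\<in>fr. s3 u = s u"
      using I unfolding I_def by blast+
    let ?y = "relabel (xs ! j)"
    have take_Suc: "take (Suc j) xs = take j xs @ [xs ! j]"
      using j xs by (simp add: take_Suc_conv_app_nth)
    have subxs: "set (take j xs) \<subseteq> set xs" by (rule set_take_subset)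
    \<comment> \<open>A basis has no repeated element and the renumbering is injective, so no subset
      formed so far contains the new number.\<close>
    have new: "?y \<notin> relabel ` set (take j xs)"
    proof
      assume "?y \<in> relabel ` set (take j xs)"
      then obtain x where x: "x \<in> set (take j xs)" "?y = relabel x" by auto
      then have "xs ! j = x" using inj subxs j xs(2) by (auto dest!: inj_onD)
      moreover have "distinct (take (Suc j) xs)" using xs by simp
      ultimately show False using x unfolding take_Suc by auto
    qed
    have dist: "distinct (map relabel (take j xs))"
      using xs inj subxs by (auto simp: distinct_map intro: inj_on_subset)
    have len: "length (?ss j) = 2 ^ j" using j xs by (simp add: length_subset_list)
    have rd: "wp orc read_body (\<lambda>t s'. t \<le> length (?ss j) * 52 + 45 \<and>
      weighted (concat L) (Suc (p + j)) s' \<and> s' ''p'' 0 = Suc (p + j) \<and>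
      (\<exists>qs''. listed qs'' s' \<and> set qs'' = set qs' \<union> insert ?y ` set (?ss j)) \<and>
      coded (?ss j @ map (insert ?y) (?ss j)) s' \<and>
      (\<forall>u\<in>{''m'', ''k'', ''b'', ''j'', ''q'', ''X'', ''D'', ''o''}. s' u = s3 u)) s3"
      using nth[OF j] new qs'(2) dist
      by (intro wp_read I3 qs') (auto simp: set_subset_list intro: down_ordered_subset_list)
    then show "wp orc read_body (\<lambda>t s'. t \<le> 2 ^ j * 52 + 45 \<and> I (Suc j) (store ''j'' 0 (Suc j) s') \<and>
       s' ''j'' 0 = j \<and> s' ''k'' 0 = k) s3"
    proof (rule wp_mono)
      fix t s4 assume a: "t \<le> length (?ss j) * 52 + 45 \<and>
        weighted (concat L) (Suc (p + j)) s4 \<and> s4 ''p'' 0 = Suc (p + j) \<and>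
        (\<exists>qs''. listed qs'' s4 \<and> set qs'' = set qs' \<union> insert ?y ` set (?ss j)) \<and>
        coded (?ss j @ map (insert ?y) (?ss j)) s4 \<and>
        (\<forall>u\<in>{''m'', ''k'', ''b'', ''j'', ''q'', ''X'', ''D'', ''o''}. s4 u = s3 u)"
      then obtain qs'' where qs'': "listed qs'' s4" "set qs'' = set qs' \<union> insert ?y ` set (?ss j)"
        by (elim conjE exE)
      have fr4: "s4 u = s3 u" if "u \<in> {''m'', ''k'', ''b'', ''j'', ''q'', ''X'', ''D'', ''o''}" for u
        using a that by (elim conjE) (rule bspec)
      have s4: "weighted (concat L) (Suc (p + j)) s4" "s4 ''p'' 0 = Suc (p + j)"
        "coded (?ss j @ map (insert ?y) (?ss j)) s4"
        using a[THEN conjunct2, THEN conjunct1] a[THEN conjunct2, THEN conjunct2, THEN conjunct1]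
          a[THEN conjunct2, THEN conjunct2, THEN conjunct2, THEN conjunct2, THEN conjunct1] .
      define s5 where "s5 = store ''j'' 0 (Suc j) s4"
      have "weighted (concat L) (p + Suc j) s5"
        using s4(1) weighted_cong[of s5 s4 "concat L" "Suc (p + j)"] by (simp add: s5_def store_apply)
      moreover have "s5 ''p'' 0 = p + Suc j" using s4 by (simp add: s5_def store_apply)
      moreover have "coded (?ss (Suc j)) s5"
        using s4(3) coded_cong[of s5 s4] by (simp add: s5_def store_apply take_Suc subset_list_snoc)
      moreover have "listed qs'' s5"
        using qs'' listed_cong[of s5 s4 qs''] by (simp add: s5_def store_apply)
      moreover have "set qs'' = downset (take q L) \<union> Pow (relabel ` set (take (Suc j) xs))"
        using qs''(2) qs'(2) by (simp add: take_Suc set_subset_list Pow_insert Un_assoc)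
      moreover have "\<forall>u\<in>fr. s5 u = s u" using I3(4) fr4 by (simp add: s5_def store_apply fr_def)
      ultimately have "I (Suc j) s5" unfolding I_def by blast
      moreover have "s4 ''j'' 0 = j" "s4 ''k'' 0 = k" using j3 k3 fr4 by simp_all
      moreover have "t \<le> 2 ^ j * 52 + 45" using a unfolding len by (rule conjunct1)
      ultimately show "t \<le> 2 ^ j * 52 + 45 \<and> I (Suc j) (store ''j'' 0 (Suc j) s4) \<and>
         s4 ''j'' 0 = j \<and> s4 ''k'' 0 = k" unfolding s5_def by blast
    qed
  qed simp
  note loop = this
  \<comment> \<open>The rounds have lengths \<open>2 ^ j\<close>, a geometric sum below
    \<open>2 ^ k\<close>.\<close>
  have time: "(\<Sum>j<k. (2 ^ j * 52 + 45) + 12) + 9 \<le> 2 ^ k * 52 + k * 57 + (9 :: nat)"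
    by (induction k) auto
  have fin: "length (concat (take (Suc q) L)) = p + k"
    using q xs by (simp add: take_Suc_conv_app_nth p xs_def)
  have down: "downset (take (Suc q) L) = downset (take q L) \<union> Pow (relabel ` set xs)"
    using q by (auto simp: downset_def take_Suc_conv_app_nth xs_def)
  show ?thesis
    unfolding basis_body_def wp_Seq wp_Put
  proof (simp only: aval.simps s1_def[symmetric], rule wp_mono[OF loop])
    fix t :: nat and s' assume a: "t \<le> (\<Sum>j<k. (2 ^ j * 52 + 45) + 12) + 9 \<and> I k s' \<and> s' ''k'' 0 = k"
    then have I: "weighted (concat L) (p + k) s'" "s' ''p'' 0 = p + k" "coded (?ss k) s'" "\<forall>u\<in>fr. s' u = s u"
      "\<exists>qs'. listed qs' s' \<and> set qs' = downset (take q L) \<union> Pow (relabel ` set xs)"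
      using xs(2) unfolding I_def by auto
    \<comment> \<open>Doubling appends at the end, so the empty set stays in cell 0, where the next
      basis expects it.\<close>
    have "subset_list ys ! 0 = {}" for ys :: "nat list"
      by (induction ys rule: rev_induct) (simp_all add: subset_list_snoc nth_append length_subset_list)
    then have "s' ''A'' 0 = 0" using I(3) by (simp add: coded_def length_subset_list)
    moreover have "acost (N 0) + acost (N 1) + 1 + t \<le> 2 ^ k * 52 + k * 57 + 12"
      using conjunct1[OF a] time by simp
    ultimately show "acost (N 0) + acost (N 1) + 1 + t \<le> 2 ^ k * 52 + k * 57 + 12 \<and>
      weighted (concat L) (length (concat (take (Suc q) L))) s' \<and>
      s' ''p'' 0 = length (concat (take (Suc q) L)) \<and>
      (\<exists>qs'. listed qs' s' \<and> set qs' = downset (take (Suc q) L)) \<and> s' ''A'' 0 = 0 \<and>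
      (\<forall>u\<in>{''m'', ''k'', ''b'', ''q'', ''X'', ''D'', ''o''}. s' u = s u)"
      using I unfolding fin down fr_def by blast
  qed
qed


text \<open>The constant 6 is attained at \<open>n = 2\<close>. From \<open>i\<close> to
  \<open>i + 1\<close> the left side grows by the factor \<open>2 * (i + 2) / (i + 1)\<close>, which
  for \<open>i \<ge> 2\<close> is at most the factor \<open>i + 1\<close> of the factorial.\<close>

lemma power2_mult_Suc_le_fact: "2 ^ n * (n + 1) \<le> (6 * fact n :: nat)"
proof (induction n rule: nat_less_induct)
  case (1 n)
  show ?case
  proof (cases "n < 3")
    case True
    then have "n = 0 \<or> n = 1 \<or> n = 2" by auto
    then show ?thesis by (auto simp: fact_numeral)
  next
    case False
    then obtain i where n: "n = Suc i" "i \<ge> 2" by (cases n) auto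
    have "2 * (i + 2) \<le> (i + 1) * (i + 1)"
      using n(2) by (simp add: algebra_simps) (use mult_le_mono1[of 2 i i] in linarith)
    then have "2 ^ i * (2 * (i + 2)) \<le> 2 ^ i * ((i + 1) * (i + 1))" by (rule mult_le_mono2)
    also have "\<dots> = (i + 1) * (2 ^ i * (i + 1))" by (simp only: ac_simps)
    also have "\<dots> \<le> (i + 1) * (6 * fact i)" using 1 n by (intro mult_le_mono2) auto
    finally show ?thesis by (simp add: n algebra_simps)
  qed
qed

lemma wp_enumerate_bases:
  assumes 0: "\<And>x i. x \<notin> {''m'', ''k'', ''b'', ''B''} \<Longrightarrow> s x i = 0"
    and s: "s ''k'' 0 = k" "s ''b'' 0 = length L" "\<And>i. i < length (concat L) \<Longrightarrow> s ''B'' i = concat L ! i"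
  shows "wp orc enumerate_bases (\<lambda>t s'. t \<le> length L * (2 ^ k * 52 + k * 57 + 24) + 15 \<and>
    (\<exists>qs. listed qs s' \<and> set qs = downset L) \<and>
    (\<forall>i. s' ''X'' i = 0 \<and> s' ''D'' i = 0 \<and> s' ''o'' i = 0)) s"
proof -
  define fr where "fr = {''m'', ''k'', ''b'', ''X'', ''D'', ''o''}"
  define I where "I q s' \<longleftrightarrow> weighted (concat L) (length (concat (take q L))) s' \<and>
    s' ''p'' 0 = length (concat (take q L)) \<and>
    (\<exists>qs'. listed qs' s' \<and> set qs' = downset (take q L)) \<and> s' ''A'' 0 = 0 \<and>
    (\<forall>u\<in>fr. s' u = s u)" for q s'
  define s1 where "s1 = store ''n'' 0 1 (store ''W'' 0 1 s)"
  have "wp orc (FOR ''q'' ''b'' basis_body)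
    (\<lambda>t s'. t \<le> (\<Sum>j<length L. (2 ^ k * 52 + k * 57 + 12) + 12) + 9 \<and> I (length L) s' \<and> s' ''b'' 0 = length L) s1"
  proof (rule wp_FOR[where I = I and tb = "\<lambda>_. 2 ^ k * 52 + k * 57 + 12"])
    show "s1 ''b'' 0 = length L" using s by (simp add: s1_def store_apply)
    define s2 where "s2 = store ''q'' 0 0 s1"
    have "listed [{}] s2"
      by (rule listed_initial) (simp_all add: s2_def s1_def store_apply 0)
    moreover have "set [{}] = downset (take 0 L)" by (simp add: downset_def)
    moreover have "weighted (concat L) (length (concat (take 0 L))) s2"
      using s by (simp add: weighted_def s2_def s1_def store_apply 0)
    moreover have "s2 ''p'' 0 = length (concat (take 0 L))" "s2 ''A'' 0 = 0" "\<forall>u\<in>fr. s2 u = s u"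
      by (simp_all add: s2_def s1_def store_apply fr_def 0)
    ultimately show "I 0 (store ''q'' 0 0 s1)" unfolding I_def s2_def[symmetric] by blast
    fix q s3 assume q: "q < length L" and I: "I q s3" and q3: "s3 ''q'' 0 = q" and b3: "s3 ''b'' 0 = length L"
    obtain qs where qs: "listed qs s3" "set qs = downset (take q L)"
      using I unfolding I_def by blast
    have I3: "weighted (concat L) (length (concat (take q L))) s3"
      "s3 ''p'' 0 = length (concat (take q L))" "s3 ''A'' 0 = 0" "\<forall>u\<in>fr. s3 u = s u"
      using I unfolding I_def by blast+
    have "s3 ''k'' 0 = k" using I3(4) s by (simp add: fr_def)
    then have "wp orc basis_body (\<lambda>t s'. t \<le> 2 ^ k * 52 + k * 57 + 12 \<and>
      weighted (concat L) (length (concat (take (Suc q) L))) s' \<and>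
      s' ''p'' 0 = length (concat (take (Suc q) L)) \<and>
      (\<exists>qs'. listed qs' s' \<and> set qs' = downset (take (Suc q) L)) \<and> s' ''A'' 0 = 0 \<and>
      (\<forall>u\<in>{''m'', ''k'', ''b'', ''q'', ''X'', ''D'', ''o''}. s' u = s3 u)) s3"
      using wp_basis[OF q refl I3(1,2) qs I3(3)] by simp
    then show "wp orc basis_body (\<lambda>t s'. t \<le> 2 ^ k * 52 + k * 57 + 12 \<and>
      I (Suc q) (store ''q'' 0 (Suc q) s') \<and> s' ''q'' 0 = q \<and> s' ''b'' 0 = length L) s3"
    proof (rule wp_mono)
      fix t s4 assume a: "t \<le> 2 ^ k * 52 + k * 57 + 12 \<and>
        weighted (concat L) (length (concat (take (Suc q) L))) s4 \<and>
        s4 ''p'' 0 = length (concat (take (Suc q) L)) \<and>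
        (\<exists>qs'. listed qs' s4 \<and> set qs' = downset (take (Suc q) L)) \<and> s4 ''A'' 0 = 0 \<and>
        (\<forall>u\<in>{''m'', ''k'', ''b'', ''q'', ''X'', ''D'', ''o''}. s4 u = s3 u)"
      then obtain qs' where qs': "listed qs' s4" "set qs' = downset (take (Suc q) L)"
        by (elim conjE exE)
      have fr4: "s4 u = s3 u" if "u \<in> {''m'', ''k'', ''b'', ''q'', ''X'', ''D'', ''o''}" for u
        using a that by (elim conjE) (rule bspec)
      have w4: "weighted (concat L) (length (concat (take (Suc q) L))) s4"
        using a[THEN conjunct2, THEN conjunct1] .
      define s5 where "s5 = store ''q'' 0 (Suc q) s4"
      have "weighted (concat L) (length (concat (take (Suc q) L))) s5"
        using w4 weighted_cong[of s5 s4] by (simp add: s5_def store_apply)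
      moreover have "listed qs' s5"
        using qs' listed_cong[of s5 s4 qs'] by (simp add: s5_def store_apply)
      moreover have "s5 ''p'' 0 = length (concat (take (Suc q) L))" "s5 ''A'' 0 = 0"
        using a[THEN conjunct2, THEN conjunct2, THEN conjunct1]
          a[THEN conjunct2, THEN conjunct2, THEN conjunct2, THEN conjunct2, THEN conjunct1]
        by (simp_all add: s5_def store_apply)
      moreover have "\<forall>u\<in>fr. s5 u = s u" using I3(4) fr4 by (simp add: s5_def store_apply fr_def)
      ultimately have "I (Suc q) s5" unfolding I_def using qs'(2) by blast
      moreover have "s4 ''q'' 0 = q" "s4 ''b'' 0 = length L" using q3 b3 fr4 by simp_all
      ultimately show "t \<le> 2 ^ k * 52 + k * 57 + 12 \<and>
        I (Suc q) (store ''q'' 0 (Suc q) s4) \<and> s4 ''q'' 0 = q \<and> s4 ''b'' 0 = length L"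
        using conjunct1[OF a] unfolding s5_def by blast
    qed
  qed simp
  note loop = this
  show ?thesis
    unfolding enumerate_bases_def
    apply (subst wp_Seq, subst wp_Put, subst wp_Seq, subst wp_Put)
    apply (simp only: aval.simps s1_def[symmetric])
  proof (rule wp_mono[OF loop])
    fix t s' assume a: "t \<le> (\<Sum>j<length L. (2 ^ k * 52 + k * 57 + 12) + 12) + 9 \<and> I (length L) s' \<and>
      s' ''b'' 0 = length L"
    then have I: "I (length L) s'" by blast
    have t: "t \<le> length L * (2 ^ k * 52 + k * 57 + 24) + 9" using conjunct1[OF a] by (simp add: algebra_simps)
    have "\<exists>qs. listed qs s' \<and> set qs = downset L" using I unfolding I_def by simp
    moreover have "s' ''X'' = s ''X''" "s' ''D'' = s ''D''" "s' ''o'' = s ''o''"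
      using I unfolding I_def by (simp_all add: fr_def)
    ultimately show "acost (N 0) + acost (N 1) + 1 + (acost (N 0) + acost (N 1) + 1 + t)
        \<le> length L * (2 ^ k * 52 + k * 57 + 24) + 15 \<and>
      (\<exists>qs. listed qs s' \<and> set qs = downset L) \<and>
      (\<forall>i. s' ''X'' i = 0 \<and> s' ''D'' i = 0 \<and> s' ''o'' i = 0)"
      using t 0 by simp
  qed
qed

lemma card_downset_le: "card (downset L) \<le> length L * 2 ^ k"
proof -
  have "downset L = (\<Union>xs\<in>set L. Pow (relabel ` set xs))" 
    unfolding downset_def using last_in_set[OF L(1)] by blast
  also have "card \<dots> \<le> (\<Sum>xs\<in>set L. card (Pow (relabel ` set xs)))" by (rule card_UN_le) simp
  also have "\<dots> \<le> (\<Sum>xs\<in>set L. 2 ^ k)"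
  proof (rule sum_mono)
    fix xs assume "xs \<in> set L"
    then have "card (relabel ` set xs) \<le> k"
      using L(2) card_image_le[of "set xs" relabel] by (simp add: distinct_card)
    then show "card (Pow (relabel ` set xs)) \<le> 2 ^ k" by (simp add: card_Pow)
  qed
  also have "\<dots> \<le> length L * 2 ^ k" by (simp add: card_length)
  finally show ?thesis .
qed

lemma wp_enumerate_bases_and_solve:
  assumes "\<And>x i. x \<notin> {''m'', ''k'', ''b'', ''B''} \<Longrightarrow> s x i = 0"
    and "s ''k'' 0 = k" "s ''b'' 0 = length L" "\<And>i. i < length (concat L) \<Longrightarrow> s ''B'' i = concat L ! i"
  shows "wp orc (enumerate_bases ;; solve_listed) (\<lambda>t s'. t \<le> 1500 * (length L * fact k) \<and>
    s' ''out'' 0 = chain_opt (downset L)) s"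
  unfolding wp_Seq
proof (rule wp_mono[OF wp_enumerate_bases])
  fix t s' assume a: "t \<le> length L * (2 ^ k * 52 + k * 57 + 24) + 15 \<and>
    (\<exists>qs. listed qs s' \<and> set qs = downset L) \<and>
    (\<forall>i. s' ''X'' i = 0 \<and> s' ''D'' i = 0 \<and> s' ''o'' i = 0)"
  then obtain qs where qs: "listed qs s'" "set qs = downset L" by blast
  have len: "length qs \<le> length L * 2 ^ k"
    using qs card_downset_le by (metis distinct_card listed_def)
  have "card T \<le> k" if T: "T \<in> set qs" for T
  proof (cases "T = {}")
    case False
    then obtain xs where xs: "xs \<in> set L" "T \<subseteq> relabel ` set xs" using T qs(2) by (auto simp: downset_def)
    have "card T \<le> card (relabel ` set xs)" using xs(2) by (intro card_mono) auto
    also have "\<dots> \<le> card (set xs)" by (rule card_image_le) simp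
    also have "\<dots> = k" using L(2) xs(1) by (simp add: distinct_card)
    finally show ?thesis .
  qed simp
  then have solve: "wp orc solve_listed (\<lambda>t s'. t \<le> length qs * (k * 85 + 85) + 29 \<and>
    s' ''out'' 0 = chain_opt (set qs)) s'"
    using a by (intro wp_solve_listed qs(1)) auto
  have "length qs * (k * 85 + 85) \<le> length L * 2 ^ k * (k * 85 + 85)" using len by (rule mult_le_mono1)
  also have "\<dots> = length L * (85 * (2 ^ k * (k + 1)))" by (simp add: algebra_simps)
  finally have 1: "length qs * (k * 85 + 85) \<le> length L * (85 * (2 ^ k * (k + 1)))" .
  have "k * 57 \<le> 57 * (2 ^ k * k)" by simp
  moreover have "(1 :: nat) \<le> 2 ^ k" by simp
  ultimately have "2 ^ k * 52 + k * 57 + 24 \<le> 76 * (2 ^ k * (k + 1))"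
    unfolding add_mult_distrib2 mult_1_right by linarith
  then have 2: "length L * (2 ^ k * 52 + k * 57 + 24) \<le> length L * (76 * (2 ^ k * (k + 1)))"
    by (rule mult_le_mono2)
  have "1 \<le> length L" using L(1) by (cases L) auto
  then have 3: "1 \<le> length L * (2 ^ k * (k + 1))" by (simp add: Suc_le_eq)
  have 4: "length L * (2 ^ k * (k + 1)) \<le> length L * (6 * fact k)"
    by (rule mult_le_mono2[OF power2_mult_Suc_le_fact])
  \<comment> \<open>With \<open>a = length L * (2 ^ k * (k + 1))\<close> and
    \<open>a \<ge> 1\<close>, the sum is at most \<open>76 * a + 85 * a + 44 * a\<close>, and
    \<open>6 * 205 = 1230\<close> is below 1500.\<close>
  have "length L * (2 ^ k * 52 + k * 57 + 24) + 15 + (length qs * (k * 85 + 85) + 29)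
      \<le> 1500 * (length L * fact k)"
    using 1 2 3 4 by (simp only: mult.left_commute[of "length L"])
  then show "wp orc solve_listed (\<lambda>t2 s'. t + t2 \<le> 1500 * (length L * fact k) \<and>
    s' ''out'' 0 = chain_opt (downset L)) s'"
    by (intro wp_mono[OF solve]) (use a qs in auto)
qed (use assms in auto)

end

section \<open>Running times\<close>

text \<open>The family \<open>F\<close> of label sets mediates: \<open>lab\<close> carries it to the
  independent sets, \<open>relabel\<close> to the family computed by the program. Both maps are
  injective on the labels that occur, so all three optima agree.\<close>

lemma basis_list_inputs_solved:
  assumes "matroid E r" and inp: "(orc, s) \<in> basis_list_inputs E r"
  shows "\<exists>t s'. exec orc (enumerate_bases ;; solve_listed) s t s' \<and> s' ''out'' 0 = mlop E r \<and>
    t \<le> 1500 * (card (bases E r) * fact (r E))"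
proof -
  interpret matroid E r by fact
  obtain L lab where s: "s = (\<lambda>_ _. 0)(''m'' := scalar (card E), ''k'' := scalar (r E),
        ''b'' := scalar (length L), ''B'' := array_of (concat L))"
    and lab: "bij_betw lab {..<card E} E" and sub: "\<forall>xs \<in> set L. distinct xs \<and> set xs \<subseteq> {..<card E}"
    and dist: "distinct (map set L)" and img_L: "(\<lambda>xs. lab ` set xs) ` set L = bases E r"
    using inp by (auto simp: basis_list_inputs_def)
  have inj: "inj_on lab {..<card E}" using lab by (rule bij_betw_imp_inj_on)
  have "bases E r = (`) lab ` set (map set L)" using img_L by (simp add: image_image)
  moreover have "inj_on ((`) lab) (set (map set L))"
    by (rule inj_on_subset[OF inj_on_image_Pow[OF inj]]) (use sub in auto)
  ultimately have card: "card (bases E r) = length L"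
    using distinct_card[OF dist] by (simp add: card_image)
  \<comment> \<open>The empty set lies in some basis, so the list is nonempty even in rank
    zero.\<close>
  have "L \<noteq> []" using img_L indep_subset_basis[OF indep_empty] by auto
  moreover have "length xs = r E \<and> distinct xs" if xs: "xs \<in> set L" for xs
  proof -
    have "card (lab ` set xs) = r E" using img_L xs bases_iff by blast
    moreover have "card (lab ` set xs) = card (set xs)"
      using sub xs by (intro card_image inj_on_subset[OF inj]) auto
    ultimately show ?thesis using sub xs by (simp add: distinct_card)
  qed
  ultimately interpret basis_lists L "r E" by unfold_locales auto
  define F where "F = {S. \<exists>xs\<in>set L. S \<subseteq> set xs}"
  have down: "\<And>S T. T \<in> F \<Longrightarrow> S \<subseteq> T \<Longrightarrow> S \<in> F" by (auto simp: F_def)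
  have "Collect (indep E r) = (`) lab ` F"
  proof (intro set_eqI iffI)
    fix I assume "I \<in> Collect (indep E r)"
    then obtain B where "B \<in> bases E r" "I \<subseteq> B" using indep_iff_subset_basis by auto
    then obtain xs where xs: "xs \<in> set L" "I \<subseteq> lab ` set xs" unfolding img_L[symmetric] by auto
    from xs(2) obtain S where "S \<subseteq> set xs" "I = lab ` S" by (rule subset_imageE)
    with xs(1) show "I \<in> (`) lab ` F" unfolding F_def by blast
  next
    fix I assume "I \<in> (`) lab ` F"
    then obtain S xs where "xs \<in> set L" "S \<subseteq> set xs" "I = lab ` S" by (auto simp: F_def)
    moreover have "lab ` set xs \<in> bases E r" unfolding img_L[symmetric] using \<open>xs \<in> set L\<close> by simp
    moreover have "I \<subseteq> lab ` set xs" using \<open>S \<subseteq> set xs\<close> \<open>I = lab ` S\<close> by auto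
    ultimately show "I \<in> Collect (indep E r)" using indep_iff_subset_basis[of I] by blast
  qed
  moreover have "inj_on lab (\<Union>F)"
    using sub by (intro inj_on_subset[OF inj]) (auto simp: F_def)
  ultimately have opt: "mlop E r = chain_opt F"
    using chain_opt_image[OF _ down] mlop_eq_chain_opt by simp
  have "downset L = (`) relabel ` F"
  proof (intro set_eqI iffI)
    fix T assume "T \<in> downset L"
    then have "T = {} \<or> (\<exists>xs\<in>set L. T \<subseteq> relabel ` set xs)" by (auto simp: downset_def)
    then obtain xs where xs: "xs \<in> set L" "T \<subseteq> relabel ` set xs"
      using last_in_set[OF \<open>L \<noteq> []\<close>] by (meson empty_subsetI)
    from xs(2) obtain S where "S \<subseteq> set xs" "T = relabel ` S" by (rule subset_imageE)
    with xs(1) show "T \<in> (`) relabel ` F" unfolding F_def by blast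
  next
    fix T assume "T \<in> (`) relabel ` F"
    then obtain S xs where "xs \<in> set L" "S \<subseteq> set xs" "T = relabel ` S" by (auto simp: F_def)
    then show "T \<in> downset L" unfolding downset_def by blast
  qed
  moreover have "inj_on relabel (\<Union>F)"
    by (rule inj_on_subset[OF inj_on_first_pos]) (auto simp: F_def)
  ultimately have "chain_opt (downset L) = mlop E r"
    using chain_opt_image[OF _ down, of relabel] opt by simp
  moreover have "wp orc (enumerate_bases ;; solve_listed) (\<lambda>t s'. t \<le> 1500 * (length L * fact (r E)) \<and>
    s' ''out'' 0 = chain_opt (downset L)) s"
    by (rule wp_enumerate_bases_and_solve) (simp_all add: s scalar_def array_of_def)
  ultimately show ?thesis unfolding wp_def card by auto
qed

lemma (in matroid) card_indeps_le: "card (Collect (indep E r)) \<le> card (bases E r) * 2 ^ r E"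
proof -
  have "Collect (indep E r) = (\<Union>B\<in>bases E r. Pow B)" using indep_iff_subset_basis by auto
  also have "card \<dots> \<le> (\<Sum>B\<in>bases E r. card (Pow B))"
    by (rule card_UN_le) (auto intro: finite_subset[OF _ finite_indeps] simp: bases_iff)
  also have "\<dots> = card (bases E r) * 2 ^ r E"
    by (simp add: bases_iff card_Pow indep_finite)
  finally show ?thesis .
qed

text \<open>For positive \<open>n\<close> the factorial grows at least by the factor 2 in each step;
  equality at \<open>n = 1\<close> explains the constant.\<close>

lemma power2_le_fact: "2 ^ n \<le> (2 * fact n :: nat)"
proof (induction n)
  case (Suc n)
  show ?case
  proof (cases n)
    case (Suc i)
    have "2 * 2 ^ n \<le> Suc n * (2 * fact n :: nat)"
      using Suc.IH \<open>n = Suc i\<close> by (intro mult_le_mono) auto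
    then show ?thesis by (simp add: algebra_simps)
  qed simp
qed simp

lemma rank_oracle_inputs_solved:
  assumes "matroid E r" and inp: "(orc, s) \<in> rank_oracle_inputs E r"
  shows "\<exists>t s'. exec orc (enumerate_by_rank ;; solve_listed) s t s' \<and> s' ''out'' 0 = mlop E r \<and>
    t \<le> 600 * ((card E + 1) ^ 2 * (card (bases E r) * fact (r E)))"
proof -
  interpret matroid E r by fact
  obtain lab where orc: "orc = (\<lambda>A. r (lab ` (A \<inter> {..<card E})))"
    and s: "s = (\<lambda>_ _. 0)(''m'' := scalar (card E))" and lab: "bij_betw lab {..<card E} E"
    using inp by (auto simp: rank_oracle_inputs_def)
  let ?m = "card E"
  have inj: "inj_on lab {..<?m}" and img: "lab ` {..<?m} = E" using lab by (auto simp: bij_betw_def)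
  define ind where "ind T \<longleftrightarrow> indep E r (lab ` T)" for T
  interpret rank_test ?m ind orc
  proof
    show "ind {}" by (simp add: ind_def indep_empty)
    show "ind S" if "ind T" "S \<subseteq> T" for S T
      using that indep_subset[of "lab ` T" "lab ` S"] by (auto simp: ind_def)
    show "orc T < orc (insert e T) \<longleftrightarrow> ind (insert e T)"
      if T: "T \<subseteq> {..<?m}" "ind T" "e < ?m" "e \<notin> T" for T e
    proof -
      have "lab e \<notin> lab ` T" using T inj by (auto simp: inj_on_def)
      moreover have e: "lab e \<in> E" using img T(3) by auto
      ultimately have "ind (insert e T) \<longleftrightarrow> r (insert (lab e) (lab ` T)) \<noteq> r (lab ` T)"
        using indep_insert_iff[of "lab ` T" "lab e"] T(2) by (simp add: ind_def)
      moreover have "r (lab ` T) \<le> r (insert (lab e) (lab ` T))"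
        using T(2) e by (intro rank_mono) (auto simp: ind_def indep_def)
      \<comment> \<open>Both queried sets consist of labels, so the restriction inside the oracle
        leaves them unchanged.\<close>
      moreover have "T \<inter> {..<?m} = T" "insert e T \<inter> {..<?m} = insert e T" using T by auto
      then have "orc T = r (lab ` T)" "orc (insert e T) = r (insert (lab e) (lab ` T))"
        by (simp_all only: orc image_insert)
      ultimately show ?thesis by linarith
    qed
  qed
  let ?F = "{T. T \<subseteq> {..<?m} \<and> ind T}"
  have img_F: "Collect (indep E r) = (`) lab ` ?F"
  proof (intro set_eqI iffI)
    fix I assume "I \<in> Collect (indep E r)"
    then obtain T where "T \<subseteq> {..<?m}" "I = lab ` T" 
      using img subset_imageE[of I lab "{..<?m}"] by (metis indep_def mem_Collect_eq)
    then show "I \<in> (`) lab ` ?F" using \<open>I \<in> Collect (indep E r)\<close> by (auto simp: ind_def)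
  qed (auto simp: ind_def)
  have opt: "chain_opt ?F = mlop E r"
    unfolding mlop_eq_chain_opt img_F
    by (rule chain_opt_image[symmetric])
      (auto intro: inj_on_subset[OF inj] ind_subset)
  have "card ?F = card (Collect (indep E r))"
    unfolding img_F
    by (rule card_image[symmetric], rule inj_on_subset[OF inj_on_image_Pow[OF inj]]) auto
  also have "\<dots> \<le> card (bases E r) * (2 * fact (r E))"
    using card_indeps_le mult_le_mono2[OF power2_le_fact] by (rule order_trans)
  finally have "300 * ((?m + 1) ^ 2 * card ?F) \<le> 300 * ((?m + 1) ^ 2 * (card (bases E r) * (2 * fact (r E))))"
    by (intro mult_le_mono2)
  also have "\<dots> = 600 * ((?m + 1) ^ 2 * (card (bases E r) * fact (r E)))"
    by simp
  finally have time: "300 * ((?m + 1) ^ 2 * card ?F) \<le> 600 * ((?m + 1) ^ 2 * (card (bases E r) * fact (r E)))" .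
  have "wp orc (enumerate_by_rank ;; solve_listed) (\<lambda>t s'. t \<le> 300 * ((?m + 1) ^ 2 * card ?F) \<and>
    s' ''out'' 0 = chain_opt ?F) s"
    by (rule wp_enumerate_and_solve) (simp_all add: s scalar_def)
  then show ?thesis unfolding wp_def opt using order_trans[OF _ time] by blast
qed

lemma poly_bigo_power:
  fixes p :: "real poly"
  shows "(\<lambda>m. poly p (real m)) \<in> O(\<lambda>m. real m ^ degree p)"
proof -
  have "(\<lambda>m. coeff p i * real m ^ i) \<in> O(\<lambda>m. real m ^ degree p)" if "i \<le> degree p" for i
  proof (rule bigoI)
    show "\<forall>\<^sub>F m in sequentially. norm (coeff p i * real m ^ i) \<le> \<bar>coeff p i\<bar> * norm (real m ^ degree p)"
      using eventually_ge_at_top[of 1]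
    proof eventually_elim
      case (elim m)
      then show ?case
        using that by (auto simp: abs_mult intro!: mult_left_mono power_increasing)
    qed
  qed
  then show ?thesis unfolding poly_altdef by (intro big_sum_in_bigo) auto
qed

theorem theorem3:
  fixes X :: "('a set \<times> ('a set \<Rightarrow> nat)) set" and g h :: "nat \<Rightarrow> nat"
  assumes "\<And>E r. (E, r) \<in> X \<Longrightarrow> matroid E r"
    and "\<And>E r. (E, r) \<in> X \<Longrightarrow> card (bases E r) \<le> g (card E)"
    and "\<And>E r. (E, r) \<in> X \<Longrightarrow> r E \<le> h (card E)"
  shows "(\<exists>T. mlop_solvable_in_time basis_list_inputs X T \<and>
              (\<lambda>m. real (T m)) \<in> O(\<lambda>m. real (g m) * fact (h m))) \<and>
         (\<exists>T d. mlop_solvable_in_time rank_oracle_inputs X T \<and>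
              (\<lambda>m. real (T m)) \<in> O(\<lambda>m. real m ^ d * (real (g m) * fact (h m)))) \<and>
         ((\<exists>p :: real poly. \<forall>m. real (g m) = poly p (real m)) \<and> (\<exists>K. \<forall>m. h m \<le> K) \<longrightarrow>
              mlop_in_P basis_list_inputs X \<and> mlop_in_P rank_oracle_inputs X)"
proof -
  define T1 where "T1 m = 1500 * (g m * fact (h m))" for m
  \<comment> \<open>One factor \<open>m + 1\<close> stems from the stages of the enumeration, the
    other from writing a set into the query vector. The shift keeps a positive factor for
    \<open>m = 0\<close>.\<close>
  define T2 where "T2 m = 600 * ((m + 1) ^ 2 * (g m * fact (h m)))" for m
  have bound: "card (bases E r) * fact (r E) \<le> g (card E) * fact (h (card E))" if "(E, r) \<in> X" for E r
    using assms(2,3)[OF that] by (intro mult_le_mono fact_mono)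
  have S1: "mlop_solvable_in_time basis_list_inputs X T1"
    unfolding mlop_solvable_in_time_def
  proof (intro exI[of _ "enumerate_bases ;; solve_listed"] ballI, clarify)
    fix E r orc s assume X: "(E, r) \<in> X" and "(orc, s) \<in> basis_list_inputs E r"
    then obtain t s' where ts: "exec orc (enumerate_bases ;; solve_listed) s t s'" "s' ''out'' 0 = mlop E r"
      "t \<le> 1500 * (card (bases E r) * fact (r E))"
      using basis_list_inputs_solved assms(1) by metis
    moreover have "1500 * (card (bases E r) * fact (r E)) \<le> T1 (card E)"
      unfolding T1_def by (rule mult_le_mono2[OF bound[OF X]])
    ultimately show "\<exists>t s'. exec orc (enumerate_bases ;; solve_listed) s t s' \<and> s' ''out'' 0 = mlop E r \<and>
      t \<le> T1 (card E)" by (meson order_trans)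
  qed
  have S2: "mlop_solvable_in_time rank_oracle_inputs X T2"
    unfolding mlop_solvable_in_time_def
  proof (intro exI[of _ "enumerate_by_rank ;; solve_listed"] ballI, clarify)
    fix E r orc s assume X: "(E, r) \<in> X" and "(orc, s) \<in> rank_oracle_inputs E r"
    then obtain t s' where ts: "exec orc (enumerate_by_rank ;; solve_listed) s t s'" "s' ''out'' 0 = mlop E r"
      "t \<le> 600 * ((card E + 1) ^ 2 * (card (bases E r) * fact (r E)))"
      using rank_oracle_inputs_solved assms(1) by metis
    moreover have "600 * ((card E + 1) ^ 2 * (card (bases E r) * fact (r E))) \<le> T2 (card E)"
      unfolding T2_def by (intro mult_le_mono2 bound[OF X])
    ultimately show "\<exists>t s'. exec orc (enumerate_by_rank ;; solve_listed) s t s' \<and> s' ''out'' 0 = mlop E r \<and>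
      t \<le> T2 (card E)" by (meson order_trans)
  qed
  let ?G = "\<lambda>m. real (g m) * fact (h m)"
  have O1: "(\<lambda>m. real (T1 m)) \<in> O(?G)"
    by (simp add: T1_def)
  have O2: "(\<lambda>m. real (T2 m)) \<in> O(\<lambda>m. real m ^ 2 * ?G m)"
  proof (rule bigoI)
    \<comment> \<open>For \<open>m \<ge> 1\<close> one has \<open>m + 1 \<le> 2 * m\<close>, so
      squaring costs a factor 4, and \<open>4 * 600 = 2400\<close>.\<close>
    show "\<forall>\<^sub>F m in sequentially. norm (real (T2 m)) \<le> 2400 * norm (real m ^ 2 * ?G m)"
      using eventually_ge_at_top[of 1]
    proof eventually_elim
      case (elim m)
      then have "(real m + 1) ^ 2 \<le> (2 * real m) ^ 2" by (intro power_mono) auto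
      then have "(real m + 1) ^ 2 * ?G m \<le> 4 * real m ^ 2 * ?G m"
        by (intro mult_right_mono) (auto simp: power_mult_distrib)
      moreover have "real (T2 m) = 600 * ((real m + 1) ^ 2 * ?G m)" by (simp add: T2_def add.commute)
      ultimately have "real (T2 m) \<le> 2400 * (real m ^ 2 * ?G m)" by linarith
      then show ?case by simp
    qed
  qed
  have "mlop_in_P basis_list_inputs X \<and> mlop_in_P rank_oracle_inputs X"
    if "\<exists>p :: real poly. \<forall>m. real (g m) = poly p (real m)" "\<exists>K. \<forall>m. h m \<le> K"
  proof -
    from that obtain p :: "real poly" and K where p: "\<And>m. real (g m) = poly p (real m)" and K: "\<And>m. h m \<le> K"
      by auto
    have "(\<lambda>m. fact (h m) :: real) \<in> O(\<lambda>_. 1)"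
      by (rule bigoI[of _ "fact K"]) (use K in \<open>auto intro!: always_eventually fact_mono\<close>)
    then have G: "?G \<in> O(\<lambda>m. real m ^ degree p)"
      using landau_o.big.mult[OF poly_bigo_power[of p], of "\<lambda>m. fact (h m)" "\<lambda>_. 1"] by (simp add: p)
    have "mlop_in_P basis_list_inputs X"
      unfolding mlop_in_P_def using S1 landau_o.big_trans[OF O1 G] by blast
    moreover have "(\<lambda>m. real (T2 m)) \<in> O(\<lambda>m. real m ^ (2 + degree p))"
      using landau_o.big_trans[OF O2 landau_o.big.mult[OF landau_o.big_refl G]]
      by (simp only: power_add)
    then have "mlop_in_P rank_oracle_inputs X" unfolding mlop_in_P_def using S2 by blast
    ultimately show ?thesis ..
  qed
  then show ?thesis using S1 S2 O1 O2 by blast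
qed

end
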